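(* Let $D$ be a domain in the extended complex plane $\overline{\mathbb C}$ and let $z_0$ be a finite accessible boundary point of $D$. Suppose that in some neighborhood of $z_0$ the boundary $\partial D$ is represented by an analytic arc $\gamma$. Then for every set $E\subset D$ that is relatively closed with respect to $D$ and satisfies $\rho(E,z_0)>0$, the expansion $$\frac{r(D\setminus E,z)}{r(D,z)}=1-c\,|z-z_0|^2+o(|z-z_0|^2),\qquad z\to z_0,$$ holds, where $z$ tends to $z_0$ along a path in $D$ perpendicular to the arc $\gamma$ at $z_0$, and where $c\ge 0$ is a constant depending only on the set $E$, the domain $D$ and the point $z_0$.
   Context: For an open set $G\subset\overline{\mathbb C}$ and a finite point $z\in G$, $r(G,z)$ denotes the inner radius at $z$ of the connected component $G_z$ of $G$ containing $z$: $\log r(G,z)=\lim_{w\to z}\bigl(g_{G_z}(w,z)+\log|w-z|\bigr)$, where $g_{G_z}(\cdot,z)$ is the Green function of $G_z$ with pole at $z$. $\rho(E,z_0)$ denotes the inner distance from the accessible boundary point $z_0$ to $E$ with respect to $D$, i.e. the infimum of the lengths of curves lying in $D$ that join $z_0$ (as an accessible boundary point) to points of $E$; $\rho(\emptyset,z_0)=\infty$. *)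

theory Defs
  imports "HOL-Analysis.Analysis" "HOL-Library.Landau_Symbols"
begin

section \<open>The extended plane\<close>

text \<open>The point at infinity is \<^term>\<open>None\<close>; a finite point \<open>z\<close> is \<open>Some z\<close>.\<close>

abbreviation extended_plane :: "complex option topology" where
  "extended_plane \<equiv> Alexandroff_compactification euclidean"

text \<open>The chart at infinity, \<open>w \<mapsto> 1/w\<close>.\<close>

definition inv_chart :: "complex \<Rightarrow> complex option" where
  "inv_chart w = (if w = 0 then None else Some (inverse w))"

definition plane_domain :: "complex option set \<Rightarrow> bool" where
  "plane_domain D \<longleftrightarrow> D \<noteq> {} \<and> openin extended_plane D \<and> connectedin extended_plane D"

section \<open>Harmonic functions\<close>

text \<open>Functions of class \<open>C\<^sup>2\<close> satisfying Laplace's equation.\<close>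

definition harmonic_on :: "(complex \<Rightarrow> real) \<Rightarrow> complex set \<Rightarrow> bool" where
  "harmonic_on u S \<longleftrightarrow> open S \<and>
     (\<exists>ux uy uxx uxy uyx uyy.
        continuous_on S uxx \<and> continuous_on S uxy \<and>
        continuous_on S uyx \<and> continuous_on S uyy \<and>
        (\<forall>z\<in>S. (u has_derivative (\<lambda>h. ux z * Re h + uy z * Im h)) (at z) \<and>
               (ux has_derivative (\<lambda>h. uxx z * Re h + uxy z * Im h)) (at z) \<and>
               (uy has_derivative (\<lambda>h. uyx z * Re h + uyy z * Im h)) (at z) \<and>
               uxx z + uyy z = 0))"

definition harmonic_on_ext :: "(complex option \<Rightarrow> real) \<Rightarrow> complex option set \<Rightarrow> bool" where
  "harmonic_on_ext u G \<longleftrightarrow>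
     harmonic_on (u \<circ> Some) (Some -` G) \<and> harmonic_on (u \<circ> inv_chart) (inv_chart -` G)"

section \<open>Green function and inner radius\<close>

definition log_pole_family :: "complex option set \<Rightarrow> complex \<Rightarrow> (complex option \<Rightarrow> real) set" where
  "log_pole_family G z =
     {u. harmonic_on_ext u (G - {Some z}) \<and> (\<forall>w \<in> G - {Some z}. 0 \<le> u w) \<and>
         (\<exists>l. ((\<lambda>w. u (Some w) + ln (cmod (w - z))) \<longlongrightarrow> l) (at z))}"

text \<open>
  The Green function of a domain \<open>G\<close> with finite pole \<open>z\<close> is the least nonnegative harmonic
  function on \<open>G - {z}\<close> with singularity \<open>- log |w - z|\<close> at \<open>z\<close>.  This determines it on
  \<open>G - {z}\<close>; no regularity of the boundary of \<open>G\<close> is needed.  It exists whenever the complement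
  of \<open>G\<close> contains a nondegenerate continuum; if it does not exist, the values below are
  unspecified.
\<close>

definition is_green_function ::
    "complex option set \<Rightarrow> complex \<Rightarrow> (complex option \<Rightarrow> real) \<Rightarrow> bool" where
  "is_green_function G z g \<longleftrightarrow>
     g \<in> log_pole_family G z \<and>
     (\<forall>u \<in> log_pole_family G z. \<forall>w \<in> G - {Some z}. g w \<le> u w)"

definition green_function :: "complex option set \<Rightarrow> complex \<Rightarrow> complex option \<Rightarrow> real" where
  "green_function G z = (SOME g. is_green_function G z g)"

definition component_at :: "complex option set \<Rightarrow> complex \<Rightarrow> complex option set" where
  "component_at G z = connected_component_of_set (subtopology extended_plane G) (Some z)"

definition inner_radius :: "complex option set \<Rightarrow> complex \<Rightarrow> real" where
  "inner_radius G z =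
     exp (Lim (at z) (\<lambda>w. green_function (component_at G z) z (Some w) + ln (cmod (w - z))))"

section \<open>Accessible boundary points and inner distance\<close>

text \<open>
  An accessible boundary point of \<open>D\<close> over a finite point \<open>z0\<close> is a class of paths in \<open>D\<close> ending
  at the boundary point \<open>z0\<close>; two paths are equivalent if, in every disc about \<open>z0\<close>, they
  eventually run in the same component of the part of \<open>D\<close> in that disc.  Thus a point of a slit
  carries one accessible point for each side.  Paths in the finite plane suffice, as \<open>z0\<close> is finite.
\<close>

definition end_paths :: "complex option set \<Rightarrow> complex \<Rightarrow> (real \<Rightarrow> complex) set" where
  "end_paths D z0 =
     {p. path p \<and> pathfinish p = z0 \<and> Some ` p ` {0..<1} \<subseteq> D \<and>
         Some z0 \<in> extended_plane frontier_of D}"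

definition end_equiv ::
    "complex option set \<Rightarrow> complex \<Rightarrow> ((real \<Rightarrow> complex) \<times> (real \<Rightarrow> complex)) set" where
  "end_equiv D z0 =
     {(p, q). p \<in> end_paths D z0 \<and> q \<in> end_paths D z0 \<and>
        (\<forall>e>0. \<exists>s\<in>{0..<1}. \<forall>t\<in>{s..<1}. \<forall>t'\<in>{s..<1}.
           connected_component (Some -` D \<inter> ball z0 e) (p t) (q t'))}"

definition accessible_points :: "complex option set \<Rightarrow> complex \<Rightarrow> (real \<Rightarrow> complex) set set" where
  "accessible_points D z0 = end_paths D z0 // end_equiv D z0"

definition curve_length :: "(real \<Rightarrow> complex) \<Rightarrow> ennreal" where
  "curve_length p =
     (SUP (n, s) \<in> {(n :: nat, s :: nat \<Rightarrow> real). mono s \<and> range s \<subseteq> {0..1}}.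
        ennreal (\<Sum>i<n. dist (p (s i)) (p (s (Suc i)))))"

text \<open>
  The inner distance from the accessible point \<open>a\<close> to \<open>E\<close>.  The members of \<open>a\<close> are the finite
  curves in \<open>D\<close> joining it to their initial points; curves through infinity have infinite length
  and would not affect the infimum.  For \<open>E = {}\<close> the value is \<open>\<infinity>\<close>.
\<close>

definition inner_distance :: "complex option set \<Rightarrow> (real \<Rightarrow> complex) set \<Rightarrow> ennreal" where
  "inner_distance E a = (INF p \<in> {p \<in> a. Some (pathstart p) \<in> E}. curve_length p)"

section \<open>Analytic boundary arcs\<close>

definition analytic_arc :: "(real \<Rightarrow> complex) \<Rightarrow> bool" where
  "analytic_arc \<gamma> \<longleftrightarrow> arc \<gamma> \<and>
     (\<exists>f. f analytic_on of_real ` {0..1} \<and>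
          (\<forall>t\<in>{0..1}. \<gamma> t = f (of_real t) \<and> deriv f (of_real t) \<noteq> 0))"

text \<open>The point \<open>z0\<close> is an interior point of the arc, not one of its end points.\<close>

definition boundary_arc_near ::
    "complex option set \<Rightarrow> complex \<Rightarrow> (real \<Rightarrow> complex) \<Rightarrow> bool" where
  "boundary_arc_near D z0 \<gamma> \<longleftrightarrow> analytic_arc \<gamma> \<and> z0 \<in> \<gamma> ` {0<..<1} \<and>
     (\<exists>U. open U \<and> z0 \<in> U \<and>
          Some -` (extended_plane frontier_of D) \<inter> U = path_image \<gamma> \<inter> U)"

text \<open>
  The path \<open>p\<close>, ending at the point \<open>z0\<close> of \<open>\<gamma>\<close>, has there a one-sided tangent \<open>v\<close> orthogonal
  to \<open>\<gamma>\<close>.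
\<close>

definition ends_perpendicular_to ::
    "(real \<Rightarrow> complex) \<Rightarrow> (real \<Rightarrow> complex) \<Rightarrow> complex \<Rightarrow> bool" where
  "ends_perpendicular_to p \<gamma> z0 \<longleftrightarrow>
     (\<exists>t0\<in>{0<..<1}. \<gamma> t0 = z0 \<and>
       (\<exists>v. ((\<lambda>t. sgn (p t - z0)) \<longlongrightarrow> v) (at_left 1) \<and>
            v \<bullet> vector_derivative \<gamma> (at t0) = 0))"

end

theory Submission
  imports Defs "HOL-Complex_Analysis.Complex_Analysis"
begin

text \<open>
  Let \<open>G\<close> be the component of \<open>D - E\<close> containing \<open>z\<close>. The logarithm of the quotient of the inner radii
  is \<open>- h z z\<close>, where \<open>h w z = g\<^sub>D w z - g\<^sub>G w z\<close> is the difference of the Green functions. In a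
  conformal coordinate that straightens the boundary arc to the real axis, \<open>h\<close> is harmonic in each
  variable and vanishes on the axis, so the Poisson formula for the odd reflection gives
  \<open>h w z = Im w Im z K w z\<close> with \<open>K\<close> continuous up to the axis; hence \<open>h z z = k (Im z)\<^sup>2 + o((Im z)\<^sup>2)\<close>,
  and \<open>Im z\<close> is proportional to the distance from \<open>z0\<close> in the first order on a perpendicular path.

  A chart onto a bounded plane set, obtained from a square root that is single-valued off a boundary
  subarc away from \<open>z0\<close>, turns the Green function into \<open>v\<^sub>z w - ln |w - z|\<close>, where \<open>v\<^sub>z\<close> is the least
  superharmonic majorant of \<open>ln |w - z|\<close> (Perron). Symmetry in \<open>z\<close> and \<open>w\<close> follows from minimality once
  \<open>z \<mapsto> v\<^sub>z w\<close> is known to be superharmonic. For this, average \<open>N\<close> poles equally spaced on a circle about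
  \<open>a\<close>: since \<open>\<Prod> |w - z\<^sub>k| = |(w - a)\<^sup>N - (z\<^sub>0 - a)\<^sup>N|\<close>, the mean of the logarithms exceeds \<open>ln |w - a|\<close>
  by at most \<open>ln 2 / N\<close> off the disc, and the same bound passes to the majorants.
\<close>

section \<open>Circle means\<close>

text \<open>Nothing is known about the boundary of \<open>G\<close> away from the arc, since
  \<open>E\<close> is an arbitrary relatively closed set. Minimality takes the place of boundary
  values: upper bounds for Green functions come from exhibiting superharmonic competitors. Only on
  the arc are boundary values required, and there the inequality \<open>0 \<le> h \<le> g\<close>,
  with \<open>g\<close> the Green function of the larger domain \<open>D\<close>, reduces the matter
  to a barrier for \<open>D\<close>. The obstacle is the dependence on the pole. Each pole has its
  own Perron family, so the regularity of \<open>h w z\<close> in \<open>z\<close> is not visible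
  from the construction; symmetry transfers the estimates in \<open>w\<close> to \<open>z\<close>,
  and a second factor \<open>Im z\<close> is gained. The set \<open>E\<close> may accumulate at
  \<open>z0\<close> from the other side of the arc. Positive inner distance keeps it only out of a
  half disc on the side of the accessible point, and the local analysis takes place in that half
  disc. As it is connected, the component \<open>G\<close> is the same for all \<open>z\<close> in
  it. The derivative of the bounded chart enters both inner radii equally and cancels in the
  quotient.\<close>

definition circ :: "real \<Rightarrow> real \<Rightarrow> complex" where
  "circ r t = of_real r * cis (2 * pi * t)"

text \<open>Angles are measured in turns, so the parameter interval has length 1 and the mean needs
  no normalising factor.\<close>

definition circle_mean :: "(complex \<Rightarrow> real) \<Rightarrow> complex \<Rightarrow> real \<Rightarrow> real" where
  "circle_mean u c r = integral {0..1} (\<lambda>t. u (c + circ r t))"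

lemma norm_circ [simp]: "norm (circ r t) = \<bar>r\<bar>"
  by (simp add: circ_def norm_mult)

lemma circ_0 [simp]: "circ r 0 = of_real r"
  by (simp add: circ_def)

lemma continuous_on_circ [continuous_intros]: "continuous_on A (circ r)"
  unfolding circ_def by (intro continuous_intros)

lemma circ_mem: "0 \<le> r \<Longrightarrow> c + circ r t \<in> sphere c r"
  by (simp add: dist_norm)

lemma sphere_circ:
  assumes "x \<in> sphere c r"
  obtains t where "t \<in> {0..1}" "x = c + circ r t"
proof -
  have "norm (x - c) = r"
    using assms by (simp add: dist_norm norm_minus_commute)
  then have "x - c = circ r (Arg2pi (x - c) / (2 * pi))"
    using Arg2pi_eq [of "x - c"] by (simp add: circ_def cis_conv_exp mult.commute)
  moreover have "Arg2pi (x - c) / (2 * pi) \<in> {0..1}"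
    using Arg2pi_lt_2pi [of "x - c"] Arg2pi_ge_0 [of "x - c"] by simp
  ultimately show thesis
    using that by (metis add.commute diff_add_cancel)
qed

lemma continuous_on_circle:
  assumes "continuous_on (sphere c r) u" "0 \<le> r"
  shows "continuous_on A (\<lambda>t. u (c + circ r t))"
  by (rule continuous_on_compose2 [OF assms(1)]) (use assms(2) in \<open>auto intro!: continuous_intros simp: dist_norm\<close>)

lemma integrable_on_circle:
  fixes u :: "complex \<Rightarrow> 'a::banach"
  assumes "continuous_on (sphere c r) u" "0 \<le> r"
  shows "(\<lambda>t. u (c + circ r t)) integrable_on {a..b}"
  by (intro integrable_continuous_interval continuous_on_circle assms)

lemma circle_mean_mono:
  assumes "continuous_on (sphere c r) u" "continuous_on (sphere c r) v" "0 \<le> r"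
    and "\<And>x. x \<in> sphere c r \<Longrightarrow> u x \<le> v x"
  shows "circle_mean u c r \<le> circle_mean v c r"
  unfolding circle_mean_def
  by (intro integral_le integrable_on_circle assms) (use assms circ_mem in auto)

lemma circle_mean_cong:
  assumes "0 \<le> r" "\<And>x. x \<in> sphere c r \<Longrightarrow> u x = v x"
  shows "circle_mean u c r = circle_mean v c r"
  unfolding circle_mean_def using assms circ_mem by (intro integral_cong) auto

lemma circle_mean_const [simp]: "circle_mean (\<lambda>_. k) c r = k"
  by (simp add: circle_mean_def)

lemma circle_mean_add:
  assumes "continuous_on (sphere c r) u" "continuous_on (sphere c r) v" "0 \<le> r"
  shows "circle_mean (\<lambda>x. u x + v x) c r = circle_mean u c r + circle_mean v c r"
  unfolding circle_mean_def by (intro integral_add integrable_on_circle assms)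

lemma circle_mean_cmult: "circle_mean (\<lambda>x. k * u x) c r = k * circle_mean u c r"
  unfolding circle_mean_def by simp

text \<open>Cauchy's formula at the centre: the derivative \<open>2 * pi * \<i> * circ r t\<close>
  of the circle cancels the kernel \<open>1 / (u - c)\<close>.\<close>

lemma holomorphic_circle_mean:
  assumes "f holomorphic_on ball c R" "0 < r" "r < R"
  shows "((\<lambda>t. f (c + circ r t)) has_integral f c) {0..1}"
proof -
  have "((\<lambda>u. f u/(u-c)) has_contour_integral (2 * of_real pi * \<i> * f c)) (circlepath c r)"
    using assms
    by (intro Cauchy_integral_circlepath holomorphic_on_imp_continuous_on)
       (auto elim!: holomorphic_on_subset simp: subset_iff)
  then have "((\<lambda>x. f (circlepath c r x) / (circlepath c r x - c) *
      vector_derivative (circlepath c r) (at x within {0..1})) has_integral 2 * of_real pi * \<i> * f c) {0..1}"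
    by (simp add: has_contour_integral_def)
  then have "((\<lambda>t. 2 * of_real pi * \<i> * f (c + circ r t)) has_integral 2 * of_real pi * \<i> * f c) {0..1}"
  proof (rule has_integral_eq [rotated])
    fix t :: real assume t: "t \<in> {0..1}"
    have cp: "circlepath c r t = c + circ r t"
      by (simp add: circlepath circ_def cis_conv_exp mult_ac)
    have vd: "vector_derivative (circlepath c r) (at t within {0..1}) = 2 * of_real pi * \<i> * circ r t"
      using t by (simp add: vector_derivative_circlepath01 circ_def cis_conv_exp mult_ac)
    have "circ r t \<noteq> 0"
      using assms by (simp add: circ_def)
    then show "f (circlepath c r t) / (circlepath c r t - c) *
        vector_derivative (circlepath c r) (at t within {0..1}) = 2 * of_real pi * \<i> * f (c + circ r t)"
      by (simp add: cp vd)
  qed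
  from has_integral_mult_right [OF this, of "inverse (2 * of_real pi * \<i>)"] show ?thesis
    by (simp add: field_simps)
qed

section \<open>Superharmonic functions and the minimum principle\<close>

text \<open>Requiring the super-mean value property on small circles only makes the notion local, so that
  pasting functions is unproblematic.\<close>

definition superharmonic :: "(complex \<Rightarrow> real) \<Rightarrow> complex set \<Rightarrow> bool" where
  "superharmonic u G \<longleftrightarrow> open G \<and> continuous_on G u \<and>
     (\<forall>x\<in>G. \<exists>e>0. cball x e \<subseteq> G \<and> (\<forall>r. 0 < r \<and> r < e \<longrightarrow> circle_mean u x r \<le> u x))"

lemma superharmonicI:
  assumes "open G" "continuous_on G u"
    and "\<And>x. x \<in> G \<Longrightarrow> \<exists>e>0. \<forall>r. 0 < r \<and> r < e \<longrightarrow> circle_mean u x r \<le> u x"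
  shows "superharmonic u G"
  unfolding superharmonic_def
proof (intro conjI ballI assms)
  fix x assume x: "x \<in> G"
  obtain e where e: "e > 0" "\<forall>r. 0 < r \<and> r < e \<longrightarrow> circle_mean u x r \<le> u x"
    using assms(3) x by blast
  obtain d where "d > 0" "cball x d \<subseteq> G"
    using x assms(1) open_contains_cball by blast
  then show "\<exists>e>0. cball x e \<subseteq> G \<and> (\<forall>r. 0 < r \<and> r < e \<longrightarrow> circle_mean u x r \<le> u x)"
    by (intro exI [of _ "min e d"]) (use e in \<open>auto simp: subset_iff\<close>)
qed

lemma superharmonicD:
  assumes "superharmonic u G" "x \<in> G"
  obtains e where "e > 0" "cball x e \<subseteq> G" "\<And>r. 0 < r \<Longrightarrow> r < e \<Longrightarrow> circle_mean u x r \<le> u x"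
  using assms unfolding superharmonic_def by blast

lemma superharmonic_open: "superharmonic u G \<Longrightarrow> open G"
  and superharmonic_continuous: "superharmonic u G \<Longrightarrow> continuous_on G u"
  by (auto simp: superharmonic_def)

lemma superharmonic_local:
  assumes "open G"
    and "\<And>x. x \<in> G \<Longrightarrow> \<exists>N v. x \<in> N \<and> superharmonic v N \<and> N \<subseteq> G \<and> (\<forall>y\<in>N. u y = v y)"
  shows "superharmonic u G"
proof (rule superharmonicI)
  show "continuous_on G u"
  proof (rule continuous_at_imp_continuous_on, rule ballI)
    fix x assume "x \<in> G"
    then obtain N v where N: "x \<in> N" "superharmonic v N" "N \<subseteq> G" "\<forall>y\<in>N. u y = v y"
      using assms(2) by blast
    then have "continuous_on N u"
      using superharmonic_continuous continuous_on_eq by metis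
    then show "isCont u x"
      using N superharmonic_open continuous_on_eq_continuous_at by blast
  qed
  fix x assume "x \<in> G"
  then obtain N v where N: "x \<in> N" "superharmonic v N" "N \<subseteq> G" "\<forall>y\<in>N. u y = v y"
    using assms(2) by blast
  obtain e where e: "e > 0" "cball x e \<subseteq> N" "\<And>r. 0 < r \<Longrightarrow> r < e \<Longrightarrow> circle_mean v x r \<le> v x"
    using superharmonicD [OF N(2,1)] by blast
  have "circle_mean u x r = circle_mean v x r" if "0 < r" "r < e" for r
    by (rule circle_mean_cong) (use that N e in \<open>auto simp: subset_iff\<close>)
  then show "\<exists>e>0. \<forall>r. 0 < r \<and> r < e \<longrightarrow> circle_mean u x r \<le> u x"
    using e N by (intro exI [of _ e]) auto
qed (rule assms)

lemma superharmonic_subset: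
  assumes "superharmonic u G" "open H" "H \<subseteq> G"
  shows "superharmonic u H"
proof (rule superharmonicI)
  show "continuous_on H u"
    using assms superharmonic_continuous continuous_on_subset by blast
qed (use assms in \<open>auto simp: superharmonic_def\<close>, blast)

lemma sphere_subset_cball_trans: "cball x e \<subseteq> G \<Longrightarrow> r < e \<Longrightarrow> sphere x r \<subseteq> G"
  by (auto simp: subset_iff)

lemma superharmonic_add:
  assumes u: "superharmonic u G" and v: "superharmonic v G"
  shows "superharmonic (\<lambda>x. u x + v x) G"
proof (rule superharmonicI)
  show "continuous_on G (\<lambda>x. u x + v x)"
    by (intro continuous_intros superharmonic_continuous assms)
  fix x assume x: "x \<in> G"
  obtain e where e: "e > 0" "cball x e \<subseteq> G" "\<And>r. 0 < r \<Longrightarrow> r < e \<Longrightarrow> circle_mean u x r \<le> u x"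
    using superharmonicD [OF u x] by blast
  obtain d where d: "d > 0" "cball x d \<subseteq> G" "\<And>r. 0 < r \<Longrightarrow> r < d \<Longrightarrow> circle_mean v x r \<le> v x"
    using superharmonicD [OF v x] by blast
  have "circle_mean (\<lambda>x. u x + v x) x r \<le> u x + v x" if r: "0 < r" "r < min d e" for r
  proof -
    have "sphere x r \<subseteq> G"
      using e r by (intro sphere_subset_cball_trans) auto
    then have "circle_mean (\<lambda>x. u x + v x) x r = circle_mean u x r + circle_mean v x r"
      using u v r by (intro circle_mean_add) (auto intro: continuous_on_subset superharmonic_continuous)
    then show ?thesis
      using e(3) [of r] d(3) [of r] r by simp
  qed
  then show "\<exists>e>0. \<forall>r. 0 < r \<and> r < e \<longrightarrow> circle_mean (\<lambda>x. u x + v x) x r \<le> u x + v x"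
    using d e by (intro exI [of _ "min d e"]) auto
qed (use u superharmonic_open in blast)

lemma superharmonic_cmult:
  assumes u: "superharmonic u G" and k: "k \<ge> 0"
  shows "superharmonic (\<lambda>x. k * u x) G"
proof (rule superharmonicI)
  show "continuous_on G (\<lambda>x. k * u x)"
    by (intro continuous_intros superharmonic_continuous assms)
  fix x assume x: "x \<in> G"
  obtain e where e: "e > 0" "cball x e \<subseteq> G" "\<And>r. 0 < r \<Longrightarrow> r < e \<Longrightarrow> circle_mean u x r \<le> u x"
    using superharmonicD [OF u x] by blast
  then show "\<exists>e>0. \<forall>r. 0 < r \<and> r < e \<longrightarrow> circle_mean (\<lambda>x. k * u x) x r \<le> k * u x"
    using k by (auto simp: circle_mean_cmult intro!: exI [of _ e] mult_left_mono)
qed (use u superharmonic_open in blast)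

lemma superharmonic_const: "open G \<Longrightarrow> superharmonic (\<lambda>_. k) G"
  by (rule superharmonicI) (auto intro: exI [of _ 1])

lemma superharmonic_min:
  assumes u: "superharmonic u G" and v: "superharmonic v G"
  shows "superharmonic (\<lambda>x. min (u x) (v x)) G"
proof (rule superharmonicI)
  show cont: "continuous_on G (\<lambda>x. min (u x) (v x))"
    by (intro continuous_intros superharmonic_continuous assms)
  fix x assume x: "x \<in> G"
  obtain e where e: "e > 0" "cball x e \<subseteq> G" "\<And>r. 0 < r \<Longrightarrow> r < e \<Longrightarrow> circle_mean u x r \<le> u x"
    using superharmonicD [OF u x] by blast
  obtain d where d: "d > 0" "cball x d \<subseteq> G" "\<And>r. 0 < r \<Longrightarrow> r < d \<Longrightarrow> circle_mean v x r \<le> v x"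
    using superharmonicD [OF v x] by blast
  have "circle_mean (\<lambda>x. min (u x) (v x)) x r \<le> min (u x) (v x)" if r: "0 < r" "r < min d e" for r
  proof -
    have s: "sphere x r \<subseteq> G"
      using e r by (intro sphere_subset_cball_trans) auto
    have "circle_mean (\<lambda>x. min (u x) (v x)) x r \<le> circle_mean u x r"
      using s r by (intro circle_mean_mono continuous_on_subset [OF cont]
          continuous_on_subset [OF superharmonic_continuous [OF u]]) auto
    moreover have "circle_mean (\<lambda>x. min (u x) (v x)) x r \<le> circle_mean v x r"
      using s r by (intro circle_mean_mono continuous_on_subset [OF cont]
          continuous_on_subset [OF superharmonic_continuous [OF v]]) auto
    ultimately show ?thesis
      using e(3) [of r] d(3) [of r] r by simp
  qed
  then show "\<exists>e>0. \<forall>r. 0 < r \<and> r < e \<longrightarrow> circle_mean (\<lambda>x. min (u x) (v x)) x r \<le> min (u x) (v x)"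
    using d e by (intro exI [of _ "min d e"]) auto
qed (use u superharmonic_open in blast)

text \<open>The nonnegative continuous function \<open>u - m\<close> has nonpositive mean, so its
  integral vanishes and with it the function. This equality case drives the minimum
  principle.\<close>

lemma circle_mean_min_eq:
  assumes cont: "continuous_on (sphere c r) u" and r: "0 \<le> r"
    and ge: "\<And>x. x \<in> sphere c r \<Longrightarrow> m \<le> u x" and le: "circle_mean u c r \<le> m"
    and x: "x \<in> sphere c r"
  shows "u x = m"
proof -
  let ?f = "\<lambda>t. u (c + circ r t) - m"
  have cf: "continuous_on {0..1} ?f"
    by (intro continuous_intros continuous_on_circle cont r)
  have nn: "0 \<le> ?f t" for t
    using ge circ_mem [OF r] by simp
  have "integral {0..1} ?f = circle_mean u c r - m"
    unfolding circle_mean_def using integrable_on_circle [OF cont r, of 0 1]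
    by (subst integral_diff) auto
  moreover have "integral {0..1} ?f \<ge> 0"
    by (rule integral_nonneg) (use cf nn in \<open>auto intro: integrable_continuous_interval\<close>)
  ultimately have "integral {0..1} ?f = 0"
    using le by linarith
  then have "(?f has_integral 0) (cbox 0 1)"
    using integrable_continuous_interval [OF cf] by (metis cbox_interval integrable_integral)
  moreover obtain t where "t \<in> {0..1}" "x = c + circ r t"
    using sphere_circ x by blast
  ultimately show ?thesis
    using has_integral_0_cbox_imp_0 [of 0 1 ?f t] cf nn by (simp add: box_real cbox_interval)
qed

text \<open>The condition at the frontier is an eventual bound within \<open>B\<close>, because
  \<open>S\<close> is often defined only inside \<open>B\<close> or has infinite limits at
  punctures.\<close>

theorem minimum_principle:
  assumes S: "superharmonic S B" and B: "bounded B"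
    and bd: "\<And>y e. y \<in> frontier B \<Longrightarrow> e > 0 \<Longrightarrow> \<forall>\<^sub>F x in at y within B. S x > - e"
    and x: "x \<in> B"
  shows "S x \<ge> 0"
proof (rule ccontr)
  assume neg: "\<not> S x \<ge> 0"
  have oB: "open B" and cS: "continuous_on B S"
    using S by (auto simp: superharmonic_def)
  \<comment> \<open>Near the frontier \<open>S\<close> exceeds the negative number
    \<open>S x\<close>, so this sublevel set cannot accumulate there and is compact.\<close>
  define K where "K = {y \<in> B. S y \<le> S x}"
  have "closed K"
    unfolding closed_sequential_limits
  proof (intro allI impI, elim conjE)
    fix s l assume sK: "\<forall>n. s n \<in> K" and lim: "s \<longlonglongrightarrow> l"
    have "l \<in> closure B"
      using sK lim unfolding closure_sequential K_def by blast
    have "l \<in> B"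
    proof (rule ccontr)
      assume nl: "l \<notin> B"
      then have "l \<in> frontier B"
        using \<open>l \<in> closure B\<close> oB by (simp add: frontier_def interior_open)
      then have "\<forall>\<^sub>F x' in at l within B. S x' > S x"
        using bd [of l "- S x"] neg by simp
      moreover have "filterlim s (at l within B) sequentially"
        using sK lim nl unfolding filterlim_at K_def
        by (auto simp: eventually_sequentially)
      ultimately have "\<forall>\<^sub>F n in sequentially. S (s n) > S x"
        by (auto dest: filterlim_iff [THEN iffD1, rule_format])
      then show False
        using sK by (auto simp: eventually_sequentially K_def not_less [symmetric])
    qed
    moreover have "(\<lambda>n. S (s n)) \<longlonglongrightarrow> S l"
      using cS \<open>l \<in> B\<close> sK lim unfolding K_def continuous_on_sequentially by (auto simp: o_def)
    then have "S l \<le> S x"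
      using sK by (intro LIMSEQ_le_const2) (auto simp: K_def)
    ultimately show "l \<in> K" by (simp add: K_def)
  qed
  then have K: "compact K"
    using B by (auto simp: compact_eq_bounded_closed K_def intro: bounded_subset)
  have cK: "continuous_on K S"
    using cS by (rule continuous_on_subset) (auto simp: K_def)
  obtain x0 where x0: "x0 \<in> K" "\<And>y. y \<in> K \<Longrightarrow> S x0 \<le> S y"
    using continuous_attains_inf [OF K _ cK] x by (auto simp: K_def)
  define L where "L = {y \<in> K. S y \<le> S x0}"
  have "closed L"
    using continuous_on_closed_Collect_le [OF cK continuous_on_const \<open>closed K\<close>] by (simp add: L_def)
  then have "compact L"
    using K by (auto simp: compact_eq_bounded_closed L_def intro: bounded_subset)
  \<comment> \<open>Among the points where the minimum is attained, take one farthest to the right: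
    a small circle about it consists of minimum points, yet contains a point farther right. This
    replaces the usual connectedness argument.\<close>
  then obtain x1 where x1: "x1 \<in> L" "\<And>y. y \<in> L \<Longrightarrow> Re y \<le> Re x1"
  proof -
    have "\<exists>x\<in>L. \<forall>y\<in>L. Re y \<le> Re x"
      using \<open>compact L\<close> x0 by (intro continuous_attains_sup continuous_intros) (auto simp: L_def)
    then show thesis
      using that by blast
  qed
  have x1B: "x1 \<in> B" and m: "S x1 = S x0"
    using x1(1) x0 by (auto simp: L_def K_def intro: antisym)
  have glob: "S x0 \<le> S y" if "y \<in> B" for y
    using x0 that by (cases "y \<in> K") (auto simp: K_def intro: order_trans less_imp_le)
  obtain e where e: "e > 0" "cball x1 e \<subseteq> B" "\<And>r. 0 < r \<Longrightarrow> r < e \<Longrightarrow> circle_mean S x1 r \<le> S x1"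
    using superharmonicD [OF S x1B] by blast
  have sph: "sphere x1 (e/2) \<subseteq> B"
    using e by (intro sphere_subset_cball_trans) auto
  have p: "x1 + of_real (e/2) \<in> sphere x1 (e/2)"
    using circ_mem [of "e/2" x1 0] e by simp
  have "S (x1 + of_real (e/2)) = S x0"
  proof (rule circle_mean_min_eq [OF _ _ _ _ p])
    show "circle_mean S x1 (e/2) \<le> S x0"
      using e(3) [of "e/2"] e(1) m by simp
  qed (use sph e glob in \<open>auto intro: continuous_on_subset [OF cS]\<close>)
  then have "x1 + of_real (e/2) \<in> L"
    using sph p x0 by (auto simp: L_def K_def)
  then show False
    using x1(2) e by fastforce
qed

lemma minimum_principle_closure:
  assumes S: "superharmonic S B" and B: "bounded B"
    and cont: "continuous_on (closure B) S"
    and bd: "\<And>y. y \<in> frontier B \<Longrightarrow> S y \<ge> 0"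
    and x: "x \<in> closure B"
  shows "S x \<ge> 0"
proof (cases "x \<in> B")
  case True
  show ?thesis
  proof (rule minimum_principle [OF S B _ True])
    fix y e :: _ assume y: "y \<in> frontier B" "(e::real) > 0"
    then have "(S \<longlongrightarrow> S y) (at y within closure B)"
      using cont by (auto simp: continuous_on_def frontier_def)
    then have "(S \<longlongrightarrow> S y) (at y within B)"
      by (rule tendsto_within_subset) (rule closure_subset)
    then show "\<forall>\<^sub>F x in at y within B. - e < S x"
      using y bd [of y] by (intro order_tendstoD) auto
  qed
next
  case False
  then show ?thesis
    using x bd superharmonic_open [OF S] by (auto simp: frontier_def interior_open)
qed

section \<open>Harmonic functions through their complex gradient\<close>

text \<open>\<open>A\<close> is the complex gradient \<open>u\<^sub>x - \<i> u\<^sub>y\<close>.\<close>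

definition gradient_harmonic :: "(complex \<Rightarrow> real) \<Rightarrow> complex set \<Rightarrow> bool" where
  "gradient_harmonic u G \<longleftrightarrow> open G \<and>
     (\<exists>A. A holomorphic_on G \<and> (\<forall>z\<in>G. (u has_derivative (\<lambda>h. Re (A z * h))) (at z)))"

lemma gradient_harmonic_open: "gradient_harmonic u G \<Longrightarrow> open G"
  by (simp add: gradient_harmonic_def)

lemma gradient_harmonic_continuous: "gradient_harmonic u G \<Longrightarrow> continuous_on G u"
  unfolding gradient_harmonic_def
  by (meson continuous_at_imp_continuous_on has_derivative_continuous)

lemma gradient_harmonic_Re:
  assumes "F holomorphic_on G" "open G"
  shows "gradient_harmonic (\<lambda>z. Re (F z)) G"
  unfolding gradient_harmonic_def
proof (intro conjI exI [of _ "deriv F"] ballI assms)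
  show "deriv F holomorphic_on G"
    using assms holomorphic_deriv by blast
  fix z assume "z \<in> G"
  then have "(F has_field_derivative deriv F z) (at z)"
    using assms holomorphic_derivI by blast
  then have "(F has_derivative (\<lambda>h. deriv F z * h)) (at z)"
    by (simp add: has_field_derivative_def)
  then show "((\<lambda>z. Re (F z)) has_derivative (\<lambda>h. Re (deriv F z * h))) (at z)"
    by (rule has_derivative_Re)
qed

lemma gradient_harmonic_subset:
  "gradient_harmonic u G \<Longrightarrow> open H \<Longrightarrow> H \<subseteq> G \<Longrightarrow> gradient_harmonic u H"
  unfolding gradient_harmonic_def by (meson holomorphic_on_subset subsetD)

lemma gradient_harmonic_cong:
  assumes "gradient_harmonic u G" "\<And>z. z \<in> G \<Longrightarrow> u z = v z"
  shows "gradient_harmonic v G"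
  using assms unfolding gradient_harmonic_def
  by (metis has_derivative_transform_within_open)

lemma gradient_harmonic_const [simp]: "open G \<Longrightarrow> gradient_harmonic (\<lambda>_. k) G"
  using gradient_harmonic_Re [of "\<lambda>_. of_real k" G] by simp

lemma gradient_harmonic_add:
  assumes "gradient_harmonic u G" "gradient_harmonic v G"
  shows "gradient_harmonic (\<lambda>z. u z + v z) G"
proof -
  obtain A B where "A holomorphic_on G" "\<forall>z\<in>G. (u has_derivative (\<lambda>h. Re (A z * h))) (at z)"
    "B holomorphic_on G" "\<forall>z\<in>G. (v has_derivative (\<lambda>h. Re (B z * h))) (at z)" "open G"
    using assms unfolding gradient_harmonic_def by blast
  then show ?thesis
    unfolding gradient_harmonic_def
    by (intro conjI exI [of _ "\<lambda>z. A z + B z"] ballI holomorphic_intros)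
       (auto intro!: derivative_eq_intros simp: fun_eq_iff algebra_simps)
qed

lemma gradient_harmonic_cmult:
  assumes "gradient_harmonic u G"
  shows "gradient_harmonic (\<lambda>z. k * u z) G"
proof -
  obtain A where "A holomorphic_on G" "\<forall>z\<in>G. (u has_derivative (\<lambda>h. Re (A z * h))) (at z)" "open G"
    using assms unfolding gradient_harmonic_def by blast
  then show ?thesis
    unfolding gradient_harmonic_def
    by (intro conjI exI [of _ "\<lambda>z. of_real k * A z"] ballI holomorphic_intros)
       (auto intro!: derivative_eq_intros simp: fun_eq_iff algebra_simps)
qed

lemma gradient_harmonic_minus: "gradient_harmonic u G \<Longrightarrow> gradient_harmonic (\<lambda>z. - u z) G"
  using gradient_harmonic_cmult [of u G "-1"] by simp

lemma gradient_harmonic_diff: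
  "gradient_harmonic u G \<Longrightarrow> gradient_harmonic v G \<Longrightarrow> gradient_harmonic (\<lambda>z. u z - v z) G"
  using gradient_harmonic_add [of u G "\<lambda>z. - v z"] gradient_harmonic_minus [of v G] by simp

lemma gradient_harmonic_compose:
  assumes u: "gradient_harmonic u G" and f: "f holomorphic_on H" "open H" "f ` H \<subseteq> G"
  shows "gradient_harmonic (\<lambda>z. u (f z)) H"
proof -
  obtain A where A: "A holomorphic_on G" "\<And>z. z \<in> G \<Longrightarrow> (u has_derivative (\<lambda>h. Re (A z * h))) (at z)"
    using u unfolding gradient_harmonic_def by blast
  have "(\<lambda>z. A (f z)) holomorphic_on H"
    using holomorphic_on_compose_gen [OF f(1) A(1)] f(3) by (auto simp: o_def)
  moreover have "deriv f holomorphic_on H"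
    using f holomorphic_deriv by blast
  moreover have "((\<lambda>z. u (f z)) has_derivative (\<lambda>h. Re (A (f z) * deriv f z * h))) (at z)" if "z \<in> H" for z
  proof -
    have "(f has_derivative (\<lambda>h. deriv f z * h)) (at z)"
      using f that holomorphic_derivI by (auto simp flip: has_field_derivative_def)
    moreover have "(u has_derivative (\<lambda>h. Re (A (f z) * h))) (at (f z))"
      using A f that by blast
    ultimately show ?thesis
      using has_derivative_compose by (fastforce simp: mult.assoc)
  qed
  ultimately show ?thesis
    unfolding gradient_harmonic_def using f
    by (intro conjI exI [of _ "\<lambda>z. A (f z) * deriv f z"] holomorphic_intros) auto
qed

lemma Re_mult_inject: "(\<lambda>h. Re (a * h)) = (\<lambda>h. Re (b * h)) \<longleftrightarrow> a = b"
proof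
  assume "(\<lambda>h. Re (a * h)) = (\<lambda>h. Re (b * h))"
  then have "Re (a * 1) = Re (b * 1)" "Re (a * \<i>) = Re (b * \<i>)"
    by metis+
  then show "a = b" by (simp add: complex_eq_iff)
qed auto

text \<open>The coefficient of the derivative is unique, so local complex gradients agree on
  overlaps and glue to one holomorphic function.\<close>

lemma gradient_harmonic_local:
  assumes G: "open G" and loc: "\<And>x. x \<in> G \<Longrightarrow> \<exists>N. x \<in> N \<and> gradient_harmonic u N"
  shows "gradient_harmonic u G"
proof -
  define A where "A z = (SOME a. (u has_derivative (\<lambda>h. Re (a * h))) (at z))" for z
  have A_eq: "A z = a" if "(u has_derivative (\<lambda>h. Re (a * h))) (at z)" for z a
  proof -
    have "(u has_derivative (\<lambda>h. Re (A z * h))) (at z)"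
      unfolding A_def using that by (rule someI)
    then show ?thesis
      using that has_derivative_unique Re_mult_inject by blast
  qed
  have "A field_differentiable (at x) \<and> (u has_derivative (\<lambda>h. Re (A x * h))) (at x)" if x: "x \<in> G" for x
  proof -
    obtain N a where N: "x \<in> N" "open N" "a holomorphic_on N" "\<And>z. z \<in> N \<Longrightarrow> (u has_derivative (\<lambda>h. Re (a z * h))) (at z)"
      using loc [OF x] unfolding gradient_harmonic_def by blast
    then have "A z = a z" if "z \<in> N" for z
      using A_eq that by blast
    then have "A holomorphic_on N"
      using N(3) holomorphic_transform by metis
    then show ?thesis
      using N \<open>\<And>z. z \<in> N \<Longrightarrow> A z = a z\<close> by (auto simp: holomorphic_on_open field_differentiable_def)
  qed
  then show ?thesis
    unfolding gradient_harmonic_def using G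
    by (intro conjI exI [of _ A]) (auto simp: holomorphic_on_def field_differentiable_at_within)
qed

text \<open>On a disc the complex gradient has a holomorphic primitive; its real part differs from
  \<open>u\<close> by a constant, which is absorbed into \<open>F\<close>.\<close>

lemma gradient_harmonic_ball_Re:
  assumes "gradient_harmonic u G" "ball x R \<subseteq> G"
  obtains F where "F holomorphic_on ball x R" "\<And>z. z \<in> ball x R \<Longrightarrow> u z = Re (F z)"
proof (cases "R > 0")
  case True
  obtain A where A: "A holomorphic_on G" "\<And>z. z \<in> G \<Longrightarrow> (u has_derivative (\<lambda>h. Re (A z * h))) (at z)"
    using assms(1) unfolding gradient_harmonic_def by blast
  have "A holomorphic_on ball x R"
    using A(1) assms(2) holomorphic_on_subset by blast
  then obtain g where g: "\<And>z. z \<in> ball x R \<Longrightarrow> (g has_field_derivative A z) (at z within ball x R)"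
    using holomorphic_convex_primitive' [of "ball x R" A] by auto
  then have g': "(g has_field_derivative A z) (at z)" if "z \<in> ball x R" for z
    using that by (metis at_within_open open_ball)
  let ?d = "\<lambda>z. u z - Re (g z)"
  have "(?d has_derivative (\<lambda>h. 0)) (at z within ball x R)" if z: "z \<in> ball x R" for z
  proof -
    have "z \<in> G" using z assms(2) by blast
    have "((\<lambda>z. Re (g z)) has_derivative (\<lambda>h. Re (A z * h))) (at z)"
      using g' [OF z] has_derivative_Re by (force simp: has_field_derivative_def)
    from has_derivative_diff [OF A(2) [OF \<open>z \<in> G\<close>] this] have "(?d has_derivative (\<lambda>h. 0)) (at z)"
      by simp
    then show ?thesis
      by (rule has_derivative_at_withinI)
  qed
  then obtain k where k: "\<And>z. z \<in> ball x R \<Longrightarrow> ?d z = k"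
    using has_derivative_zero_constant [of "ball x R" ?d] by auto
  show thesis
  proof
    show "(\<lambda>z. g z + of_real k) holomorphic_on ball x R"
      using g' by (intro holomorphic_intros) (auto simp: holomorphic_on_open simp del: mem_ball)
    show "u z = Re (g z + of_real k)" if "z \<in> ball x R" for z
      using k [OF that] by simp
  qed
next
  case False
  then have "ball x R = {}" by simp
  then show thesis
    using that [of "\<lambda>_. 0"] holomorphic_on_const by blast
qed

lemma has_integral_Re:
  assumes "(f has_integral I) S" shows "((\<lambda>t. Re (f t)) has_integral Re I) S"
  using has_integral_linear [OF assms bounded_linear_Re] by (simp add: o_def)

lemma gradient_harmonic_mean:
  assumes "gradient_harmonic u G" "ball x R \<subseteq> G" "0 < r" "r < R"
  shows "circle_mean u x r = u x"
proof -
  obtain F where F: "F holomorphic_on ball x R" "\<And>z. z \<in> ball x R \<Longrightarrow> u z = Re (F z)"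
    using gradient_harmonic_ball_Re assms by metis
  have "((\<lambda>t. F (x + circ r t)) has_integral F x) {0..1}"
    by (rule holomorphic_circle_mean) (use F assms in auto)
  then have "((\<lambda>t. Re (F (x + circ r t))) has_integral Re (F x)) {0..1}"
    by (rule has_integral_Re)
  then have "integral {0..1} (\<lambda>t. Re (F (x + circ r t))) = u x"
    using F assms by (simp add: integral_unique)
  moreover have "integral {0..1} (\<lambda>t. Re (F (x + circ r t))) = circle_mean u x r"
    unfolding circle_mean_def by (rule integral_cong) (use F assms in \<open>simp add: dist_norm\<close>)
  ultimately show ?thesis by simp
qed

lemma gradient_harmonic_superharmonic:
  assumes "gradient_harmonic u G"
  shows "superharmonic u G"
proof (rule superharmonicI)
  fix x assume "x \<in> G"
  then obtain e where "e > 0" "ball x e \<subseteq> G"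
    using gradient_harmonic_open [OF assms] open_contains_ball by blast
  then show "\<exists>e>0. \<forall>r. 0 < r \<and> r < e \<longrightarrow> circle_mean u x r \<le> u x"
    using gradient_harmonic_mean [OF assms] by (intro exI [of _ e]) auto
qed (use assms gradient_harmonic_open gradient_harmonic_continuous in auto)

lemma gradient_harmonic_imp_harmonic_on:
  assumes "gradient_harmonic u G"
  shows "harmonic_on u G"
proof -
  obtain A where A: "A holomorphic_on G" "\<And>z. z \<in> G \<Longrightarrow> (u has_derivative (\<lambda>h. Re (A z * h))) (at z)"
    and G: "open G"
    using assms unfolding gradient_harmonic_def by blast
  have dA: "(A has_derivative (\<lambda>h. deriv A z * h)) (at z)" if "z \<in> G" for z
    using A G that holomorphic_derivI by (auto simp flip: has_field_derivative_def)
  have "continuous_on G (deriv A)"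
    using A G holomorphic_deriv holomorphic_on_imp_continuous_on by blast
  then have c: "continuous_on G (\<lambda>z. Re (deriv A z))" "continuous_on G (\<lambda>z. - Re (deriv A z))"
     "continuous_on G (\<lambda>z. - Im (deriv A z))"
    by (intro continuous_intros; simp)+
  show ?thesis
    unfolding harmonic_on_def
    apply (rule conjI [OF G])
    apply (rule exI [of _ "\<lambda>z. Re (A z)"], rule exI [of _ "\<lambda>z. - Im (A z)"])
    apply (rule exI [of _ "\<lambda>z. Re (deriv A z)"], rule exI [of _ "\<lambda>z. - Im (deriv A z)"])
    apply (rule exI [of _ "\<lambda>z. - Im (deriv A z)"], rule exI [of _ "\<lambda>z. - Re (deriv A z)"])
  proof (intro conjI c ballI)
    fix z assume z: "z \<in> G"
    show "(u has_derivative (\<lambda>h. Re (A z) * Re h + - Im (A z) * Im h)) (at z)"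
      using A(2) [OF z] by simp
    show "((\<lambda>z. Re (A z)) has_derivative (\<lambda>h. Re (deriv A z) * Re h + - Im (deriv A z) * Im h)) (at z)"
      using has_derivative_Re [OF dA [OF z]] by simp
    show "((\<lambda>z. - Im (A z)) has_derivative (\<lambda>h. - Im (deriv A z) * Re h + - Re (deriv A z) * Im h)) (at z)"
      using has_derivative_minus [OF has_derivative_Im [OF dA [OF z]]] by (simp add: algebra_simps)
  qed auto
qed

section \<open>The Dirichlet problem for a disc\<close>

text \<open>Written as the real part of a function holomorphic in \<open>w\<close>, so that Poisson
  integrals are real parts of holomorphic functions; \<open>poisson_kernel_eq\<close> gives the
  familiar quotient.\<close>

definition poisson_kernel :: "complex \<Rightarrow> complex \<Rightarrow> real" where
  "poisson_kernel s w = Re ((s + w) / (s - w))"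

definition poisson :: "(complex \<Rightarrow> real) \<Rightarrow> complex \<Rightarrow> real \<Rightarrow> complex \<Rightarrow> real" where
  "poisson f c r z = integral {0..1} (\<lambda>t. f (c + circ r t) * poisson_kernel (circ r t) (z - c))"

lemma poisson_kernel_eq: "poisson_kernel s w = ((norm s)\<^sup>2 - (norm w)\<^sup>2) / (norm (s - w))\<^sup>2"
  unfolding poisson_kernel_def Re_divide cmod_power2
  by (simp add: algebra_simps power2_eq_square)

lemma poisson_kernel_nonneg: "norm w \<le> norm s \<Longrightarrow> poisson_kernel s w \<ge> 0"
  by (simp add: poisson_kernel_eq)

text \<open>The extreme case is \<open>(1 + 1/2) / (1 - 1/2) = 3\<close>; this becomes the Harnack
  constant.\<close>

lemma poisson_kernel_le3:
  assumes "norm w \<le> norm s / 2" shows "poisson_kernel s w \<le> 3"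
proof (cases "s = 0")
  case False
  have n: "norm s - norm w \<le> norm (s - w)" by (rule norm_triangle_ineq2)
  have p: "norm s - norm w > 0" using assms False by (smt (verit) field_sum_of_halves norm_le_zero_iff)
  have "(norm s)\<^sup>2 - (norm w)\<^sup>2 = (norm s - norm w) * (norm s + norm w)"
    by (simp add: algebra_simps power2_eq_square)
  also have "\<dots> \<le> (norm s - norm w) * (3 * (norm s - norm w))"
    using p assms by (intro mult_left_mono) auto
  also have "\<dots> = 3 * (norm s - norm w)\<^sup>2"
    by (simp add: power2_eq_square)
  also have "\<dots> \<le> 3 * (norm (s - w))\<^sup>2"
    using p power_mono [OF n, of 2] by simp
  finally show ?thesis
    using p n by (auto simp: poisson_kernel_eq divide_simps)
qed (simp add: poisson_kernel_def)

lemma continuous_on_poisson_kernel: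
  assumes "norm w < r"
  shows "continuous_on A (\<lambda>t. poisson_kernel (circ r t) w)"
proof -
  have "circ r t - w \<noteq> 0" for t
    using assms norm_circ [of r t] by auto
  then show ?thesis
    unfolding poisson_kernel_def by (intro continuous_intros) auto
qed

lemma poisson_integrand_continuous:
  assumes "continuous_on (sphere c r) f" "z \<in> ball c r"
  shows "continuous_on A (\<lambda>t. f (c + circ r t) * poisson_kernel (circ r t) (z - c))"
proof -
  have "0 \<le> r" "norm (z - c) < r"
    using assms(2) dist_norm [of c z] by (auto simp: dist_norm norm_minus_commute intro: order_trans [OF norm_ge_zero less_imp_le])
  then show ?thesis
    by (intro continuous_intros continuous_on_circle continuous_on_poisson_kernel assms)
qed

text \<open>On the circle \<open>s * cnj s = r^2\<close>, which turns the kernel into the real part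
  of \<open>q s\<close>, holomorphic in \<open>s\<close> with \<open>q 0 = 1\<close>; the mean value
  property does the rest.\<close>

lemma poisson_kernel_mean:
  assumes w: "norm w < r"
  shows "integral {0..1} (\<lambda>t. poisson_kernel (circ r t) w) = 1"
proof -
  have r: "r > 0" using w norm_ge_zero le_less_trans by blast
  define q where "q s = (of_real (r\<^sup>2) + cnj w * s) / (of_real (r\<^sup>2) - cnj w * s)" for s :: complex
  \<comment> \<open>For nonzero \<open>w\<close> the pole of \<open>q\<close> has modulus
    \<open>r^2 / norm w\<close>; \<open>R\<close> is the harmonic mean of this number and
    \<open>r\<close>, hence lies strictly between them.\<close>
  define R where "R = r * (2 * r / (r + norm w))"
  have p: "r + norm w > 0" using r by (simp add: add_pos_nonneg)
  have R: "r < R" "norm w * R < r\<^sup>2 \<or> w = 0"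
    using w r p by (auto simp: R_def field_simps power2_eq_square add_pos_nonneg)
  have nz: "of_real (r\<^sup>2) - cnj w * s \<noteq> 0" if "norm s < R" for s
  proof
    assume "of_real (r\<^sup>2) - cnj w * s = 0"
    then have "norm (of_real (r\<^sup>2) :: complex) = norm (cnj w * s)" by simp
    then have "r\<^sup>2 = norm w * norm s" using r by (simp add: norm_mult norm_power)
    moreover have "norm w * norm s \<le> norm w * R" using that by (intro mult_left_mono) auto
    ultimately show False using R r by auto
  qed
  have "q holomorphic_on ball 0 R"
    unfolding q_def using nz by (intro holomorphic_intros) auto
  then have "((\<lambda>t. q (0 + circ r t)) has_integral q 0) {0..1}"
    by (rule holomorphic_circle_mean) (use R r in auto)
  from has_integral_Re [OF this] have "((\<lambda>t. Re (q (circ r t))) has_integral Re (q 0)) {0..1}"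
    by simp
  moreover have "q 0 = 1" using r by (simp add: q_def)
  moreover have "Re (q (circ r t)) = poisson_kernel (circ r t) w" for t
  proof -
    define s where "s = circ r t"
    have s: "s \<noteq> 0" "s - w \<noteq> 0" "s * cnj s = of_real (r\<^sup>2)"
      using r w norm_circ [of r t] unfolding s_def complex_norm_square [symmetric] by (auto simp: circ_def)
    have "q s = (s * (cnj s + cnj w)) / (s * (cnj s - cnj w))"
      using s(3) by (simp add: q_def algebra_simps)
    also have "\<dots> = cnj ((s + w) / (s - w))"
      using s by simp
    finally have "Re (q s) = Re ((s + w) / (s - w))"
      by (simp only: cnj.sel)
    then show ?thesis
      by (simp add: poisson_kernel_def s_def)
  qed
  ultimately show ?thesis
    by (simp add: integral_unique)
qed

lemma poisson_center: "r > 0 \<Longrightarrow> poisson f c r c = circle_mean f c r"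
proof -
  assume "r > 0"
  then have "circ r t \<noteq> 0" for t by (simp add: circ_def)
  then show ?thesis by (simp add: poisson_def circle_mean_def poisson_kernel_def)
qed

lemma poisson_mono:
  assumes "continuous_on (sphere c r) f" "continuous_on (sphere c r) g" "z \<in> ball c r"
    and "\<And>x. x \<in> sphere c r \<Longrightarrow> f x \<le> g x"
  shows "poisson f c r z \<le> poisson g c r z"
proof -
  have r: "0 \<le> r" "norm (z - c) < r"
    using assms(3) by (auto simp: dist_norm norm_minus_commute intro: order_trans [OF norm_ge_zero less_imp_le])
  show ?thesis
    unfolding poisson_def
    by (intro integral_le integrable_continuous_interval poisson_integrand_continuous assms mult_right_mono
        poisson_kernel_nonneg circ_mem) (use r in auto)
qed

lemma poisson_const:
  assumes "z \<in> ball c r" shows "poisson (\<lambda>_. k) c r z = k"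
  using assms poisson_kernel_mean [of "z - c" r]
  by (simp add: poisson_def dist_norm norm_minus_commute)

lemma poisson_add:
  assumes "continuous_on (sphere c r) f" "continuous_on (sphere c r) g" "z \<in> ball c r"
  shows "poisson (\<lambda>x. f x + g x) c r z = poisson f c r z + poisson g c r z"
  unfolding poisson_def distrib_right
  by (intro integral_add integrable_continuous_interval poisson_integrand_continuous assms)

lemma poisson_harmonic:
  assumes f: "continuous_on (sphere c r) f"
  shows "gradient_harmonic (poisson f c r) (ball c r)"
proof (cases "r > 0")
  case True
  define F where "F z = integral (cbox 0 1)
    (\<lambda>t. of_real (f (c + circ r t)) * ((circ r t + (z - c)) / (circ r t - (z - c))))" for z
  have nz: "circ r t - (z - c) \<noteq> 0" if "z \<in> ball c r" for z t
  proof
    assume "circ r t - (z - c) = 0"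
    then have "norm (z - c) = \<bar>r\<bar>" using norm_circ [of r t] by simp
    then show False using that True by (simp add: dist_norm norm_minus_commute)
  qed
  have cf: "continuous_on A (\<lambda>t. f (c + circ r t))" for A
    using continuous_on_circle [OF f] True by simp
  have "F holomorphic_on ball c r"
    unfolding F_def
  proof (rule leibniz_rule_holomorphic)
    fix z t assume z: "z \<in> ball c r"
    show "((\<lambda>z. of_real (f (c + circ r t)) * ((circ r t + (z - c)) / (circ r t - (z - c)))) has_field_derivative
        of_real (f (c + circ r t)) * (2 * circ r t / (circ r t - (z - c))\<^sup>2)) (at z within ball c r)"
      using nz [OF z, of t] by (auto intro!: derivative_eq_intros simp: field_simps power2_eq_square)
  next
    fix z assume z: "z \<in> ball c r"
    show "(\<lambda>t. of_real (f (c + circ r t)) * ((circ r t + (z - c)) / (circ r t - (z - c)))) integrable_on cbox 0 1"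
      using nz [OF z] by (intro integrable_continuous continuous_intros cf) auto
  next
    have "continuous_on (ball c r \<times> cbox 0 1) (\<lambda>p. of_real (f (c + circ r (snd p))) *
        (2 * circ r (snd p) / (circ r (snd p) - (fst p - c))\<^sup>2))"
      using nz
      by (intro continuous_intros continuous_on_compose2 [OF cf [of UNIV]]
          continuous_on_compose2 [OF continuous_on_circ [of UNIV]]) auto
    then show "continuous_on (ball c r \<times> cbox 0 1) (\<lambda>(z, t). of_real (f (c + circ r t)) * (2 * circ r t / (circ r t - (z - c))\<^sup>2))"
      by (simp add: case_prod_unfold)
  qed auto
  then have "gradient_harmonic (\<lambda>z. Re (F z)) (ball c r)"
    by (rule gradient_harmonic_Re) simp
  then show ?thesis
  proof (rule gradient_harmonic_cong)
    fix z assume z: "z \<in> ball c r"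
    have "(\<lambda>t. of_real (f (c + circ r t)) * ((circ r t + (z - c)) / (circ r t - (z - c)))) integrable_on cbox 0 1"
      using nz [OF z] by (intro integrable_continuous continuous_intros cf) auto
    from integral_linear [OF this bounded_linear_Re]
    show "Re (F z) = poisson f c r z"
      by (simp add: F_def poisson_def poisson_kernel_def o_def del: times_divide_eq_right)
  qed
next
  case False
  then have "ball c r = {}" by simp
  then show ?thesis
    unfolding gradient_harmonic_def by (metis emptyE holomorphic_on_empty open_ball)
qed

text \<open>The kernel has mass 1 and concentrates at \<open>y\<close>: near \<open>y\<close> the
  continuity of \<open>f\<close> is used, away from \<open>y\<close> the kernel itself tends to
  0.\<close>

lemma poisson_tendsto_boundary:
  assumes f: "continuous_on (sphere c r) f" and y: "y \<in> sphere c r" and r: "r > 0"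
  shows "(poisson f c r \<longlongrightarrow> f y) (at y within ball c r)"
proof -
  have "bounded (f ` sphere c r)"
    using f compact_imp_bounded compact_continuous_image compact_sphere by blast
  then obtain M where M: "M > 0" "\<And>x. x \<in> sphere c r \<Longrightarrow> \<bar>f x\<bar> \<le> M"
    unfolding bounded_pos by auto
  show ?thesis
    unfolding Lim_within
  proof (intro allI impI)
    fix e :: real assume e: "e > 0"
    obtain d where d: "d > 0" "\<And>x. x \<in> sphere c r \<Longrightarrow> dist x y < d \<Longrightarrow> dist (f x) (f y) < e/2"
      using f y e unfolding continuous_on_iff by (meson half_gt_zero)
    \<comment> \<open>Bound for the part of the circle with \<open>dist x y \<ge> d\<close>: there
      \<open>norm (x - z) \<ge> d/2\<close>, whence the factor 4, and \<open>2 * M\<close> bounds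
      the oscillation of \<open>f\<close>.\<close>
    define K where "K z = 2 * M * (4 * (r\<^sup>2 - (norm (z - c))\<^sup>2) / d\<^sup>2)" for z
    have "(K \<longlongrightarrow> K y) (at y)"
      unfolding K_def by (intro tendsto_intros) (use d in auto)
    moreover have "K y = 0"
      using y by (simp add: K_def dist_norm norm_minus_commute)
    ultimately have "\<forall>\<^sub>F z in at y. K z < e/2"
      using e by (intro order_tendstoD) auto
    then obtain d' where d': "d' > 0" "\<And>z. z \<noteq> y \<Longrightarrow> dist z y < d' \<Longrightarrow> K z < e/2"
      unfolding eventually_at by blast
    show "\<exists>d>0. \<forall>z\<in>ball c r. 0 < dist z y \<and> dist z y < d \<longrightarrow> dist (poisson f c r z) (f y) < e"
    proof (intro exI [of _ "min d' (d/2)"] conjI ballI impI)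
      fix z assume z: "z \<in> ball c r" and "0 < dist z y \<and> dist z y < min d' (d/2)"
      then have zy: "dist z y < d/2" "K z < e/2"
        using d' by auto
      have nz: "norm (z - c) < r"
        using z by (simp add: dist_norm norm_minus_commute)
      have pt: "\<bar>f x - f y\<bar> * poisson_kernel (x - c) (z - c) \<le> e/2 * poisson_kernel (x - c) (z - c) + K z"
        if x: "x \<in> sphere c r" for x
      proof -
        have nx: "norm (x - c) = r" using x by (simp add: dist_norm norm_minus_commute)
        have k0: "poisson_kernel (x - c) (z - c) \<ge> 0"
          using nx nz by (intro poisson_kernel_nonneg) auto
        have K0: "K z \<ge> 0"
          using M nz by (simp add: K_def power_mono)
        show ?thesis
        proof (cases "dist x y < d")
          case True
          then have "\<bar>f x - f y\<bar> \<le> e/2"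
            using d(2) [OF x] by (simp add: dist_norm)
          then show ?thesis
            using k0 K0 by (smt (verit) mult_right_mono)
        next
          case False
          have "d/2 \<le> norm (x - z)"
            using False zy dist_triangle [of x y z] by (simp add: dist_norm)
          then have "(d/2)\<^sup>2 \<le> (norm (x - z))\<^sup>2"
            using d by (intro power_mono) auto
          then have "poisson_kernel (x - c) (z - c) \<le> (r\<^sup>2 - (norm (z - c))\<^sup>2) / (d/2)\<^sup>2"
            using d nz nx by (simp add: poisson_kernel_eq) (intro divide_left_mono, auto simp: power_mono intro!: mult_pos_pos zero_less_power)
          moreover have "\<bar>f x - f y\<bar> \<le> 2 * M"
            using M(2) [OF x] M(2) [OF y] by linarith
          ultimately have "\<bar>f x - f y\<bar> * poisson_kernel (x - c) (z - c) \<le> K z"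
            unfolding K_def using k0 M by (intro mult_mono) (auto simp: power_divide algebra_simps)
          then show ?thesis
            using k0 e by (smt (verit) mult_nonneg_nonneg half_gt_zero)
        qed
      qed
      have cfy: "continuous_on (sphere c r) (\<lambda>x. f x - f y)"
        by (intro continuous_intros f)
      have "poisson f c r z - f y = poisson (\<lambda>x. f x - f y) c r z"
        using poisson_add [OF f continuous_on_const z, of "- f y"] poisson_const [OF z, of "- f y"] by simp
      also have "norm \<dots> \<le> integral {0..1} (\<lambda>t. e/2 * poisson_kernel (circ r t) (z - c) + K z)"
        unfolding poisson_def
      proof (rule integral_norm_bound_integral)
        show "(\<lambda>t. e/2 * poisson_kernel (circ r t) (z - c) + K z) integrable_on {0..1}"
          by (intro integrable_continuous_interval continuous_intros continuous_on_poisson_kernel nz)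
        fix t
        have "poisson_kernel (circ r t) (z - c) \<ge> 0"
          using nz r by (intro poisson_kernel_nonneg) auto
        then show "norm ((f (c + circ r t) - f y) * poisson_kernel (circ r t) (z - c))
            \<le> e/2 * poisson_kernel (circ r t) (z - c) + K z"
          using pt [of "c + circ r t"] r circ_mem [of r c t] by (simp add: abs_mult)
      qed (intro integrable_continuous_interval poisson_integrand_continuous cfy z)
      also have "\<dots> = e/2 + K z"
      proof -
        have "(\<lambda>t. e/2 * poisson_kernel (circ r t) (z - c)) integrable_on {0..1}"
          by (intro integrable_continuous_interval continuous_intros continuous_on_poisson_kernel nz)
        then show ?thesis
          using poisson_kernel_mean [OF nz] by (subst integral_add) auto
      qed
      finally show "dist (poisson f c r z) (f y) < e"
        using zy by (simp add: dist_norm)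
    qed (use d d' in auto)
  qed
qed

text \<open>The Poisson modification of Perron's method: since \<open>f\<close> is kept outside the
  open disc, it maps superharmonic functions to superharmonic ones as long as the closed disc lies
  in their domain.\<close>

definition dirichlet :: "(complex \<Rightarrow> real) \<Rightarrow> complex \<Rightarrow> real \<Rightarrow> complex \<Rightarrow> real" where
  "dirichlet f c r z = (if z \<in> ball c r then poisson f c r z else f z)"

lemma dirichlet_harmonic:
  assumes "continuous_on (sphere c r) f"
  shows "gradient_harmonic (dirichlet f c r) (ball c r)"
  by (rule gradient_harmonic_cong [OF poisson_harmonic [OF assms]]) (simp add: dirichlet_def)

lemma dirichlet_continuous:
  assumes f: "continuous_on A f" "sphere c r \<subseteq> A" and r: "r > 0"
  shows "continuous_on (A \<union> ball c r) (dirichlet f c r)"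
proof -
  have fs: "continuous_on (sphere c r) f"
    using f continuous_on_subset by blast
  have "(dirichlet f c r \<longlongrightarrow> dirichlet f c r y) (at y within A \<union> ball c r)" if y: "y \<in> A \<union> ball c r" for y
  proof (cases "y \<in> ball c r")
    case True
    have "continuous_on (ball c r) (dirichlet f c r)"
      using gradient_harmonic_continuous dirichlet_harmonic fs by blast
    then have "isCont (dirichlet f c r) y"
      using True continuous_on_eq_continuous_at open_ball by blast
    then show ?thesis
      using tendsto_within_subset subset_UNIV by (force simp: isCont_def)
  next
    case False
    then have yA: "y \<in> A" using y by auto
    have fy: "dirichlet f c r y = f y" using False by (simp add: dirichlet_def)
    have 1: "(dirichlet f c r \<longlongrightarrow> f y) (at y within A - ball c r)"
    proof (rule Lim_transform_eventually)
      show "(f \<longlongrightarrow> f y) (at y within A - ball c r)"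
        using f(1) yA unfolding continuous_on_def by (meson Diff_subset tendsto_within_subset)
      show "\<forall>\<^sub>F x in at y within A - ball c r. f x = dirichlet f c r x"
        by (auto simp: eventually_at_filter dirichlet_def)
    qed
    have 2: "(dirichlet f c r \<longlongrightarrow> f y) (at y within ball c r)"
    proof (cases "y \<in> sphere c r")
      case True
      show ?thesis
      proof (rule Lim_transform_eventually [OF poisson_tendsto_boundary [OF fs True r]])
        show "\<forall>\<^sub>F x in at y within ball c r. poisson f c r x = dirichlet f c r x"
          by (auto simp: eventually_at_filter dirichlet_def)
      qed
    next
      case False
      with \<open>y \<notin> ball c r\<close> have "y \<notin> closure (ball c r)" using r by auto
      then have "at y within ball c r = bot"
        using trivial_limit_within islimpt_in_closure by (metis closure_subset insert_Diff_single insert_absorb subsetD Diff_empty Diff_insert0 \<open>y \<notin> ball c r\<close>)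
      then show ?thesis by simp
    qed
    have "(dirichlet f c r \<longlongrightarrow> f y) (at y within (A - ball c r) \<union> ball c r)"
      using 1 2 Lim_within_Un by blast
    then show ?thesis
      by (metis Un_Diff_cancel2 fy)
  qed
  then show ?thesis
    by (simp add: continuous_on_def)
qed

lemma dirichlet_continuous_cball:
  assumes "continuous_on (cball c r) f" "r > 0"
  shows "continuous_on (cball c r) (dirichlet f c r)"
proof -
  have "cball c r \<union> ball c r = cball c r" by auto
  then show ?thesis
    using dirichlet_continuous [OF assms(1) _ assms(2), of c] sphere_cball by metis
qed

lemma dirichlet_unique:
  assumes r: "r > 0" and u: "continuous_on (cball c r) u"
    and up: "superharmonic u (ball c r)" and dn: "superharmonic (\<lambda>x. - u x) (ball c r)"
    and z: "z \<in> ball c r"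
  shows "u z = poisson u c r z"
proof -
  have us: "continuous_on (sphere c r) u"
    using u continuous_on_subset sphere_cball by blast
  let ?d = "dirichlet u c r"
  have cd: "continuous_on (cball c r) ?d"
    using dirichlet_continuous_cball u r by blast
  have gd: "superharmonic ?d (ball c r)" "superharmonic (\<lambda>x. - ?d x) (ball c r)"
    using dirichlet_harmonic [OF us] gradient_harmonic_superharmonic gradient_harmonic_minus by blast+
  have "u z - ?d z \<ge> 0"
  proof (rule minimum_principle_closure [where S = "\<lambda>z. u z - ?d z" and B = "ball c r"])
    show "superharmonic (\<lambda>z. u z - ?d z) (ball c r)"
      using superharmonic_add [OF up gd(2)] by simp
  qed (use r u cd z in \<open>auto simp: dirichlet_def intro!: continuous_intros\<close>)
  moreover have "?d z - u z \<ge> 0"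
  proof (rule minimum_principle_closure [where S = "\<lambda>z. ?d z - u z" and B = "ball c r"])
    show "superharmonic (\<lambda>z. ?d z - u z) (ball c r)"
      using superharmonic_add [OF gd(1) dn] by simp
  qed (use r u cd z in \<open>auto simp: dirichlet_def intro!: continuous_intros\<close>)
  ultimately show ?thesis
    using z by (simp add: dirichlet_def)
qed

section \<open>Twice differentiable harmonic functions\<close>

lemma second_derivative_at_max:
  fixes \<phi> :: "real \<Rightarrow> real"
  assumes e: "e > 0" and d1: "\<And>s. \<bar>s\<bar> < e \<Longrightarrow> DERIV \<phi> s :> \<phi>' s" and d2: "DERIV \<phi>' 0 :> l"
    and mx: "\<And>s. \<bar>s\<bar> < e \<Longrightarrow> \<phi> s \<le> \<phi> 0"
  shows "l \<le> 0"
proof (rule ccontr)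
  assume "\<not> l \<le> 0"
  then obtain d where d: "d > 0" "\<And>h. 0 < h \<Longrightarrow> h < d \<Longrightarrow> \<phi>' 0 < \<phi>' h"
    using DERIV_pos_inc_right [OF d2] by auto
  have "\<phi>' 0 = 0"
    by (rule DERIV_local_max [OF d1 e]) (use e mx in auto)
  define h where "h = min d e / 2"
  have h: "0 < h" "h < d" "h < e" using d e by (auto simp: h_def)
  obtain x where "0 < x" "x < h" "\<phi> h - \<phi> 0 = (h - 0) * \<phi>' x"
    using MVT2 [of 0 h \<phi> \<phi>'] d1 h by auto
  then have "\<phi> h > \<phi> 0"
    using d(2) [of x] h \<open>\<phi>' 0 = 0\<close> by (smt (verit) mult_pos_pos)
  then show False using mx [of h] h by simp
qed

lemma harmonic_on_diff:
  assumes "harmonic_on u S" "harmonic_on v S"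
  shows "harmonic_on (\<lambda>z. u z - v z) S"
proof -
  obtain ux uy uxx uxy uyx uyy where S: "open S"
    and cu: "continuous_on S uxx" "continuous_on S uxy" "continuous_on S uyx" "continuous_on S uyy"
    and du: "\<forall>z\<in>S. (u has_derivative (\<lambda>h. ux z * Re h + uy z * Im h)) (at z) \<and>
               (ux has_derivative (\<lambda>h. uxx z * Re h + uxy z * Im h)) (at z) \<and>
               (uy has_derivative (\<lambda>h. uyx z * Re h + uyy z * Im h)) (at z) \<and>
               uxx z + uyy z = 0"
    using assms(1) unfolding harmonic_on_def by blast
  obtain vx vy vxx vxy vyx vyy where
        cv: "continuous_on S vxx" "continuous_on S vxy" "continuous_on S vyx" "continuous_on S vyy"
    and dv: "\<forall>z\<in>S. (v has_derivative (\<lambda>h. vx z * Re h + vy z * Im h)) (at z) \<and>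
               (vx has_derivative (\<lambda>h. vxx z * Re h + vxy z * Im h)) (at z) \<and>
               (vy has_derivative (\<lambda>h. vyx z * Re h + vyy z * Im h)) (at z) \<and>
               vxx z + vyy z = 0"
    using assms(2) unfolding harmonic_on_def by blast
  have D: "((\<lambda>z. f z - g z) has_derivative (\<lambda>h. (a - a') * Re h + (b - b') * Im h)) (at z)"
    if "(f has_derivative (\<lambda>h. a * Re h + b * Im h)) (at z)" "(g has_derivative (\<lambda>h. a' * Re h + b' * Im h)) (at z)"
    for f g a a' b b' and z :: complex
    using has_derivative_diff [OF that] by (simp add: algebra_simps)
  show ?thesis
    unfolding harmonic_on_def
    apply (rule conjI [OF S])
    apply (rule exI [of _ "\<lambda>z. ux z - vx z"], rule exI [of _ "\<lambda>z. uy z - vy z"])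
    apply (rule exI [of _ "\<lambda>z. uxx z - vxx z"], rule exI [of _ "\<lambda>z. uxy z - vxy z"])
    apply (rule exI [of _ "\<lambda>z. uyx z - vyx z"], rule exI [of _ "\<lambda>z. uyy z - vyy z"])
  proof (intro conjI ballI continuous_on_diff cu cv)
    fix z assume z: "z \<in> S"
    show "uxx z - vxx z + (uyy z - vyy z) = 0"
      using du dv z by (smt (verit))
  qed (use du dv in \<open>auto intro!: D\<close>)
qed

lemma has_real_derivative_along_line:
  assumes "(w has_derivative (\<lambda>h. a * Re h + b * Im h)) (at (p + of_real s * k))"
  shows "((\<lambda>s. w (p + of_real s * k)) has_real_derivative a * Re k + b * Im k) (at s)"
proof -
  have "((\<lambda>s. p + of_real s * k) has_derivative (\<lambda>h. of_real h * k)) (at s)"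
    by (auto intro!: derivative_eq_intros)
  from has_derivative_compose [OF this assms]
  have "((\<lambda>s. w (p + of_real s * k)) has_derivative (*) (a * Re k + b * Im k)) (at s)"
    by (rule has_derivative_eq_rhs) (simp add: fun_eq_iff algebra_simps)
  then show ?thesis
    by (simp add: has_field_derivative_def)
qed

text \<open>Adding \<open>e * |x - c|^2\<close> makes the Laplacian equal to
  \<open>4 * e > 0\<close>, which the second derivative test forbids at an interior maximum.\<close>

lemma harmonic_on_le_zero:
  assumes w: "harmonic_on w (ball c r)" and cont: "continuous_on (cball c r) w"
    and bd: "\<And>x. x \<in> sphere c r \<Longrightarrow> w x \<le> 0" and z: "z \<in> ball c r"
  shows "w z \<le> 0"
proof (rule ccontr)
  assume "\<not> w z \<le> 0"
  then have pos: "w z > 0" by simp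
  obtain ux uy uxx uxy uyx uyy where
    *: "\<forall>z\<in>ball c r. (w has_derivative (\<lambda>h. ux z * Re h + uy z * Im h)) (at z) \<and>
               (ux has_derivative (\<lambda>h. uxx z * Re h + uxy z * Im h)) (at z) \<and>
               (uy has_derivative (\<lambda>h. uyx z * Re h + uyy z * Im h)) (at z) \<and>
               uxx z + uyy z = 0"
    using w unfolding harmonic_on_def by blast
  have du: "\<And>z. z\<in>ball c r \<Longrightarrow> (w has_derivative (\<lambda>h. ux z * Re h + uy z * Im h)) (at z)"
      "\<And>z. z\<in>ball c r \<Longrightarrow> (ux has_derivative (\<lambda>h. uxx z * Re h + uxy z * Im h)) (at z)"
      "\<And>z. z\<in>ball c r \<Longrightarrow> (uy has_derivative (\<lambda>h. uyx z * Re h + uyy z * Im h)) (at z)"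
      "\<And>z. z\<in>ball c r \<Longrightarrow> uxx z + uyy z = 0"
    using * by blast+
  have r: "r > 0" using z by (metis ball_eq_empty empty_iff not_le)
  \<comment> \<open>Then \<open>e * r^2\<close> is half of \<open>w z\<close>, so the maximum of the
    perturbed function is not on the circle.\<close>
  define e where "e = w z / (2 * r\<^sup>2)"
  have e: "e > 0" using pos r by (simp add: e_def)
  define v where "v x = w x + e * ((Re (x - c))\<^sup>2 + (Im (x - c))\<^sup>2)" for x
  have "continuous_on (cball c r) v"
    unfolding v_def by (intro continuous_intros cont)
  then obtain p where p: "p \<in> cball c r" "\<And>x. x \<in> cball c r \<Longrightarrow> v x \<le> v p"
    using continuous_attains_sup [of "cball c r" v] r by auto
  have "w z \<le> v z" using e by (simp add: v_def)
  also have "v z \<le> v p" using p z by auto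
  finally have vp: "w z \<le> v p" .
  have "p \<notin> sphere c r"
  proof
    assume ps: "p \<in> sphere c r"
    then have "(Re (p - c))\<^sup>2 + (Im (p - c))\<^sup>2 = r\<^sup>2"
      using cmod_power2 [of "p - c"] by (simp add: dist_norm norm_minus_commute)
    then have "v p \<le> e * r\<^sup>2" using bd [OF ps] unfolding v_def by simp
    also have "\<dots> < w z" using pos r by (simp add: e_def)
    finally show False using vp by simp
  qed
  then have pb: "p \<in> ball c r" using p by auto
  then obtain d where d: "d > 0" "ball p d \<subseteq> ball c r"
    using open_contains_ball open_ball by blast
  have inb: "p + of_real s * k \<in> ball c r" if "\<bar>s\<bar> < d" "norm k = 1" for s k
    using that d(2) by (auto simp: dist_norm norm_mult subset_iff)
  have "uxx p + 2 * e \<le> 0"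
  proof (rule second_derivative_at_max [OF d(1)])
    fix s :: real assume s: "\<bar>s\<bar> < d"
    have b: "p + of_real s \<in> ball c r" using inb [OF s, of 1] by simp
    have "((\<lambda>s. w (p + of_real s)) has_real_derivative ux (p + of_real s)) (at s)"
      using has_real_derivative_along_line [of w _ _ p s 1] du(1) [OF b] by fastforce
    then show "((\<lambda>s. v (p + of_real s)) has_real_derivative ux (p + of_real s) + 2 * e * (Re (p - c) + s)) (at s)"
      unfolding v_def by (auto intro!: derivative_eq_intros simp: algebra_simps)
    show "v (p + of_real s) \<le> v (p + of_real 0)"
      using p(2) b by auto
  next
    have "((\<lambda>s. ux (p + of_real s)) has_real_derivative uxx p) (at 0)"
      using has_real_derivative_along_line [of ux _ _ p 0 1] du(2) [OF pb] by fastforce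
    then show "((\<lambda>s. ux (p + of_real s) + 2 * e * (Re (p - c) + s)) has_real_derivative uxx p + 2 * e) (at 0)"
      by (auto intro!: derivative_eq_intros)
  qed
  moreover have "uyy p + 2 * e \<le> 0"
  proof (rule second_derivative_at_max [OF d(1)])
    fix s :: real assume s: "\<bar>s\<bar> < d"
    have b: "p + of_real s * \<i> \<in> ball c r" using inb [OF s, of \<i>] by simp
    have "((\<lambda>s. w (p + of_real s * \<i>)) has_real_derivative uy (p + of_real s * \<i>)) (at s)"
      using has_real_derivative_along_line [OF du(1) [OF b]] by simp
    then show "((\<lambda>s. v (p + of_real s * \<i>)) has_real_derivative uy (p + of_real s * \<i>) + 2 * e * (Im (p - c) + s)) (at s)"
      unfolding v_def by (auto intro!: derivative_eq_intros simp: algebra_simps)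
    show "v (p + of_real s * \<i>) \<le> v (p + of_real 0 * \<i>)"
      using p(2) b by auto
  next
    have "((\<lambda>s. uy (p + of_real s * \<i>)) has_real_derivative uyy p) (at 0)"
      using has_real_derivative_along_line [of uy _ _ p 0 \<i>] du(3) [OF pb] by fastforce
    then show "((\<lambda>s. uy (p + of_real s * \<i>) + 2 * e * (Im (p - c) + s)) has_real_derivative uyy p + 2 * e) (at 0)"
      by (auto intro!: derivative_eq_intros)
  qed
  ultimately show False using du(4) [OF pb] e by linarith
qed

lemma harmonic_on_subset:
  assumes "harmonic_on u S" "open T" "T \<subseteq> S"
  shows "harmonic_on u T"
proof -
  obtain ux uy uxx uxy uyx uyy where
        c: "continuous_on S uxx" "continuous_on S uxy" "continuous_on S uyx" "continuous_on S uyy"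
    and d: "\<forall>z\<in>S. (u has_derivative (\<lambda>h. ux z * Re h + uy z * Im h)) (at z) \<and>
               (ux has_derivative (\<lambda>h. uxx z * Re h + uxy z * Im h)) (at z) \<and>
               (uy has_derivative (\<lambda>h. uyx z * Re h + uyy z * Im h)) (at z) \<and>
               uxx z + uyy z = 0"
    using assms(1) unfolding harmonic_on_def by blast
  show ?thesis
    unfolding harmonic_on_def
    apply (rule conjI [OF assms(2)])
    apply (rule exI [of _ ux], rule exI [of _ uy], rule exI [of _ uxx], rule exI [of _ uxy],
        rule exI [of _ uyx], rule exI [of _ uyy])
    using c d assms(3) by (blast intro: continuous_on_subset)
qed

lemma harmonic_on_continuous: "harmonic_on u S \<Longrightarrow> continuous_on S u"
  unfolding harmonic_on_def
  by (intro continuous_at_imp_continuous_on) (blast intro: has_derivative_continuous)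

text \<open>By the maximum principle a twice differentiable harmonic function equals its Poisson
  integral on every small disc, and that is the real part of a holomorphic function. This links the
  definition in the statement with the one used in the proofs.\<close>

theorem harmonic_on_iff_gradient: "harmonic_on u S \<longleftrightarrow> gradient_harmonic u S"
proof
  assume u: "harmonic_on u S"
  show "gradient_harmonic u S"
  proof (rule gradient_harmonic_local)
    show S: "open S" using u by (simp add: harmonic_on_def)
    fix x assume "x \<in> S"
    then obtain r where r: "r > 0" "cball x r \<subseteq> S"
      using S open_contains_cball by blast
    then have b: "ball x r \<subseteq> S" by auto
    have c: "continuous_on (cball x r) u"
      using r harmonic_on_continuous [OF u] continuous_on_subset by blast
    have cs: "continuous_on (sphere x r) u"
      using c continuous_on_subset sphere_cball by blast
    let ?d = "dirichlet u x r"
    have cd: "continuous_on (cball x r) ?d"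
      using dirichlet_continuous_cball c r by blast
    have hd: "harmonic_on ?d (ball x r)" "harmonic_on u (ball x r)"
      using gradient_harmonic_imp_harmonic_on dirichlet_harmonic [OF cs] harmonic_on_subset [OF u _ b] by auto
    have eq: "?d y = u y" if "y \<in> sphere x r" for y
      using that by (simp add: dirichlet_def)
    have "gradient_harmonic u (ball x r)"
    proof (rule gradient_harmonic_cong [OF dirichlet_harmonic [OF cs]])
      fix z assume z: "z \<in> ball x r"
      have "u z - ?d z \<le> 0"
        by (rule harmonic_on_le_zero [OF harmonic_on_diff continuous_on_diff _ z])
           (use hd c cd eq in simp_all)
      moreover have "?d z - u z \<le> 0"
        by (rule harmonic_on_le_zero [OF harmonic_on_diff continuous_on_diff _ z])
           (use hd c cd eq in simp_all)
      ultimately show "?d z = u z" by simp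
    qed
    then show "\<exists>N. x \<in> N \<and> gradient_harmonic u N"
      using r by (intro exI [of _ "ball x r"]) auto
  qed
qed (rule gradient_harmonic_imp_harmonic_on)

section \<open>Harnack's inequality and limits\<close>

lemma gradient_harmonic_poisson:
  assumes "gradient_harmonic u (ball c r)" "continuous_on (cball c r) u" "z \<in> ball c r"
  shows "u z = poisson u c r z"
proof -
  have "r > 0" using assms(3) by (metis ball_eq_empty empty_iff not_le)
  then show ?thesis
    using assms gradient_harmonic_superharmonic gradient_harmonic_minus
    by (intro dirichlet_unique) auto
qed

text \<open>In the Poisson formula the kernel is at most 3 on the disc of half the radius, and the
  mean of the boundary values is \<open>u c\<close>.\<close>

lemma harnack:
  assumes u: "gradient_harmonic u (ball c r)" "continuous_on (cball c r) u"
    and nn: "\<And>x. x \<in> sphere c r \<Longrightarrow> u x \<ge> 0" and z: "z \<in> cball c (r/2)" and r: "r > 0"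
  shows "u z \<le> 3 * u c"
proof -
  have cs: "continuous_on (sphere c r) u"
    using u continuous_on_subset sphere_cball by blast
  have zb: "z \<in> ball c r" and nz: "norm (z - c) \<le> r/2" using z r by (auto simp: dist_norm norm_minus_commute)
  have "u z = poisson u c r z"
    using gradient_harmonic_poisson u zb by blast
  also have "\<dots> \<le> integral {0..1} (\<lambda>t. u (c + circ r t) * 3)"
    unfolding poisson_def
  proof (intro integral_le integrable_continuous_interval poisson_integrand_continuous cs zb mult_left_mono)
    show "poisson_kernel (circ r t) (z - c) \<le> 3" for t
      by (rule poisson_kernel_le3) (use nz r in simp)
  qed (use nn circ_mem r in \<open>auto intro!: continuous_intros continuous_on_circle cs\<close>)
  also have "\<dots> = 3 * circle_mean u c r"
    by (simp add: circle_mean_def)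
  also have "\<dots> = 3 * u c"
    using gradient_harmonic_poisson [OF u, of c] r by (simp add: poisson_center)
  finally show ?thesis .
qed

text \<open>The Poisson formula passes to uniform limits. Only approximability within every
  \<open>e\<close> on one closed disc about each point is asked for, which is what Perron's method
  delivers without choosing a sequence.\<close>

lemma uniform_limit_harmonic:
  assumes G: "open G"
    and ap: "\<And>x. x \<in> G \<Longrightarrow> \<exists>r>0. cball x r \<subseteq> G \<and> (\<forall>e>0. \<exists>u. gradient_harmonic u (ball x r) \<and>
       continuous_on (cball x r) u \<and> (\<forall>y\<in>cball x r. \<bar>u y - v y\<bar> \<le> e))"
  shows "gradient_harmonic v G"
proof (rule gradient_harmonic_local [OF G])
  fix x assume "x \<in> G"
  then obtain r where r: "r > 0" "cball x r \<subseteq> G"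
    and u: "\<And>e. e > 0 \<Longrightarrow> \<exists>u. gradient_harmonic u (ball x r) \<and>
       continuous_on (cball x r) u \<and> (\<forall>y\<in>cball x r. \<bar>u y - v y\<bar> \<le> e)"
    using ap by meson
  have cv: "continuous_on (cball x r) v"
    unfolding continuous_on_iff
  proof (intro ballI allI impI)
    fix y e assume y: "y \<in> cball x r" and e: "(e::real) > 0"
    obtain u where cu: "continuous_on (cball x r) u" and uv: "\<forall>y\<in>cball x r. \<bar>u y - v y\<bar> \<le> e/4"
      using u [of "e/4"] e by auto
    obtain d where "d > 0" "\<And>y'. y' \<in> cball x r \<Longrightarrow> dist y' y < d \<Longrightarrow> dist (u y') (u y) < e/4"
      using cu y e unfolding continuous_on_iff by (metis zero_less_divide_iff zero_less_numeral)
    then show "\<exists>d>0. \<forall>y'\<in>cball x r. dist y' y < d \<longrightarrow> dist (v y') (v y) < e"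
    proof (intro exI [of _ d] conjI ballI impI)
      fix y' assume a: "y' \<in> cball x r" "dist y' y < d"
      then have "\<bar>u y' - u y\<bar> < e/4"
        using \<open>\<And>y'. y' \<in> cball x r \<Longrightarrow> dist y' y < d \<Longrightarrow> dist (u y') (u y) < e/4\<close> by (simp add: dist_real_def)
      moreover have "\<bar>u y' - v y'\<bar> \<le> e/4" "\<bar>u y - v y\<bar> \<le> e/4" using uv a y by auto
      ultimately show "dist (v y') (v y) < e"
        unfolding dist_real_def using e by linarith
    qed
  qed
  have cvs: "continuous_on (sphere x r) v"
    using cv continuous_on_subset sphere_cball by blast
  have "gradient_harmonic v (ball x r)"
  proof (rule gradient_harmonic_cong [OF poisson_harmonic [OF cvs]])
    fix z assume z: "z \<in> ball x r"
    have "\<bar>poisson v x r z - v z\<bar> \<le> 0 + e" if e: "e > 0" for e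
    proof -
      obtain u where hu: "gradient_harmonic u (ball x r)" and cu: "continuous_on (cball x r) u"
        and uv: "\<forall>y\<in>cball x r. \<bar>u y - v y\<bar> \<le> e/2"
        using u [of "e/2"] e by auto
      have cus: "continuous_on (sphere x r) u"
        using cu continuous_on_subset sphere_cball by blast
      have bnd: "u y - e/2 \<le> v y" "v y \<le> u y + e/2" if "y \<in> cball x r" for y
        using bspec [OF uv that] unfolding abs_le_iff by linarith+
      have uz: "u z = poisson u x r z"
        using gradient_harmonic_poisson hu cu z by blast
      have "poisson v x r z \<le> poisson (\<lambda>y. u y + e/2) x r z"
        by (rule poisson_mono) (use cus cvs z bnd in \<open>auto intro!: continuous_intros\<close>)
      moreover have "poisson (\<lambda>y. u y + - e/2) x r z \<le> poisson v x r z"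
        by (rule poisson_mono) (use cus cvs z bnd in \<open>auto intro!: continuous_intros\<close>)
      moreover have "poisson (\<lambda>y. u y + k) x r z = u z + k" for k
        using poisson_add [OF cus continuous_on_const z] poisson_const [OF z] uz by simp
      ultimately have "\<bar>poisson v x r z - u z\<bar> \<le> e/2"
        unfolding abs_le_iff by (metis add.commute add_minus_cancel diff_le_eq minus_diff_eq minus_divide_left neg_le_iff_le uminus_add_conv_diff)
      moreover have "\<bar>u z - v z\<bar> \<le> e/2" using uv z by auto
      ultimately show ?thesis by linarith
    qed
    then have "\<bar>poisson v x r z - v z\<bar> \<le> 0"
      by (rule field_le_epsilon)
    then show "poisson v x r z = v z" by simp
  qed
  then show "\<exists>N. x \<in> N \<and> gradient_harmonic v N"
    using r by (intro exI [of _ "ball x r"]) auto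
qed

section \<open>Perron families\<close>

lemma superharmonic_ge_dirichlet:
  assumes S: "superharmonic S G" and r: "r > 0" "cball c r \<subseteq> G"
  shows "dirichlet S c r x \<le> S x"
proof (cases "x \<in> ball c r")
  case True
  have c: "continuous_on (cball c r) S"
    using S r superharmonic_continuous continuous_on_subset by blast
  then have cs: "continuous_on (sphere c r) S"
    using continuous_on_subset sphere_cball by blast
  have "S x - dirichlet S c r x \<ge> 0"
  proof (rule minimum_principle_closure [where S = "\<lambda>x. S x - dirichlet S c r x" and B = "ball c r"])
    have "superharmonic S (ball c r)"
      by (rule superharmonic_subset [OF S]) (use r in auto)
    moreover have "superharmonic (\<lambda>x. - dirichlet S c r x) (ball c r)"
      using dirichlet_harmonic [OF cs] gradient_harmonic_superharmonic gradient_harmonic_minus by blast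
    ultimately show "superharmonic (\<lambda>x. S x - dirichlet S c r x) (ball c r)"
      using superharmonic_add by fastforce
    show "continuous_on (closure (ball c r)) (\<lambda>x. S x - dirichlet S c r x)"
      using c dirichlet_continuous_cball [OF c r(1)] r by (auto intro!: continuous_intros)
    show "0 \<le> S y - dirichlet S c r y" if "y \<in> frontier (ball c r)" for y
      using that r by (auto simp: dirichlet_def)
    show "x \<in> closure (ball c r)" using True closure_subset by blast
  qed auto
  then show ?thesis by simp
qed (auto simp: dirichlet_def)

text \<open>Inside the disc the function is harmonic; at a point outside, the value is unchanged
  while the means can only decrease.\<close>

lemma superharmonic_dirichlet:
  assumes S: "superharmonic S G" and r: "r > 0" "cball c r \<subseteq> G"
  shows "superharmonic (dirichlet S c r) G"
proof (rule superharmonicI)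
  show "open G" using S superharmonic_open by blast
  have "G \<union> ball c r = G" using r by auto
  then show cd: "continuous_on G (dirichlet S c r)"
    using dirichlet_continuous [OF superharmonic_continuous [OF S], of c r] r sphere_cball by (metis subset_trans)
  fix x assume x: "x \<in> G"
  show "\<exists>e>0. \<forall>s. 0 < s \<and> s < e \<longrightarrow> circle_mean (dirichlet S c r) x s \<le> dirichlet S c r x"
  proof (cases "x \<in> ball c r")
    case True
    have "continuous_on (sphere c r) S"
      using S r superharmonic_continuous continuous_on_subset sphere_cball by blast
    then have "superharmonic (dirichlet S c r) (ball c r)"
      using dirichlet_harmonic gradient_harmonic_superharmonic by blast
    from superharmonicD [OF this True] show ?thesis by metis
  next
    case False
    obtain e where e: "e > 0" "cball x e \<subseteq> G" "\<And>s. 0 < s \<Longrightarrow> s < e \<Longrightarrow> circle_mean S x s \<le> S x"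
      using superharmonicD [OF S x] by blast
    have "circle_mean (dirichlet S c r) x s \<le> S x" if s: "0 < s" "s < e" for s
    proof -
      have "sphere x s \<subseteq> G" using e s by (intro sphere_subset_cball_trans) auto
      then have "circle_mean (dirichlet S c r) x s \<le> circle_mean S x s"
        using s superharmonic_ge_dirichlet [OF S r]
        by (intro circle_mean_mono continuous_on_subset [OF cd]
            continuous_on_subset [OF superharmonic_continuous [OF S]]) auto
      then show ?thesis using e(3) [OF s] by simp
    qed
    then show ?thesis
      using False e by (auto simp: dirichlet_def intro!: exI [of _ e])
  qed
qed

text \<open>A single member \<open>T\<close>, harmonic near \<open>x\<close> and close to the
  infimum at \<open>x\<close>, is uniformly close to the infimum on a smaller disc. For any member
  \<open>R\<close> the modification \<open>Q\<close> of \<open>min R T\<close> satisfies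
  \<open>Q \<le> R\<close> and \<open>Q \<le> T\<close>, and Harnack's inequality for
  \<open>T - Q\<close> spreads the bound at the centre to the disc.\<close>

theorem perron:
  assumes G: "open G" and ne: "U \<noteq> {}" and sup: "\<And>S. S \<in> U \<Longrightarrow> superharmonic S G"
    and mn: "\<And>S T. S \<in> U \<Longrightarrow> T \<in> U \<Longrightarrow> (\<lambda>x. min (S x) (T x)) \<in> U"
    and dir: "\<And>S c r. S \<in> U \<Longrightarrow> r > 0 \<Longrightarrow> cball c r \<subseteq> G \<Longrightarrow> dirichlet S c r \<in> U"
    and low: "\<And>x. x \<in> G \<Longrightarrow> \<exists>m. \<forall>S\<in>U. m \<le> S x"
  shows "gradient_harmonic (\<lambda>x. INF S\<in>U. S x) G"
proof (rule uniform_limit_harmonic [OF G])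
  let ?v = "\<lambda>x. INF S\<in>U. S x"
  have bdd: "bdd_below ((\<lambda>S. S x) ` U)" if "x \<in> G" for x
    using low [OF that] by (auto intro: bdd_belowI2)
  have le: "?v x \<le> S x" if "x \<in> G" "S \<in> U" for x S
    using that bdd by (intro cINF_lower) auto
  fix x assume "x \<in> G"
  then obtain r where r: "r > 0" "cball x r \<subseteq> G"
    using G open_contains_cball by blast
  have harm: "gradient_harmonic (dirichlet S x r) (ball x r)" "continuous_on (cball x r) (dirichlet S x r)"
    if "S \<in> U" for S
  proof -
    have "continuous_on (cball x r) S"
      using sup [OF that] r superharmonic_continuous continuous_on_subset by blast
    then show "gradient_harmonic (dirichlet S x r) (ball x r)" "continuous_on (cball x r) (dirichlet S x r)"
      using r dirichlet_continuous_cball dirichlet_harmonic continuous_on_subset sphere_cball by metis+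
  qed
  have sub: "cball x (r/2) \<subseteq> ball x r" "ball x (r/2) \<subseteq> ball x r" "cball x (r/2) \<subseteq> cball x r"
    using r by auto
  show "\<exists>r>0. cball x r \<subseteq> G \<and> (\<forall>e>0. \<exists>u. gradient_harmonic u (ball x r) \<and>
       continuous_on (cball x r) u \<and> (\<forall>y\<in>cball x r. \<bar>u y - ?v y\<bar> \<le> e))"
  proof (intro exI [of _ "r/2"] conjI allI impI)
    show "r/2 > 0" using r by simp
    show "cball x (r/2) \<subseteq> G" using sub r by blast
    fix e :: real assume e: "e > 0"
    \<comment> \<open>The fraction \<open>e/3\<close> compensates the factor 3 in Harnack's
      inequality.\<close>
    have "\<exists>S\<in>U. S x < ?v x + e/3"
      using cINF_less_iff [OF ne bdd [OF \<open>x \<in> G\<close>], of "?v x + e/3"] e by auto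
    then obtain S where S: "S \<in> U" "S x < ?v x + e/3" by blast
    define T where "T = dirichlet S x r"
    have T: "T \<in> U" "T x < ?v x + e/3"
      using S dir [OF S(1) r] le_less_trans [OF superharmonic_ge_dirichlet [OF sup [OF S(1)] r] S(2)]
      unfolding T_def by auto
    have hT: "gradient_harmonic T (ball x r)" "continuous_on (cball x r) T"
      using harm [OF S(1)] by (auto simp: T_def)
    have key: "T y - e \<le> R y" if R: "R \<in> U" and y: "y \<in> cball x (r/2)" for R y
    proof -
      define M where "M = (\<lambda>x. min (R x) (T x))"
      have M: "M \<in> U" using mn R T by (simp add: M_def)
      define Q where "Q = dirichlet M x r"
      have Q: "Q \<in> U" using M dir r by (simp add: Q_def)
      have hQ: "gradient_harmonic Q (ball x r)" "continuous_on (cball x r) Q"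
        using harm [OF M] by (auto simp: Q_def)
      have QM: "Q w \<le> M w" for w
        using superharmonic_ge_dirichlet [OF sup [OF M] r] by (simp add: Q_def)
      have "T y - Q y \<le> 3 * (T x - Q x)"
      proof (rule harnack [where u = "\<lambda>w. T w - Q w" and r = r])
        show "0 \<le> T w - Q w" for w using QM [of w] by (simp add: M_def)
      qed (use r hT hQ y in \<open>auto intro!: continuous_intros gradient_harmonic_diff\<close>)
      moreover have "Q x \<ge> ?v x" using le \<open>x \<in> G\<close> Q by blast
      ultimately have "T y - Q y \<le> e" using T by simp
      then show ?thesis using QM [of y] by (simp add: M_def)
    qed
    show "\<exists>u. gradient_harmonic u (ball x (r/2)) \<and>
       continuous_on (cball x (r/2)) u \<and> (\<forall>y\<in>cball x (r/2). \<bar>u y - ?v y\<bar> \<le> e)"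
    proof (intro exI [of _ T] conjI ballI)
      show "gradient_harmonic T (ball x (r/2))"
        using gradient_harmonic_subset [OF hT(1)] sub by auto
      show "continuous_on (cball x (r/2)) T"
        using hT(2) sub continuous_on_subset by blast
      fix y assume y: "y \<in> cball x (r/2)"
      have "T y - e \<le> ?v y"
        using ne key y by (intro cINF_greatest) auto
      moreover have "?v y \<le> T y" using le T y r sub by blast
      ultimately show "\<bar>T y - ?v y\<bar> \<le> e" using e by linarith
    qed
  qed
qed

section \<open>Least harmonic majorants of logarithmic poles\<close>

lemma ln_norm_harmonic: "gradient_harmonic (\<lambda>x. ln (cmod (x - z))) (- {z})"
  unfolding gradient_harmonic_def
proof (intro conjI exI [of _ "\<lambda>x. 1 / (x - z)"] ballI)
  fix x assume x: "x \<in> - {z}"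
  have "((\<lambda>x. x - z) has_derivative (\<lambda>h. h)) (at x)"
    by (auto intro!: derivative_eq_intros)
  moreover have "(norm has_derivative (\<lambda>h. h \<bullet> sgn (x - z))) (at (x - z))"
    using x by (intro has_derivative_norm) auto
  ultimately have "((\<lambda>x. norm (x - z)) has_derivative (\<lambda>h. h \<bullet> sgn (x - z))) (at x)"
    by (rule has_derivative_compose)
  then have "((\<lambda>x. ln (norm (x - z))) has_derivative (\<lambda>h. (h \<bullet> sgn (x - z)) * inverse (norm (x - z)))) (at x)"
    using x by (auto intro!: derivative_eq_intros simp: divide_inverse)
  then show "((\<lambda>x. ln (cmod (x - z))) has_derivative (\<lambda>h. Re (1 / (x - z) * h))) (at x)"
  proof (rule has_derivative_eq_rhs)
    show "(\<lambda>h. (h \<bullet> sgn (x - z)) * inverse (norm (x - z))) = (\<lambda>h. Re (1 / (x - z) * h))"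
    proof
      fix h
      define w where "w = x - z"
      have "w \<noteq> 0" using x by (simp add: w_def)
      then have "(h \<bullet> sgn w) * inverse (norm w) = Re (1 / w * h)"
        by (simp add: sgn_div_norm inner_complex_def Re_divide cmod_power2 power2_eq_square divide_simps)
           (simp add: cmod_def algebra_simps power2_eq_square)
      then show "(h \<bullet> sgn (x - z)) * inverse (norm (x - z)) = Re (1 / (x - z) * h)"
        by (simp add: w_def)
    qed
  qed
qed (auto intro!: holomorphic_intros)

lemma ln_norm_at_bot: "filterlim (\<lambda>x. ln (cmod (x - z))) at_bot (at z)"
proof -
  have "filterlim (\<lambda>x. cmod (x - z)) (at_right 0) (at z)"
    unfolding filterlim_at
  proof (intro conjI)
    show "\<forall>\<^sub>F x in at z. cmod (x - z) \<in> {0<..} \<and> cmod (x - z) \<noteq> 0"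
      by (auto simp: eventually_at_filter)
    have "((\<lambda>x. cmod (x - z)) \<longlongrightarrow> cmod (z - z)) (at z)"
      by (intro tendsto_intros)
    then show "((\<lambda>x. cmod (x - z)) \<longlongrightarrow> 0) (at z)" by simp
  qed
  then show ?thesis
    using ln_at_0 filterlim_compose by blast
qed

text \<open>The minimum principle for \<open>S x - ln (cmod (x - z))\<close> on the disc without
  \<open>Z\<close> and \<open>z\<close>. Outside \<open>Z\<close>, the pole \<open>z\<close> is
  harmless since the logarithm tends to minus infinity there; at points of \<open>Z\<close> the
  inequality is assumed nearby.\<close>

lemma ln_norm_le_superharmonic:
  assumes Z: "finite Z" and S: "superharmonic S (ball c r - Z)" and cont: "continuous_on (cball c r - Z) S"
    and poles: "\<And>y. y \<in> Z \<Longrightarrow> \<forall>\<^sub>F x in at y. ln (cmod (x - z)) \<le> S x"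
    and bd: "\<And>x. x \<in> sphere c r - Z - {z} \<Longrightarrow> ln (cmod (x - z)) \<le> S x"
    and x: "x \<in> ball c r - Z - {z}"
  shows "ln (cmod (x - z)) \<le> S x"
proof -
  let ?B = "ball c r - Z - {z}"
  have oB: "open ?B"
    using Z by (simp add: open_Diff finite_imp_closed)
  have "S x - ln (cmod (x - z)) \<ge> 0"
  proof (rule minimum_principle [where S = "\<lambda>x. S x - ln (cmod (x - z))" and B = ?B])
    have "superharmonic (\<lambda>x. - ln (cmod (x - z))) ?B"
      by (rule superharmonic_subset [OF gradient_harmonic_superharmonic [OF gradient_harmonic_minus [OF ln_norm_harmonic]] oB]) auto
    moreover have "superharmonic S ?B"
      by (rule superharmonic_subset [OF S oB]) auto
    ultimately show "superharmonic (\<lambda>x. S x - ln (cmod (x - z))) ?B"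
      using superharmonic_add by fastforce
    show "bounded ?B" using bounded_ball bounded_subset by (metis Diff_subset)
    fix y e :: _ assume y: "y \<in> frontier ?B" and e: "(e::real) > 0"
    have "y \<in> closure (ball c r)" "y \<notin> ?B"
      using y oB closure_mono [of ?B "ball c r"] by (auto simp: frontier_def interior_open)
    then have yc: "y \<in> cball c r"
      using closure_minimal [OF ball_subset_cball closed_cball] by blast
    show "\<forall>\<^sub>F x in at y within ?B. - e < S x - ln (cmod (x - z))"
    proof (cases "y \<in> Z")
      case True
      then have "\<forall>\<^sub>F x in at y within ?B. ln (cmod (x - z)) \<le> S x"
        using poles eventually_at_filter by (metis (mono_tags, lifting) at_le filter_leD subset_UNIV)
      then show ?thesis
        by eventually_elim (use e in auto)
    next
      case False
      then have "(S \<longlongrightarrow> S y) (at y within cball c r - Z)"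
        using cont yc by (auto simp: continuous_on_def)
      then have lim: "(S \<longlongrightarrow> S y) (at y within ?B)"
        by (rule tendsto_within_subset) auto
      show ?thesis
      proof (cases "y = z")
        case True
        have "\<forall>\<^sub>F x in at y within ?B. S x > S y - 1"
          using lim by (intro order_tendstoD) auto
        moreover have "\<forall>\<^sub>F x in at z. ln (cmod (x - z)) \<le> S y - 1"
          using ln_norm_at_bot [of z] by (auto simp: filterlim_at_bot)
        then have "\<forall>\<^sub>F x in at y within ?B. ln (cmod (x - z)) \<le> S y - 1"
          unfolding True using at_le filter_leD subset_UNIV by metis
        ultimately show ?thesis
          by eventually_elim (use e in auto)
      next
        case nz: False
        then have "y \<in> sphere c r - Z - {z}"
          using False yc \<open>y \<notin> ?B\<close> by auto
        then have ge: "ln (cmod (y - z)) \<le> S y" using bd by blast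
        have "((\<lambda>x. S x - ln (cmod (x - z))) \<longlongrightarrow> S y - ln (cmod (y - z))) (at y within ?B)"
          using nz by (intro tendsto_intros lim) auto
        then show ?thesis
          using ge e by (intro order_tendstoD) auto
      qed
    qed
  qed (use x in auto)
  then show ?thesis by simp
qed

text \<open>At \<open>z\<close> no inequality is asked: the logarithm is minus infinity there, and
  \<open>ln 0\<close> is only a default value.\<close>

definition pole_majorants :: "complex set \<Rightarrow> complex \<Rightarrow> (complex \<Rightarrow> real) set" where
  "pole_majorants G z = {S. superharmonic S G \<and> (\<forall>x\<in>G - {z}. ln (cmod (x - z)) \<le> S x)}"

text \<open>\<open>log_majorant G z x - ln |x - z|\<close> is the Green function of \<open>G\<close> with pole \<open>z\<close>.\<close>

definition log_majorant :: "complex set \<Rightarrow> complex \<Rightarrow> complex \<Rightarrow> real" where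
  "log_majorant G z x = (INF S\<in>pole_majorants G z. S x)"

text \<open>The number \<open>d\<close> makes the constant \<open>ln d\<close> a majorant of every
  logarithm with pole in \<open>G\<close>, so that these families are not empty; one
  \<open>d\<close> will serve for two nested domains.\<close>

locale bounded_open =
  fixes G :: "complex set" and d :: real
  assumes open_G: "open G"
    and diam: "x \<in> G \<Longrightarrow> y \<in> G \<Longrightarrow> cmod (x - y) \<le> d"
begin

lemma pole_majorants_const:
  assumes "z \<in> G" shows "(\<lambda>_. ln d) \<in> pole_majorants G z"
  unfolding pole_majorants_def
proof (intro CollectI conjI ballI superharmonic_const open_G)
  fix x assume "x \<in> G - {z}"
  then show "ln (cmod (x - z)) \<le> ln d"
    using diam [of x z] assms by (intro ln_mono) auto
qed

text \<open>Away from \<open>z\<close> the logarithm itself is a bound. At \<open>z\<close> the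
  minimum principle on a disc of radius \<open>r\<close> gives \<open>ln r\<close>.\<close>

lemma pole_majorants_lower:
  assumes "x \<in> G" shows "\<exists>m. \<forall>S\<in>pole_majorants G z. m \<le> S x"
proof (cases "x = z")
  case False
  then show ?thesis
    using assms by (auto simp: pole_majorants_def)
next
  case True
  obtain r where r: "r > 0" "cball z r \<subseteq> G"
    using open_G open_contains_cball assms True by blast
  have "ln r \<le> S z" if "S \<in> pole_majorants G z" for S
  proof -
    have S: "superharmonic S G" "\<And>x. x \<in> G - {z} \<Longrightarrow> ln (cmod (x - z)) \<le> S x"
      using that by (auto simp: pole_majorants_def)
    have "S z - ln r \<ge> 0"
    proof (rule minimum_principle_closure [where S = "\<lambda>x. S x - ln r" and B = "ball z r"])
      have "superharmonic S (ball z r)" "superharmonic (\<lambda>x. - ln r) (ball z r)"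
        using superharmonic_subset [OF S(1)] superharmonic_const r by (auto simp: subset_iff)
      then show "superharmonic (\<lambda>x. S x - ln r) (ball z r)"
        using superharmonic_add by fastforce
      show "continuous_on (closure (ball z r)) (\<lambda>x. S x - ln r)"
        using superharmonic_continuous [OF S(1)] r by (auto intro!: continuous_intros intro: continuous_on_subset)
      show "0 \<le> S y - ln r" if "y \<in> frontier (ball z r)" for y
        using S(2) [of y] that r by (auto simp: dist_norm norm_minus_commute subset_iff)
    qed (use r in auto)
    then show ?thesis by simp
  qed
  then show ?thesis using True by blast
qed

lemma log_majorant_le:
  assumes "x \<in> G" "S \<in> pole_majorants G z"
  shows "log_majorant G z x \<le> S x"
  unfolding log_majorant_def
proof (rule cINF_lower)
  show "bdd_below ((\<lambda>S. S x) ` pole_majorants G z)"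
    using pole_majorants_lower [OF assms(1), of z] by (auto intro: bdd_belowI2)
qed (rule assms)

lemma log_majorant_le_ln_diam: "x \<in> G \<Longrightarrow> z \<in> G \<Longrightarrow> log_majorant G z x \<le> ln d"
  using log_majorant_le pole_majorants_const by fastforce

lemma ln_le_log_majorant:
  assumes "x \<in> G" "z \<in> G" "x \<noteq> z"
  shows "ln (cmod (x - z)) \<le> log_majorant G z x"
  unfolding log_majorant_def
  by (rule cINF_greatest) (use assms pole_majorants_const in \<open>auto simp: pole_majorants_def\<close>)

text \<open>The pole is no exception, since the majorant is only the regular part of the Green
  function. The point to check is that a Poisson modification on a disc containing \<open>z\<close>
  still majorises the logarithm.\<close>

lemma log_majorant_harmonic:
  assumes "z \<in> G"
  shows "gradient_harmonic (log_majorant G z) G"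
proof -
  have "gradient_harmonic (\<lambda>x. INF S\<in>pole_majorants G z. S x) G"
  proof (rule perron [OF open_G])
    show "pole_majorants G z \<noteq> {}" using pole_majorants_const [OF assms] by auto
    show "\<exists>m. \<forall>S\<in>pole_majorants G z. m \<le> S x" if "x \<in> G" for x
      using that by (rule pole_majorants_lower)
    fix S c r assume S: "S \<in> pole_majorants G z" and r: "(r::real) > 0" "cball c r \<subseteq> G"
    have S': "superharmonic S G" using S by (simp add: pole_majorants_def)
    have sd: "superharmonic (dirichlet S c r) G"
      using superharmonic_dirichlet [OF S' r] .
    have "ln (cmod (x - z)) \<le> dirichlet S c r x" if x: "x \<in> G - {z}" for x
    proof (cases "x \<in> ball c r")
      case True
      show ?thesis
      proof (rule ln_norm_le_superharmonic [where Z = "{}" and r = r and c = c])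
        show "superharmonic (dirichlet S c r) (ball c r - {})"
          using superharmonic_subset [OF sd] r by (auto simp: subset_iff)
        show "continuous_on (cball c r - {}) (dirichlet S c r)"
          using superharmonic_continuous [OF sd] r continuous_on_subset by auto
        show "ln (cmod (x - z)) \<le> dirichlet S c r x" if "x \<in> sphere c r - {} - {z}" for x
        proof -
          have "x \<in> G - {z}" using that r(2) by auto
          then have "ln (cmod (x - z)) \<le> S x" using S unfolding pole_majorants_def by blast
          then show ?thesis using that by (simp add: dirichlet_def)
        qed
      qed (use True x in auto)
    qed (use S x in \<open>auto simp: dirichlet_def pole_majorants_def\<close>)
    then show "dirichlet S c r \<in> pole_majorants G z"
      using sd by (simp add: pole_majorants_def)
  qed (auto simp: pole_majorants_def intro: superharmonic_min)
  then show ?thesis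
    unfolding log_majorant_def by (simp add: log_majorant_def [abs_def])
qed

lemma log_majorant_superharmonic: "z \<in> G \<Longrightarrow> superharmonic (log_majorant G z) G"
  using log_majorant_harmonic gradient_harmonic_superharmonic by blast

text \<open>The majorant for the larger set, restricted to the smaller one, is a competitor
  there.\<close>

lemma log_majorant_mono:
  assumes "bounded_open H d" "H \<subseteq> G" "z \<in> H" "x \<in> H"
  shows "log_majorant H z x \<le> log_majorant G z x"
proof (rule bounded_open.log_majorant_le [OF assms(1,4)])
  have "superharmonic (log_majorant G z) H"
    using assms log_majorant_superharmonic superharmonic_subset bounded_open.open_G by blast
  then show "log_majorant G z \<in> pole_majorants H z"
    unfolding pole_majorants_def using ln_le_log_majorant assms by auto
qed

text \<open>Truncating \<open>S\<close> at \<open>ln d\<close>, an upper bound of \<open>ln |x - z|\<close> on \<open>G\<close>, removes its poles.\<close>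

lemma log_majorant_le_poles:
  assumes z: "z \<in> G" and Z: "finite Z" "Z \<subseteq> G" and S: "superharmonic S (G - Z)"
    and poles: "\<And>y. y \<in> Z \<Longrightarrow> \<forall>\<^sub>F x in at y. ln d \<le> S x"
    and disc: "cball a r \<subseteq> G"
    and ge: "\<And>x. x \<in> G - Z - ball a r \<Longrightarrow> x \<noteq> z \<Longrightarrow> ln (cmod (x - z)) \<le> S x"
    and x: "x \<in> G - Z"
  shows "log_majorant G z x \<le> S x"
proof -
  define T where "T x = (if x \<in> Z then ln d else min (S x) (ln d))" for x
  have oZ: "open (G - Z)" using open_G Z by (simp add: open_Diff finite_imp_closed)
  have "superharmonic T G"
  proof (rule superharmonic_local [OF open_G])
    fix x assume x: "x \<in> G"
    show "\<exists>N v. x \<in> N \<and> superharmonic v N \<and> N \<subseteq> G \<and> (\<forall>y\<in>N. T y = v y)"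
    proof (cases "x \<in> Z")
      case False
      have "superharmonic (\<lambda>x. min (S x) (ln d)) (G - Z)"
        by (intro superharmonic_min S superharmonic_const oZ)
      then show ?thesis
        using False x by (intro exI [of _ "G - Z"] exI [of _ "\<lambda>x. min (S x) (ln d)"]) (auto simp: T_def)
    next
      case True
      then obtain N where N: "open N" "x \<in> N" "\<And>y. y \<in> N \<Longrightarrow> y \<noteq> x \<Longrightarrow> ln d \<le> S y"
        using poles [OF True] unfolding eventually_at_topological by blast
      let ?N = "(N \<inter> G)"
      show ?thesis
      proof (intro exI [of _ ?N] exI [of _ "\<lambda>_. ln d"] conjI superharmonic_const ballI)
        show "T y = ln d" if "y \<in> N \<inter> G" for y
          using N(3) [of y] that True by (cases "y = x") (auto simp: T_def min_def)
      qed (use N x open_G in auto)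
    qed
  qed
  moreover have "ln (cmod (y - z)) \<le> T y" if y: "y \<in> G - {z}" for y
  proof -
    have ld: "ln (cmod (w - z)) \<le> ln d" if "w \<in> G - {z}" for w
      using diam [of w z] z that by (intro ln_mono) auto
    \<comment> \<open>Outside the disc this is assumed; inside it follows by the minimum principle
      from the values on the boundary circle, which lies in \<open>G\<close>.\<close>
    have "ln (cmod (y - z)) \<le> S y" if "y \<notin> Z"
    proof (cases "y \<in> ball a r")
      case True
      show ?thesis
      proof (rule ln_norm_le_superharmonic [OF Z(1), where c = a and r = r])
        show "superharmonic S (ball a r - Z)"
          using Z disc by (intro superharmonic_subset [OF S]) (auto simp: open_Diff finite_imp_closed)
        show "continuous_on (cball a r - Z) S"
          using superharmonic_continuous [OF S] disc by (auto intro: continuous_on_subset)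
        show "ln (cmod (x - z)) \<le> S x" if "x \<in> sphere a r - Z - {z}" for x
          using that disc by (intro ge) auto
        show "\<forall>\<^sub>F x in at w. ln (cmod (x - z)) \<le> S x" if w: "w \<in> Z" for w
        proof -
          have "\<forall>\<^sub>F x in at w. x \<in> G"
            using w Z open_G eventually_at_topological by blast
          moreover have "\<forall>\<^sub>F x in at w. x \<noteq> z"
            by (rule eventually_neq_at_within)
          ultimately show ?thesis
            using poles [OF w] by eventually_elim (use ld in force)
        qed
      qed (use that True y in auto)
    qed (use ge that y in auto)
    then show ?thesis using ld [OF y] by (simp add: T_def)
  qed
  ultimately have "log_majorant G z x \<le> T x"
    using x by (intro log_majorant_le) (auto simp: pole_majorants_def)
  also have "T x \<le> S x" using x by (simp add: T_def)
  finally show ?thesis .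
qed

end

section \<open>Symmetry of the Green function\<close>

lemma ln_le_ln_plus:
  fixes p q e :: real
  assumes "0 < p" "0 < q" "0 \<le> e" "q \<le> p * (1 + e)"
  shows "ln q \<le> ln p + e"
proof -
  have "ln q \<le> ln (p * (1 + e))" using assms by (intro ln_mono) auto
  also have "\<dots> = ln p + ln (1 + e)" using assms by (simp add: ln_mult)
  also have "\<dots> \<le> ln p + e" using ln_add_one_self_le_self [OF assms(3)] by simp
  finally show ?thesis .
qed

text \<open>Antipodal points \<open>k\<close> and \<open>k + 2^m\<close> combine to
  \<open>(y - a) * (y + a) = y^2 - a^2\<close>, which halves the number of factors; this is why
  powers of 2 are used.\<close>

lemma prod_circle_points:
  fixes y c :: complex
  shows "(\<Prod>k<2^m. y - c * cis (2 * pi * (real k / 2^m))) = y ^ (2^m) - c ^ (2^m)"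
proof (induction m arbitrary: y c)
  case 0
  then show ?case by (simp add: lessThan_Suc)
next
  case (Suc m)
  let ?f = "\<lambda>k. y - c * cis (2 * pi * (real k / 2^(Suc m)))"
  have "(\<Prod>k<2^Suc m. ?f k) = prod ?f {0..<2^m+2^m}"
    by (rule arg_cong [where f = "prod ?f"]) auto
  also have "\<dots> = prod ?f {0..<2^m} * prod ?f {0+2^m..<2^m+2^m}"
    unfolding add_0 by (rule prod.atLeastLessThan_concat [symmetric]) auto
  also have "prod ?f {0+2^m..<2^m+2^m} = prod (\<lambda>k. ?f (k + 2^m)) {0..<2^m}"
    by (rule prod.shift_bounds_nat_ivl)
  also have "prod ?f {0..<2^m} * \<dots> = (\<Prod>k<2^m. ?f k * ?f (k + 2^m))"
    by (simp add: prod.distrib lessThan_atLeast0)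
  also have "\<dots> = (\<Prod>k<2^m. y\<^sup>2 - c\<^sup>2 * cis (2 * pi * (real k / 2^m)))"
  proof (rule prod.cong [OF refl])
    fix k
    let ?a = "2 * pi * (real k / 2^(Suc m))"
    have "2 * pi * (real (k + 2^m) / 2^(Suc m)) = ?a + pi"
      by (simp add: field_simps)
    then have "cis (2 * pi * (real (k + 2^m) / 2^(Suc m))) = - cis ?a"
      by (metis cis_mult cis_pi mult_minus1_right)
    then have "?f k * ?f (k + 2^m) = y\<^sup>2 - c\<^sup>2 * (cis ?a)\<^sup>2"
      by (simp add: algebra_simps power2_eq_square)
    also have "(cis ?a)\<^sup>2 = cis (2 * pi * (real k / 2^m))"
      by (simp add: power2_eq_square cis_mult field_simps)
    finally show "?f k * ?f (k + 2^m) = y\<^sup>2 - c\<^sup>2 * cis (2 * pi * (real k / 2^m))" .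
  qed
  also have "\<dots> = (y\<^sup>2) ^ (2^m) - (c\<^sup>2) ^ (2^m)" by (rule Suc)
  also have "\<dots> = y ^ (2^Suc m) - c ^ (2^Suc m)" by (simp add: power_mult)
  finally show ?case .
qed

text \<open>Both powers in the product formula have modulus at most \<open>norm y ^ (2^m)\<close>,
  which produces the 2 in \<open>ln 2\<close>. The bound is the same for every rotation
  \<open>t\<close> of the points, so it can be integrated over \<open>t\<close>.\<close>

lemma sum_ln_circle_points:
  assumes y: "norm y > r" and r: "r > 0"
  shows "(\<Sum>k<2^m. ln (norm (y - circ r (real k / 2^m + t)))) \<le> 2^m * ln (norm y) + ln 2"
proof -
  have c: "circ r (real k / 2^m + t) = circ r t * cis (2 * pi * (real k / 2^m))" for k
    by (simp add: circ_def cis_mult algebra_simps)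
  have nz: "norm (y - circ r s) > 0" for s
    using y r norm_circ [of r s] by auto
  have "(\<Sum>k<2^m. ln (norm (y - circ r (real k / 2^m + t)))) = ln (\<Prod>k<2^m. norm (y - circ r (real k / 2^m + t)))"
    by (rule ln_prod [symmetric]) (use nz in auto)
  also have "(\<Prod>k<2^m. norm (y - circ r (real k / 2^m + t))) = norm (y ^ (2^m) - circ r t ^ (2^m))"
    unfolding c prod_norm prod_circle_points by simp
  also have "ln \<dots> \<le> ln (2 * norm y ^ (2^m))"
  proof (rule ln_mono)
    have "norm (y ^ (2^m) - circ r t ^ (2^m)) = (\<Prod>k<2^m. norm (y - circ r (real k / 2^m + t)))"
      unfolding c prod_norm prod_circle_points by simp
    then show "norm (y ^ (2^m) - circ r t ^ (2^m)) > 0"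
      using nz by (simp add: prod_pos)
    have "norm (y ^ (2^m) - circ r t ^ (2^m)) \<le> norm y ^ (2^m) + norm (circ r t) ^ (2^m)"
      using norm_triangle_ineq4 by (metis norm_power)
    also have "norm (circ r t) ^ (2^m) \<le> norm y ^ (2^m)"
      using y r by (intro power_mono) auto
    finally show "norm (y ^ (2^m) - circ r t ^ (2^m)) \<le> 2 * norm y ^ (2^m)" by simp
  qed
  also have "\<dots> = 2^m * ln (norm y) + ln 2"
  proof -
    have "norm y > 0" using y r by linarith
    then show ?thesis by (simp add: ln_mult ln_realpow)
  qed
  finally show ?thesis .
qed

text \<open>With \<open>h = 1 / n\<close> this writes an integral over the whole circle as an
  integral over rotations of sums over \<open>n\<close> equally spaced points.\<close>

lemma integral_equal_pieces:
  fixes u :: "real \<Rightarrow> real"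
  assumes u: "continuous_on UNIV u" and h: "h \<ge> 0"
  shows "integral {0..real n * h} u = integral {0..h} (\<lambda>t. \<Sum>i<n. u (real i * h + t))"
proof -
  have int: "u integrable_on {a..b}" for a b
    using u continuous_on_subset integrable_continuous_interval by blast
  have "integral {0..real n * h} u = (\<Sum>i<n. integral {real i * h..real i * h + h} u)"
  proof (induction n)
    case (Suc n)
    have "integral {0..real n * h} u + integral {real n * h..real (Suc n) * h} u = integral {0..real (Suc n) * h} u"
      by (rule Henstock_Kurzweil_Integration.integral_combine) (use h int in \<open>auto simp: algebra_simps\<close>)
    then show ?case using Suc by (simp add: algebra_simps)
  qed simp
  also have "\<dots> = (\<Sum>i<n. integral {0..h} (\<lambda>t. u (real i * h + t)))"
  proof (rule sum.cong [OF refl])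
    fix i
    show "integral {real i * h..real i * h + h} u = integral {0..h} (\<lambda>t. u (real i * h + t))"
      using integral_shift_Icc_real [of 0 h u "real i * h"] by (simp add: o_def add.commute)
  qed
  also have "\<dots> = integral {0..h} (\<lambda>t. \<Sum>i<n. u (real i * h + t))"
    by (rule integral_sum [symmetric])
       (auto intro!: integrable_continuous_interval continuous_on_compose2 [OF u] continuous_intros)
  finally show ?thesis .
qed

context bounded_open
begin

text \<open>Away from a disc about \<open>z\<close>, a small shift of the pole changes the logarithm
  by at most \<open>e\<close>. Checking competitors only outside that disc gives a bound uniform in
  \<open>w\<close>, even for \<open>w\<close> close to the pole.\<close>

lemma log_majorant_pole_close:
  assumes z: "z \<in> G" and e: "e > 0"
  obtains b where "b > 0" "\<And>z' w. z' \<in> ball z b \<Longrightarrow> w \<in> G \<Longrightarrow> z' \<in> G \<and> \<bar>log_majorant G z' w - log_majorant G z w\<bar> \<le> e"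
proof -
  obtain r where r: "r > 0" "cball z r \<subseteq> G"
    using open_G open_contains_cball z by blast
  \<comment> \<open>Outside the disc the distance to either pole is at least \<open>r/2\<close>, so
    \<open>b \<le> r * e / 2\<close> makes the shift a relative change of at most
    \<open>e\<close>.\<close>
  define b where "b = min (r/2) (r * e / 2)"
  have b: "b > 0" "b \<le> r/2" "b \<le> r * e / 2" using r e by (auto simp: b_def)
  have main: "log_majorant G z1 w \<le> log_majorant G z2 w + e"
    if z12: "z1 \<in> G" "z2 \<in> G" and w: "w \<in> G"
      and le: "\<And>x. x \<in> G - ball z r \<Longrightarrow> x \<noteq> z1 \<Longrightarrow> ln (cmod (x - z1)) \<le> ln (cmod (x - z2)) + e \<and> x \<noteq> z2" for z1 z2 w
  proof (rule log_majorant_le_poles [where Z = "{}" and a = z and r = r])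
    show "superharmonic (\<lambda>x. log_majorant G z2 x + e) (G - {})"
      using superharmonic_add [OF log_majorant_superharmonic [OF z12(2)] superharmonic_const [OF open_G]] by simp
    fix x assume x: "x \<in> G - {} - ball z r" "x \<noteq> z1"
    then show "ln (cmod (x - z1)) \<le> log_majorant G z2 x + e"
      using le [of x] ln_le_log_majorant [of x z2] z12 by force
  qed (use that r in auto)
  show thesis
  proof
    show "b > 0" by (rule b)
    fix z' w assume z': "z' \<in> ball z b" and w: "w \<in> G"
    have zz: "norm (z - z') < b" using z' by (simp add: dist_norm)
    have zG: "z' \<in> G" using z' b r by (auto simp: subset_iff)
    have est: "norm (x - z') \<le> norm (x - z) + b" "norm (x - z) \<le> norm (x - z') + b" for x
      using zz norm_triangle_ineq [of "x - z" "z - z'"] norm_triangle_ineq [of "x - z'" "z' - z"]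
      by (auto simp: norm_minus_commute)
    have far: "norm (x - z) \<ge> r" "norm (x - z') \<ge> r/2" if "x \<notin> ball z r" for x
      using that est(2) [of x] b by (auto simp: dist_norm norm_minus_commute)
    have "log_majorant G z' w \<le> log_majorant G z w + e"
    proof (rule main [OF zG z w], intro conjI)
      fix x assume x: "x \<in> G - ball z r"
      have f: "norm (x - z) \<ge> r" "norm (x - z') \<ge> r/2" using far x by auto
      show "ln (cmod (x - z')) \<le> ln (cmod (x - z)) + e"
      proof (rule ln_le_ln_plus)
        have "b \<le> norm (x - z) * e"
          using b f e by (smt (verit) mult_right_mono field_sum_of_halves mult_pos_pos r(1))
        then show "cmod (x - z') \<le> cmod (x - z) * (1 + e)"
          using est(1) [of x] by (simp add: algebra_simps)
      qed (use f r e in auto)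
      show "x \<noteq> z" using f r by auto
    qed
    moreover have "log_majorant G z w \<le> log_majorant G z' w + e"
    proof (rule main [OF z zG w], intro conjI)
      fix x assume x: "x \<in> G - ball z r"
      have f: "norm (x - z) \<ge> r" "norm (x - z') \<ge> r/2" using far x by auto
      show "ln (cmod (x - z)) \<le> ln (cmod (x - z')) + e"
      proof (rule ln_le_ln_plus)
        have "b \<le> norm (x - z') * e"
          using b(3) mult_right_mono [OF f(2), of e] e by linarith
        then show "cmod (x - z) \<le> cmod (x - z') * (1 + e)"
          using est(2) [of x] by (simp add: algebra_simps)
      qed (use f r e in auto)
      show "x \<noteq> z'" using f r by auto
    qed
    ultimately show "z' \<in> G \<and> \<bar>log_majorant G z' w - log_majorant G z w\<bar> \<le> e"
      using zG by auto
  qed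
qed

lemma continuous_on_pole:
  assumes w: "w \<in> G" shows "continuous_on G (\<lambda>z. log_majorant G z w)"
  unfolding continuous_on_iff
proof (intro ballI allI impI)
  fix z e assume z: "z \<in> G" and e: "(e::real) > 0"
  obtain b where "b > 0" "\<And>z' w. z' \<in> ball z b \<Longrightarrow> w \<in> G \<Longrightarrow> z' \<in> G \<and> \<bar>log_majorant G z' w - log_majorant G z w\<bar> \<le> e/2"
    using log_majorant_pole_close [OF z, of "e/2"] e by auto
  then show "\<exists>d>0. \<forall>z'\<in>G. dist z' z < d \<longrightarrow> dist (log_majorant G z' w) (log_majorant G z w) < e"
    using w e by (intro exI [of _ b]) (force simp: dist_real_def dist_commute)
qed

text \<open>The logarithms are replaced by their majorants one pole at a time, each step by minimality.\<close>

lemma sum_log_majorant_circle: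
  assumes a: "a \<in> G" and r: "r > 0" "r < R" "cball a R \<subseteq> G" and w: "w \<in> G"
  shows "(\<Sum>i<2^m. log_majorant G (a + circ r (real i / 2^m + t)) w) \<le> 2^m * log_majorant G a w + ln 2"
proof -
  define N :: nat where "N = 2^m"
  have N: "N \<ge> 1" by (simp add: N_def)
  define z where "z i = a + circ r (real i / 2^m + t)" for i
  have zb: "z i \<in> ball a R" and zG: "z i \<in> G" for i
  proof -
    show "z i \<in> ball a R" using r by (simp add: z_def dist_norm)
    then show "z i \<in> G" using r by auto
  qed
  \<comment> \<open>\<open>P j\<close> is the state after the first \<open>j\<close> logarithms have
    been replaced by their majorants.\<close>
  define P where "P j x \<longleftrightarrow> (\<Sum>i<j. log_majorant G (z i) x) + (\<Sum>i\<in>{j..<N}. ln (cmod (x - z i)))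
     \<le> N * log_majorant G a x + ln 2" for j x
  have base: "P 0 x" if x: "x \<in> G - ball a R" for x
  proof -
    have y: "norm (x - a) > r" using x r by (simp add: dist_norm norm_minus_commute)
    have "(\<Sum>i<2^m. ln (norm (x - a - circ r (real i / 2^m + t)))) \<le> 2^m * ln (norm (x - a)) + ln 2"
      by (rule sum_ln_circle_points [OF y r(1)])
    moreover have "ln (norm (x - a)) \<le> log_majorant G a x"
      using y r x a by (intro ln_le_log_majorant) auto
    then have "2^m * ln (norm (x - a)) \<le> 2^m * log_majorant G a x"
      by (intro mult_left_mono) auto
    ultimately have "(\<Sum>i<2^m. ln (norm (x - a - circ r (real i / 2^m + t)))) \<le> 2^m * log_majorant G a x + ln 2"
      by linarith
    then have "(\<Sum>i<N. ln (norm (x - z i))) \<le> N * log_majorant G a x + ln 2"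
      by (simp add: N_def z_def diff_diff_eq)
    then show ?thesis
      by (simp add: P_def lessThan_atLeast0)
  qed
  have step: "P (Suc j) x" if j: "j < N" and IH: "\<And>x. x \<in> G - ball a R \<Longrightarrow> P j x"
    and x: "x \<in> G - z ` {Suc j..<N}" for j x
  proof -
    let ?Z = "z ` {Suc j..<N}"
    \<comment> \<open>This is \<open>P j\<close> solved for the term of index \<open>j\<close>. The
      remaining logarithms enter with a minus sign, so \<open>S\<close> tends to infinity at their
      poles; elsewhere in \<open>G\<close> it is harmonic.\<close>
    define S where "S x = N * log_majorant G a x + ln 2 + (\<Sum>i<j. - log_majorant G (z i) x)
       + (\<Sum>i\<in>{Suc j..<N}. - ln (cmod (x - z i)))" for x
    have oZ: "open (G - ?Z)" using open_G by (simp add: open_Diff finite_imp_closed)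
    have gsum: "gradient_harmonic (\<lambda>x. \<Sum>i\<in>I. f i x) (G - ?Z)"
      if "finite I" "\<And>i. i \<in> I \<Longrightarrow> gradient_harmonic (f i) (G - ?Z)" for I and f :: "nat \<Rightarrow> complex \<Rightarrow> real"
      using that by (induction I rule: finite_induct) (auto intro!: gradient_harmonic_add gradient_harmonic_const oZ)
    have gl: "gradient_harmonic (log_majorant G y) (G - ?Z)" if "y \<in> G" for y
      by (rule gradient_harmonic_subset [OF log_majorant_harmonic [OF that] oZ]) auto
    have hS: "gradient_harmonic S (G - ?Z)"
      unfolding S_def
    proof (intro gradient_harmonic_add gsum gradient_harmonic_const oZ gradient_harmonic_cmult gradient_harmonic_minus gl a zG)
      fix i assume "i \<in> {Suc j..<N}"
      then show "gradient_harmonic (\<lambda>x. ln (cmod (x - z i))) (G - ?Z)"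
        by (intro gradient_harmonic_subset [OF ln_norm_harmonic oZ]) auto
    qed auto
    have "log_majorant G (z j) x \<le> S x"
    proof (rule log_majorant_le_poles [where Z = ?Z and a = a and r = R])
      show "superharmonic S (G - ?Z)" using hS gradient_harmonic_superharmonic by blast
      show "ln (cmod (x - z j)) \<le> S x" if x: "x \<in> G - ?Z - ball a R" for x
      proof -
        have "P j x" using IH x by blast
        moreover have "(\<Sum>i\<in>{j..<N}. ln (cmod (x - z i))) = ln (cmod (x - z j)) + (\<Sum>i\<in>{Suc j..<N}. ln (cmod (x - z i)))"
          using j by (rule sum.atLeast_Suc_lessThan)
        ultimately show ?thesis
          unfolding P_def S_def sum_negf by linarith
      qed
      fix y assume "y \<in> ?Z"
      then obtain i0 where i0: "i0 \<in> {Suc j..<N}" "y = z i0" by blast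
      have yG: "y \<in> G" using i0 zG by simp
      let ?I = "{Suc j..<N} - {i0}"
      \<comment> \<open>The \<open>j\<close> majorants and the logarithms with index other than
        \<open>i0\<close> are estimated by \<open>ln d\<close>; what is left tends to infinity at
        \<open>y\<close>.\<close>
      define K where "K = ln 2 - real j * ln d - real (card ?I) * ln d"
      have "isCont (log_majorant G a) y"
        using gradient_harmonic_continuous [OF log_majorant_harmonic [OF a]] yG open_G continuous_on_eq_continuous_at by blast
      then have "((\<lambda>x. N * log_majorant G a x + K) \<longlongrightarrow> N * log_majorant G a y + K) (at y)"
        by (intro tendsto_intros) (simp add: isCont_def)
      moreover have "filterlim (\<lambda>x. - ln (cmod (x - y))) at_top (at y)"
        using ln_norm_at_bot [of y] by (simp add: filterlim_uminus_at_top)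
      ultimately have "filterlim (\<lambda>x. N * log_majorant G a x + K + - ln (cmod (x - y))) at_top (at y)"
        by (rule filterlim_tendsto_add_at_top)
      then have "\<forall>\<^sub>F x in at y. ln d \<le> N * log_majorant G a x + K + - ln (cmod (x - y))"
        by (simp add: filterlim_at_top)
      moreover have "\<forall>\<^sub>F x in at y. x \<in> G"
        using yG open_G eventually_at_topological by blast
      moreover have "\<forall>\<^sub>F x in at y. \<forall>i\<in>{Suc j..<N}. x \<noteq> z i"
        by (rule eventually_ball_finite) (auto intro: eventually_neq_at_within)
      ultimately show "\<forall>\<^sub>F x in at y. ln d \<le> S x"
      proof eventually_elim
        case (elim x)
        have "(\<Sum>i<j. log_majorant G (z i) x) \<le> (\<Sum>i<j. ln d)"
          using elim zG by (intro sum_mono log_majorant_le_ln_diam) auto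
        moreover have "(\<Sum>i\<in>?I. ln (cmod (x - z i))) \<le> (\<Sum>i\<in>?I. ln d)"
          using elim diam [of x] zG by (intro sum_mono ln_mono) auto
        moreover have "(\<Sum>i\<in>{Suc j..<N}. ln (cmod (x - z i))) = ln (cmod (x - z i0)) + (\<Sum>i\<in>?I. ln (cmod (x - z i)))"
          using i0 by (intro sum.remove) auto
        ultimately show ?case
          using elim(1) i0 unfolding S_def K_def sum_negf by simp
      qed
    qed (use zG r x in auto)
    then show ?thesis
      unfolding P_def S_def sum_negf by simp
  qed
  have all: "P j x" if "j \<le> N" "x \<in> G - ball a R" for j x
    using that
  proof (induction j arbitrary: x)
    case 0
    then show ?case using base by blast
  next
    case (Suc j)
    then have "x \<in> G - z ` {Suc j..<N}" using zb by blast
    then show ?case using step [of j x] Suc by auto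
  qed
  \<comment> \<open>The last step leaves no pole to exclude: \<open>{Suc (N - 1)..<N}\<close> is
    empty, so the bound holds at every point of \<open>G\<close>, also inside the disc.\<close>
  have "P (Suc (N - 1)) w"
    by (rule step) (use N all w in auto)
  then show ?thesis
    using N by (simp add: P_def N_def z_def)
qed

text \<open>Means over finitely many poles are averaged over all rotations into the mean over the
  circle; the error \<open>ln 2 / 2^m\<close> disappears as \<open>m\<close> grows.\<close>

lemma superharmonic_pole:
  assumes w: "w \<in> G" shows "superharmonic (\<lambda>z. log_majorant G z w) G"
proof (rule superharmonicI [OF open_G continuous_on_pole [OF w]])
  fix a assume a: "a \<in> G"
  then obtain R where R: "R > 0" "cball a R \<subseteq> G"
    using open_G open_contains_cball by blast
  have "circle_mean (\<lambda>z. log_majorant G z w) a r \<le> log_majorant G a w" if r: "0 < r" "r < R" for r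
  proof -
    define u where "u s = log_majorant G (a + circ r s) w" for s
    have mem: "a + circ r s \<in> G" for s using R r by (auto simp: subset_iff dist_norm)
    have cu: "continuous_on UNIV u"
      unfolding u_def by (rule continuous_on_compose2 [OF continuous_on_pole [OF w]]) (use mem in \<open>auto intro!: continuous_intros\<close>)
    have bnd: "integral {0..1} u \<le> log_majorant G a w + ln 2 * (1/2)^m" for m :: nat
    proof -
      let ?h = "1 / 2^m :: real"
      have "integral {0..1} u = integral {0..real (2^m) * ?h} u" by simp
      also have "\<dots> = integral {0..?h} (\<lambda>t. \<Sum>i<2^m. u (real i * ?h + t))"
        by (rule integral_equal_pieces [OF cu]) simp
      also have "\<dots> \<le> integral {0..?h} (\<lambda>t. 2^m * log_majorant G a w + ln 2)"
      proof (rule integral_le)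
        show "(\<lambda>t. \<Sum>i<2^m. u (real i * ?h + t)) integrable_on {0..?h}"
          by (intro integrable_continuous_interval continuous_intros continuous_on_compose2 [OF cu]) auto
        show "(\<Sum>i<2^m. u (real i * ?h + t)) \<le> 2^m * log_majorant G a w + ln 2" for t
          using sum_log_majorant_circle [OF a r R(2) w, of m t] by (simp add: u_def)
      qed auto
      also have "\<dots> = log_majorant G a w + ln 2 * (1/2)^m"
        by (simp add: field_simps power_divide)
      finally show ?thesis .
    qed
    have "(\<lambda>m. log_majorant G a w + ln 2 * (1/2)^m) \<longlonglongrightarrow> log_majorant G a w + ln 2 * 0"
      by (intro tendsto_intros LIMSEQ_power_zero) auto
    then have "integral {0..1} u \<le> log_majorant G a w"
      using bnd by (intro LIMSEQ_le_const) auto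
    then show ?thesis unfolding circle_mean_def u_def .
  qed
  then show "\<exists>e>0. \<forall>r. 0 < r \<and> r < e \<longrightarrow> circle_mean (\<lambda>z. log_majorant G z w) a r \<le> log_majorant G a w"
    using R by blast
qed

text \<open>As a function of the pole, the majorant is itself a competitor for the other pole.\<close>

theorem log_majorant_symmetric:
  assumes "z \<in> G" "w \<in> G"
  shows "log_majorant G z w = log_majorant G w z"
proof -
  have "log_majorant G w z \<le> log_majorant G z w" if "z \<in> G" "w \<in> G" for z w
  proof (rule log_majorant_le [where S = "\<lambda>z. log_majorant G z w"])
    show "(\<lambda>z. log_majorant G z w) \<in> pole_majorants G w"
      unfolding pole_majorants_def
      using superharmonic_pole [OF that(2)] ln_le_log_majorant [OF that(2)] by (auto simp: norm_minus_commute)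
  qed (rule that)
  then show ?thesis using assms by (intro antisym) auto
qed

end

section \<open>Behaviour at an analytic boundary arc\<close>

definition half_disc :: "real \<Rightarrow> complex set" where
  "half_disc R = {z \<in> ball 0 R. Im z > 0}"

lemma open_half_disc: "open (half_disc R)"
proof -
  have "half_disc R = ball 0 R \<inter> {z. Im z > 0}" by (auto simp: half_disc_def)
  then show ?thesis by (simp add: open_Int open_halfspace_Im_gt)
qed

lemma half_disc_mono: "r \<le> R \<Longrightarrow> half_disc r \<subseteq> half_disc R"
  by (auto simp: half_disc_def)

text \<open>Comparison with the barrier \<open>Re ((\<zeta> - x)\<^sup>2 - 2 \<i> r (\<zeta> - x)) / r\<^sup>2\<close>, which is nonnegative on the
  half disc of radius \<open>r\<close> about \<open>x\<close>, vanishes at \<open>x\<close> and is at least 1 on the half circle.\<close>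

lemma (in bounded_open) green_tendsto_boundary:
  assumes f: "f holomorphic_on ball 0 R" "inj_on f (ball 0 R)" "f ` half_disc R \<subseteq> G"
    and real: "\<And>\<zeta>. \<zeta> \<in> ball 0 R \<Longrightarrow> Im \<zeta> = 0 \<Longrightarrow> f \<zeta> \<notin> G"
    and z: "z \<in> G" and x: "x \<in> ball 0 R" "Im x = 0"
  shows "((\<lambda>\<zeta>. log_majorant G z (f \<zeta>) - ln (cmod (f \<zeta> - z))) \<longlongrightarrow> 0) (at x within half_disc R)"
proof -
  define \<delta> where "\<delta> = norm (f x - z) / 2"
  have \<delta>: "\<delta> > 0" using real [OF x] z by (auto simp: \<delta>_def)
  have cf: "continuous_on (ball 0 R) f" using f holomorphic_on_imp_continuous_on by blast
  have "isCont f x" using cf x continuous_on_eq_continuous_at open_ball by blast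
  then obtain s where s: "s > 0" "\<And>y. dist y x < s \<Longrightarrow> dist (f y) (f x) < \<delta>"
    using \<delta> unfolding continuous_at_eps_delta by blast
  obtain s' where s': "s' > 0" "cball x s' \<subseteq> ball 0 R"
    using x open_contains_cball open_ball by blast
  define r where "r = min (s/2) s'"
  have r: "r > 0" "cball x r \<subseteq> ball 0 R" using s s' by (auto simp: r_def)
  have far: "\<delta> \<le> norm (f \<zeta> - z)" if "\<zeta> \<in> cball x r" for \<zeta>
  proof -
    have "dist (f \<zeta>) (f x) < \<delta>"
      using that s by (intro s(2)) (auto simp: r_def dist_commute)
    then show ?thesis
      using norm_triangle_ineq [of "f x - f \<zeta>" "f \<zeta> - z"] by (simp add: \<delta>_def dist_norm norm_minus_commute)
  qed
  define M where "M = ln d - ln \<delta>"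
  \<comment> \<open>\<open>M\<close> bounds the Green function on the image of the small half disc,
    whose points keep the distance \<open>\<delta>\<close> from the pole. As \<open>M'\<close> is
    larger, the scaled barrier exceeds the Green function on the half circle.\<close>
  define M' where "M' = max M 0 + 1"
  have M': "M' > 0" "M' > M" by (auto simp: M'_def)
  define q where "q \<zeta> = ((\<zeta> - x)\<^sup>2 - 2 * \<i> * of_real r * (\<zeta> - x)) / of_real (r\<^sup>2)" for \<zeta>
  have q: "Re (q \<zeta>) = ((Re (\<zeta> - x))\<^sup>2 - (Im \<zeta>)\<^sup>2 + 2 * r * Im \<zeta>) / r\<^sup>2" for \<zeta>
    using x r by (simp add: q_def Re_divide power2_eq_square power4_eq_xxxx divide_simps)
  have q_lower: "Re (q \<zeta>) \<ge> (norm (\<zeta> - x))\<^sup>2 / r\<^sup>2" if "\<zeta> \<in> cball x r" "Im \<zeta> \<ge> 0" for \<zeta>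
  proof -
    have "Im \<zeta> \<le> r"
      using that abs_Im_le_cmod [of "\<zeta> - x"] x by (simp add: dist_norm norm_minus_commute)
    then have "Im \<zeta> * Im \<zeta> \<le> r * Im \<zeta>" using that by (intro mult_right_mono) auto
    then show ?thesis
      unfolding q cmod_power2 using x r
      by (intro divide_right_mono) (auto simp: power2_eq_square)
  qed
  have q_nonneg: "Re (q \<zeta>) \<ge> 0" if "\<zeta> \<in> cball x r" "Im \<zeta> \<ge> 0" for \<zeta>
    by (rule order_trans [OF _ q_lower [OF that]]) simp
  have q_holo: "q holomorphic_on UNIV"
    unfolding q_def using r by (intro holomorphic_intros) auto
  define B where "B = ball x r \<inter> {\<zeta>. Im \<zeta> > 0}"
  have oB: "open B" by (simp add: B_def open_Int open_halfspace_Im_gt)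
  have "B \<subseteq> cball x r" by (auto simp: B_def)
  then have BR: "B \<subseteq> half_disc R" "B \<subseteq> ball 0 R"
    using r(2) by (auto simp: B_def half_disc_def simp del: mem_ball mem_cball)
  define V where "V = f ` B"
  have oV: "open V" unfolding V_def
  proof (rule open_mapping_thm3 [OF _ oB])
    show "f holomorphic_on B" by (rule holomorphic_on_subset [OF f(1) BR(2)])
    show "inj_on f B" by (rule inj_on_subset [OF f(2) BR(2)])
  qed
  have VG: "V \<subseteq> G" using f BR by (auto simp: V_def)
  have zV: "z \<notin> V"
  proof
    assume "z \<in> V"
    then obtain \<zeta> where "\<zeta> \<in> B" "z = f \<zeta>" by (auto simp: V_def)
    then show False using far [of \<zeta>] \<delta> by (simp add: B_def)
  qed
  obtain g where g: "g holomorphic_on f ` ball 0 R" "\<And>\<zeta>. \<zeta> \<in> ball 0 R \<Longrightarrow> g (f \<zeta>) = \<zeta>"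
    using holomorphic_has_inverse [OF f(1) open_ball f(2)] by metis
  let ?b = "\<lambda>y. ln (cmod (y - z)) + M' * Re (q (g y))"
  \<comment> \<open>The barrier is pasted in on \<open>V\<close>. Once \<open>S\<close> is
    superharmonic it is a competitor, so minimality bounds the majorant by the barrier on
    \<open>V\<close>.\<close>
  define S where "S y = (if y \<in> V then min (log_majorant G z y) (?b y) else log_majorant G z y)" for y
  \<comment> \<open>The only points where the barrier can undercut the Green function. Their image
    is closed and, within \<open>G\<close>, contained in the open set \<open>V\<close>; off it
    \<open>S\<close> is the majorant itself, so the pasting is a local matter.\<close>
  define C where "C = {\<zeta> \<in> cball x r. 0 \<le> Im \<zeta> \<and> M' * Re (q \<zeta>) \<le> M}"
  have "C = cball x r \<inter> {\<zeta>. 0 \<le> Im \<zeta>} \<inter> {\<zeta>. M' * Re (q \<zeta>) \<le> M}"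
    by (auto simp: C_def)
  then have "compact C"
    using holomorphic_on_imp_continuous_on [OF q_holo]
    by (auto intro!: compact_Int_closed closed_Collect_le continuous_intros)
  moreover have "continuous_on C f"
    by (rule continuous_on_subset [OF cf]) (use r(2) in \<open>auto simp: C_def simp del: mem_cball mem_ball\<close>)
  ultimately have fC: "closed (f ` C)"
    using compact_continuous_image compact_imp_closed by blast
  have CV: "y \<in> V" if y: "y \<in> f ` C" "y \<in> G" for y
  proof -
    obtain \<zeta> where \<zeta>: "\<zeta> \<in> cball x r" "0 \<le> Im \<zeta>" "M' * Re (q \<zeta>) \<le> M" "y = f \<zeta>"
      using y by (auto simp: C_def)
    have "Im \<zeta> \<noteq> 0" using real [of \<zeta>] \<zeta> y r by blast
    moreover have "norm (\<zeta> - x) \<noteq> r"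
    proof
      assume "norm (\<zeta> - x) = r"
      then have "Re (q \<zeta>) \<ge> 1" using q_lower \<zeta> r by fastforce
      then have "M' * Re (q \<zeta>) \<ge> M' * 1" using M' by (intro mult_left_mono) auto
      then show False using \<zeta>(3) M' by linarith
    qed
    ultimately have "\<zeta> \<in> B" using \<zeta> by (auto simp: B_def dist_norm norm_minus_commute)
    then show ?thesis using \<zeta> by (simp add: V_def)
  qed
  have sup_b: "superharmonic ?b V"
  proof (intro superharmonic_add superharmonic_cmult)
    show "superharmonic (\<lambda>y. ln (cmod (y - z))) V"
      using superharmonic_subset [OF gradient_harmonic_superharmonic [OF ln_norm_harmonic] oV] zV by blast
    have "g holomorphic_on V" using g(1) BR holomorphic_on_subset unfolding V_def by (metis image_mono)
    then have "(\<lambda>y. q (g y)) holomorphic_on V"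
      using holomorphic_on_compose_gen [OF _ q_holo, of g V] by (simp add: o_def)
    then show "superharmonic (\<lambda>y. Re (q (g y))) V"
      using gradient_harmonic_Re oV gradient_harmonic_superharmonic by blast
  qed (use M' in auto)
  have "superharmonic S G"
  proof (rule superharmonic_local [OF open_G])
    fix y assume y: "y \<in> G"
    show "\<exists>N v. y \<in> N \<and> superharmonic v N \<and> N \<subseteq> G \<and> (\<forall>w\<in>N. S w = v w)"
    proof (cases "y \<in> V")
      case True
      have "superharmonic (\<lambda>y. min (log_majorant G z y) (?b y)) V"
        by (intro superharmonic_min sup_b superharmonic_subset [OF log_majorant_superharmonic [OF z] oV VG])
      then show ?thesis
        using True VG by (intro exI [of _ V] exI [of _ "\<lambda>y. min (log_majorant G z y) (?b y)"]) (auto simp: S_def)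
    next
      case False
      let ?N = "G - f ` C"
      have "superharmonic (log_majorant G z) ?N"
        using open_G fC by (intro superharmonic_subset [OF log_majorant_superharmonic [OF z]]) auto
      moreover have "S w = log_majorant G z w" if w: "w \<in> ?N" for w
      proof (cases "w \<in> V")
        case True
        then obtain \<zeta> where \<zeta>: "\<zeta> \<in> B" "w = f \<zeta>" by (auto simp: V_def)
        then have \<zeta>c: "\<zeta> \<in> cball x r" "Im \<zeta> \<ge> 0" by (auto simp: B_def)
        then have "M' * Re (q \<zeta>) > M" using w \<zeta> by (force simp: C_def)
        moreover have "g w = \<zeta>" using g \<zeta> BR by blast
        moreover have "ln \<delta> \<le> ln (cmod (w - z))" using far \<zeta>c \<zeta> \<delta> by (intro ln_mono) auto
        moreover have "log_majorant G z w \<le> ln d" using log_majorant_le_ln_diam w z by blast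
        ultimately show ?thesis by (simp add: S_def M_def)
      qed (simp add: S_def)
      ultimately show ?thesis
        using False y CV by (intro exI [of _ ?N] exI [of _ "log_majorant G z"]) auto
    qed
  qed
  moreover have "ln (cmod (y - z)) \<le> S y" if y: "y \<in> G - {z}" for y
  proof -
    have 1: "ln (cmod (y - z)) \<le> log_majorant G z y" using ln_le_log_majorant y z by blast
    have "ln (cmod (y - z)) \<le> ?b y" if "y \<in> V"
    proof -
      obtain \<zeta> where \<zeta>: "\<zeta> \<in> B" "y = f \<zeta>" using \<open>y \<in> V\<close> by (auto simp: V_def)
      then have "Re (q \<zeta>) \<ge> 0" by (intro q_nonneg) (auto simp: B_def)
      moreover have "g y = \<zeta>" using g \<zeta> BR by blast
      ultimately show ?thesis using M' by simp
    qed
    then show ?thesis using 1 by (simp add: S_def)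
  qed
  ultimately have "S \<in> pole_majorants G z" by (simp add: pole_majorants_def)
  then have up: "log_majorant G z y \<le> S y" if "y \<in> G" for y
    using log_majorant_le that by blast
  have upper: "log_majorant G z (f \<zeta>) - ln (cmod (f \<zeta> - z)) \<le> M' * Re (q \<zeta>)" if \<zeta>: "\<zeta> \<in> B" for \<zeta>
  proof -
    have "f \<zeta> \<in> V" "g (f \<zeta>) = \<zeta>" using \<zeta> g BR by (auto simp: V_def)
    then show ?thesis using up [of "f \<zeta>"] VG by (auto simp: S_def)
  qed
  have evB: "\<forall>\<^sub>F \<zeta> in at x within half_disc R. \<zeta> \<in> B"
    unfolding eventually_at using r by (intro exI [of _ r]) (auto simp: B_def half_disc_def dist_commute)
  have "isCont q x"
    using holomorphic_on_imp_continuous_on [OF q_holo] continuous_on_eq_continuous_at open_UNIV by blast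
  then have "(q \<longlongrightarrow> q x) (at x within half_disc R)"
    unfolding isCont_def by (rule tendsto_within_subset) auto
  then have "((\<lambda>\<zeta>. M' * Re (q \<zeta>)) \<longlongrightarrow> M' * Re (q x)) (at x within half_disc R)"
    by (intro tendsto_intros)
  moreover have "q x = 0" by (simp add: q_def)
  ultimately have "((\<lambda>\<zeta>. M' * Re (q \<zeta>)) \<longlongrightarrow> 0) (at x within half_disc R)"
    by simp
  then show ?thesis
  proof (rule tendsto_sandwich [OF _ _ tendsto_const, rotated 2])
    show "\<forall>\<^sub>F \<zeta> in at x within half_disc R. 0 \<le> log_majorant G z (f \<zeta>) - ln (cmod (f \<zeta> - z))"
      using evB
    proof eventually_elim
      case (elim \<zeta>)
      then have "f \<zeta> \<in> V" by (simp add: V_def)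
      then show ?case using ln_le_log_majorant [of "f \<zeta>" z] VG z zV by auto
    qed
    show "\<forall>\<^sub>F \<zeta> in at x within half_disc R. log_majorant G z (f \<zeta>) - ln (cmod (f \<zeta> - z)) \<le> M' * Re (q \<zeta>)"
      using evB by eventually_elim (rule upper)
  qed
qed

section \<open>Odd reflection and Poisson's formula for a half disc\<close>

definition half_harmonic :: "(complex \<Rightarrow> real) \<Rightarrow> real \<Rightarrow> real \<Rightarrow> bool" where
  "half_harmonic u r M \<longleftrightarrow> continuous_on {z \<in> cball 0 r. Im z \<ge> 0} u \<and> gradient_harmonic u (half_disc r) \<and>
     (\<forall>z\<in>cball 0 r. Im z = 0 \<longrightarrow> u z = 0) \<and> (\<forall>z\<in>sphere 0 r. Im z \<ge> 0 \<longrightarrow> \<bar>u z\<bar> \<le> M)"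

definition odd_ext :: "(complex \<Rightarrow> real) \<Rightarrow> complex \<Rightarrow> real" where
  "odd_ext u z = (if Im z \<ge> 0 then u z else - u (cnj z))"

text \<open>\<open>Im w\<close> times this is half the difference of the Poisson kernels at \<open>w\<close> and its conjugate.\<close>

definition half_kernel :: "complex \<Rightarrow> complex \<Rightarrow> real" where
  "half_kernel s w = 2 * ((norm s)\<^sup>2 - (norm w)\<^sup>2) * Im s / ((norm (s - w))\<^sup>2 * (norm (s - cnj w))\<^sup>2)"

lemma integral_reflect_01:
  fixes f :: "real \<Rightarrow> real"
  shows "integral {0..1} (\<lambda>t. f (1 - t)) = integral {0..1} f"
  using integral_shift_Icc_real [of 0 1 "\<lambda>x. f (- x)" "-1"] Henstock_Kurzweil_Integration.integral_reflect_real [of 1 0 f]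
  by (simp add: o_def)

lemma poisson_kernel_cnj: "poisson_kernel (cnj s) (cnj w) = poisson_kernel s w"
  by (simp add: poisson_kernel_eq flip: complex_cnj_diff)

lemma circ_reflect: "circ r (1 - t) = cnj (circ r t)"
proof -
  have "cis (2 * pi * (1 - t)) = cnj (cis (2 * pi * t))"
    by (simp add: complex_eq_iff right_diff_distrib cos_diff sin_diff)
  then show ?thesis by (simp add: circ_def)
qed

text \<open>The identity \<open>|s - cnj w|^2 - |s - w|^2 = 4 * Im s * Im w\<close> is the source of
  the factor \<open>Im w\<close>, and so of the linear decay at the axis.\<close>

lemma poisson_kernel_diff:
  assumes "s \<noteq> w" "s \<noteq> cnj w"
  shows "poisson_kernel s w - poisson_kernel s (cnj w) = 2 * Im w * half_kernel s w"
proof -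
  have "(norm (s - cnj w))\<^sup>2 - (norm (s - w))\<^sup>2 = 4 * Im s * Im w"
    unfolding cmod_power2 by (simp add: power2_eq_square algebra_simps)
  moreover have "poisson_kernel s w - poisson_kernel s (cnj w) =
      ((norm s)\<^sup>2 - (norm w)\<^sup>2) * ((norm (s - cnj w))\<^sup>2 - (norm (s - w))\<^sup>2) / ((norm (s - w))\<^sup>2 * (norm (s - cnj w))\<^sup>2)"
    using assms by (simp add: poisson_kernel_eq field_simps)
  ultimately show ?thesis
    by (simp add: half_kernel_def)
qed

lemma half_harmonic_odd_ext_continuous:
  assumes "half_harmonic u r M"
  shows "continuous_on (sphere 0 r) (odd_ext u)"
proof -
  have c: "continuous_on {z \<in> cball 0 r. Im z \<ge> 0} u" and z0: "\<And>z. z \<in> cball 0 r \<Longrightarrow> Im z = 0 \<Longrightarrow> u z = 0"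
    using assms by (auto simp: half_harmonic_def)
  let ?A = "sphere 0 r \<inter> {z. Im z \<ge> 0}" and ?B = "sphere 0 r \<inter> {z. Im z \<le> 0}"
  have "continuous_on (?A \<union> ?B) (\<lambda>z. if Im z \<ge> 0 then u z else - u (cnj z))"
  proof (rule continuous_on_cases)
    show "closed ?A" "closed ?B"
      by (auto intro!: closed_Int closed_halfspace_Im_ge closed_halfspace_Im_le)
    show "continuous_on ?A u" by (rule continuous_on_subset [OF c]) auto
    show "continuous_on ?B (\<lambda>z. - u (cnj z))"
      by (intro continuous_intros continuous_on_compose2 [OF c]) auto
    show "\<forall>z. z \<in> ?A \<and> \<not> 0 \<le> Im z \<or> z \<in> ?B \<and> 0 \<le> Im z \<longrightarrow> u z = - u (cnj z)"
      using z0 by (auto simp: complex_is_Real_iff)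
  qed
  moreover have "?A \<union> ?B = sphere 0 r" by auto
  ultimately show ?thesis by (simp add: odd_ext_def [abs_def])
qed

text \<open>The Poisson integral of odd data is odd, hence zero on the axis, and agrees with
  \<open>u\<close> on the half disc by the minimum principle. Half the difference of its values at
  \<open>w\<close> and \<open>cnj w\<close> yields \<open>half_kernel\<close>.\<close>

lemma half_harmonic_representation:
  assumes u: "half_harmonic u r M" and r: "r > 0" and w: "w \<in> half_disc r"
  shows "u w = Im w * integral {0..1} (\<lambda>t. odd_ext u (circ r t) * half_kernel (circ r t) w)"
    and "(\<lambda>t. odd_ext u (circ r t) * half_kernel (circ r t) w) integrable_on {0..1}"
proof -
  have cu: "continuous_on {z \<in> cball 0 r. Im z \<ge> 0} u" and hu: "gradient_harmonic u (half_disc r)"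
    and z0: "\<And>z. z \<in> cball 0 r \<Longrightarrow> Im z = 0 \<Longrightarrow> u z = 0"
    using u by (auto simp: half_harmonic_def)
  let ?U = "odd_ext u"
  have cU: "continuous_on (sphere 0 r) ?U" using half_harmonic_odd_ext_continuous u by blast
  have refl: "poisson ?U 0 r (cnj z) = - poisson ?U 0 r z" for z
  proof -
    have odd: "?U (cnj (circ r t)) = - ?U (circ r t)" for t
    proof (cases "Im (circ r t) = 0")
      case True
      then have "cnj (circ r t) = circ r t" by (simp add: complex_eq_iff)
      then show ?thesis using z0 [of "circ r t"] r True by (simp add: odd_ext_def)
    qed (simp add: odd_ext_def)
    have "poisson ?U 0 r (cnj z) = integral {0..1} (\<lambda>t. ?U (circ r (1 - t)) * poisson_kernel (circ r (1 - t)) (cnj z))"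
      using integral_reflect_01 [of "\<lambda>t. ?U (circ r t) * poisson_kernel (circ r t) (cnj z)"]
      by (simp add: poisson_def)
    also have "\<dots> = integral {0..1} (\<lambda>t. - (?U (circ r t) * poisson_kernel (circ r t) z))"
      by (simp add: circ_reflect poisson_kernel_cnj odd)
    finally show ?thesis by (simp add: poisson_def)
  qed
  have real0: "poisson ?U 0 r z = 0" if "Im z = 0" for z
  proof -
    have "cnj z = z" using that by (simp add: complex_eq_iff)
    then show ?thesis using refl [of z] by simp
  qed
  let ?d = "dirichlet ?U 0 r"
  have cd: "continuous_on (cball 0 r) ?d"
  proof -
    have "sphere 0 r \<union> ball 0 r = cball (0::complex) r" by auto
    then show ?thesis using dirichlet_continuous [OF cU subset_refl r] by simp
  qed
  have hd: "gradient_harmonic ?d (half_disc r)"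
    by (rule gradient_harmonic_subset [OF dirichlet_harmonic [OF cU] open_half_disc]) (auto simp: half_disc_def)
  have clos: "closure (half_disc r) \<subseteq> {z \<in> cball 0 r. Im z \<ge> 0}"
  proof (rule closure_minimal)
    have "{z \<in> cball 0 r. Im z \<ge> 0} = cball 0 r \<inter> {z. Im z \<ge> 0}" by auto
    then show "closed {z \<in> cball 0 r. Im z \<ge> 0}"
      by (simp add: closed_Int closed_halfspace_Im_ge)
  qed (auto simp: half_disc_def)
  have eq: "?d y = u y" if "y \<in> frontier (half_disc r)" for y
  proof -
    have y: "y \<in> cball 0 r" "Im y \<ge> 0" "y \<notin> half_disc r"
      using that clos open_half_disc by (auto simp: frontier_def interior_open)
    show ?thesis
    proof (cases "norm y < r")
      case True
      then have "Im y = 0" using y by (auto simp: half_disc_def)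
      then show ?thesis using True y z0 real0 by (simp add: dirichlet_def)
    qed (use y in \<open>auto simp: dirichlet_def odd_ext_def\<close>)
  qed
  have cdu: "continuous_on (closure (half_disc r)) ?d" "continuous_on (closure (half_disc r)) u"
    by (rule continuous_on_subset [OF cd]; use clos in blast) (rule continuous_on_subset [OF cu clos])
  have wc: "w \<in> closure (half_disc r)" using w closure_subset by blast
  have bd: "bounded (half_disc r)" by (rule bounded_subset [OF bounded_ball [of 0 r]]) (auto simp: half_disc_def)
  have "u w - ?d w \<ge> 0"
    by (rule minimum_principle_closure [where S = "\<lambda>w. u w - ?d w", OF gradient_harmonic_superharmonic [OF gradient_harmonic_diff] bd _ _ wc])
      (use hu hd cdu eq in \<open>auto intro!: continuous_intros\<close>)
  moreover have "?d w - u w \<ge> 0"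
    by (rule minimum_principle_closure [where S = "\<lambda>w. ?d w - u w", OF gradient_harmonic_superharmonic [OF gradient_harmonic_diff] bd _ _ wc])
      (use hu hd cdu eq in \<open>auto intro!: continuous_intros\<close>)
  ultimately have uw: "u w = poisson ?U 0 r w"
    using w by (simp add: dirichlet_def half_disc_def)
  have wb: "w \<in> ball 0 r" "cnj w \<in> ball 0 r" and wr: "norm w < r" using w by (auto simp: half_disc_def)
  have nz: "circ r t \<noteq> w" "circ r t \<noteq> cnj w" for t
    using wr r norm_circ [of r t] by (metis abs_of_pos complex_mod_cnj less_irrefl)+
  have i: "(\<lambda>t. ?U (circ r t) * poisson_kernel (circ r t) z) integrable_on {0..1}" if "z \<in> ball 0 r" for z
    using poisson_integrand_continuous [OF cU that] integrable_continuous_interval by fastforce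
  have pk: "?U (circ r t) * half_kernel (circ r t) w =
      (?U (circ r t) * poisson_kernel (circ r t) w - ?U (circ r t) * poisson_kernel (circ r t) (cnj w)) / (2 * Im w)" for t
  proof -
    have "Im w \<noteq> 0" using w by (simp add: half_disc_def)
    then show ?thesis
      using poisson_kernel_diff [OF nz, of t] by (simp add: right_diff_distrib [symmetric])
  qed
  show "(\<lambda>t. ?U (circ r t) * half_kernel (circ r t) w) integrable_on {0..1}"
    unfolding pk by (intro integrable_on_divide integrable_diff i wb)
  have "integral {0..1} (\<lambda>t. ?U (circ r t) * half_kernel (circ r t) w) =
      (poisson ?U 0 r w - poisson ?U 0 r (cnj w)) / (2 * Im w)"
    unfolding pk poisson_def using i wb by (simp add: integral_diff)
  then show "u w = Im w * integral {0..1} (\<lambda>t. odd_ext u (circ r t) * half_kernel (circ r t) w)"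
    using w uw refl by (simp add: half_disc_def)
qed

lemma half_kernel_continuous:
  assumes "r > 0"
  shows "continuous_on (sphere 0 r \<times> cball 0 (r/2)) (\<lambda>(s, w). half_kernel s w)"
proof -
  have "fst p - snd p \<noteq> 0" "fst p - cnj (snd p) \<noteq> 0" if "p \<in> sphere 0 r \<times> cball 0 (r/2)" for p :: "complex \<times> complex"
    using that assms by (auto simp: mem_Times_iff)
  then show ?thesis
    unfolding half_kernel_def case_prod_unfold by (intro continuous_intros) auto
qed

lemma half_harmonic_odd_ext_bound:
  assumes "half_harmonic u r M" "r > 0"
  shows "\<bar>odd_ext u (circ r t)\<bar> \<le> M"
proof -
  have b: "\<And>z. z \<in> sphere 0 r \<Longrightarrow> Im z \<ge> 0 \<Longrightarrow> \<bar>u z\<bar> \<le> M"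
    using assms(1) by (auto simp: half_harmonic_def)
  show ?thesis
    using b [of "circ r t"] b [of "cnj (circ r t)"] assms(2) by (auto simp: odd_ext_def)
qed

text \<open>The constant bounds the kernel on a compact set, so it depends on \<open>r\<close> alone
  and not on \<open>u\<close>; it will be applied to a whole family of functions.\<close>

lemma half_harmonic_linear_bound:
  assumes r: "r > 0"
  obtains C where "C \<ge> 0"
    "\<And>u M w. half_harmonic u r M \<Longrightarrow> w \<in> half_disc r \<Longrightarrow> norm w \<le> r/2 \<Longrightarrow> \<bar>u w\<bar> \<le> C * M * Im w"
proof -
  have "compact (sphere (0::complex) r \<times> cball (0::complex) (r/2))"
    by (intro compact_Times) auto
  then have "bounded ((\<lambda>(s, w). half_kernel s w) ` (sphere 0 r \<times> cball 0 (r/2)))"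
    using half_kernel_continuous [OF r] compact_continuous_image compact_imp_bounded by blast
  then obtain C where C: "C > 0" "\<And>s w. s \<in> sphere 0 r \<Longrightarrow> w \<in> cball 0 (r/2) \<Longrightarrow> \<bar>half_kernel s w\<bar> \<le> C"
    unfolding bounded_pos by fastforce
  show thesis
  proof
    show "C \<ge> 0" using C by simp
    fix u M w assume u: "half_harmonic u r M" and w: "w \<in> half_disc r" "norm w \<le> r/2"
    have "norm (integral {0..1} (\<lambda>t. odd_ext u (circ r t) * half_kernel (circ r t) w)) \<le> integral {0..1::real} (\<lambda>t. C * M)"
    proof (rule integral_norm_bound_integral)
      fix t
      have "\<bar>half_kernel (circ r t) w\<bar> \<le> C" using C(2) [of "circ r t" w] w r by simp
      then show "norm (odd_ext u (circ r t) * half_kernel (circ r t) w) \<le> C * M"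
        using half_harmonic_odd_ext_bound [OF u r, of t] C(1)
        by (simp add: abs_mult mult.commute [of C]) (intro mult_mono; auto intro: order_trans [OF abs_ge_zero])
    qed (use half_harmonic_representation [OF u r w(1)] in auto)
    then have "Im w * \<bar>integral {0..1} (\<lambda>t. odd_ext u (circ r t) * half_kernel (circ r t) w)\<bar> \<le> Im w * (C * M)"
      using w by (intro mult_left_mono) (auto simp: half_disc_def)
    then show "\<bar>u w\<bar> \<le> C * M * Im w"
      using half_harmonic_representation(1) [OF u r w(1)] w by (simp add: half_disc_def abs_mult mult_ac)
  qed
qed

text \<open>Uniform continuity of the kernel on a compact set. The radius \<open>b\<close> is
  independent of \<open>u\<close>, and the error is proportional to \<open>M\<close>, which matters
  because \<open>M\<close> will itself be proportional to an imaginary part.\<close>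

lemma half_harmonic_quotient_cauchy:
  assumes r: "r > 0" and e: "e > 0"
  obtains b where "b > 0" "b \<le> r/2"
    "\<And>u M w w'. half_harmonic u r M \<Longrightarrow> w \<in> half_disc b \<Longrightarrow> w' \<in> half_disc b \<Longrightarrow> \<bar>u w / Im w - u w' / Im w'\<bar> \<le> e * M"
proof -
  have "compact (sphere (0::complex) r \<times> cball (0::complex) (r/2))"
    by (intro compact_Times) auto
  then have "uniformly_continuous_on (sphere 0 r \<times> cball 0 (r/2)) (\<lambda>(s, w). half_kernel s w)"
    using half_kernel_continuous [OF r] compact_uniformly_continuous by blast
  then obtain b' where b': "b' > 0" "\<And>p q. p \<in> sphere 0 r \<times> cball 0 (r/2) \<Longrightarrow> q \<in> sphere 0 r \<times> cball 0 (r/2) \<Longrightarrow>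
      dist p q < b' \<Longrightarrow> dist (case_prod half_kernel p) (case_prod half_kernel q) < e"
    using e unfolding uniformly_continuous_on_def by (metis dist_commute)
  define b where "b = min (b'/2) (r/2)"
  show thesis
  proof
    show "b > 0" "b \<le> r/2" using b' r by (auto simp: b_def)
    fix u M w w' assume u: "half_harmonic u r M" and w: "w \<in> half_disc b" "w' \<in> half_disc b"
    have wr: "w \<in> half_disc r" "w' \<in> half_disc r" "norm w \<le> r/2" "norm w' \<le> r/2" and wb: "norm w < b'/2" "norm w' < b'/2"
      using w r by (auto simp: half_disc_def b_def)
    let ?I = "\<lambda>w. integral {0..1} (\<lambda>t. odd_ext u (circ r t) * half_kernel (circ r t) w)"
    have I: "u w / Im w = ?I w" if "w \<in> half_disc r" for w
      using half_harmonic_representation(1) [OF u r that] that by (simp add: half_disc_def)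
    have "norm (integral {0..1} (\<lambda>t. odd_ext u (circ r t) * half_kernel (circ r t) w - odd_ext u (circ r t) * half_kernel (circ r t) w'))
        \<le> integral {0..1::real} (\<lambda>t. e * M)"
    proof (rule integral_norm_bound_integral)
      fix t
      have "dist w w' < b'" using wb norm_triangle_ineq4 [of w w'] by (simp add: dist_norm)
      then have "dist (circ r t, w) (circ r t, w') < b'" by (simp add: dist_Pair_Pair)
      then have "\<bar>half_kernel (circ r t) w - half_kernel (circ r t) w'\<bar> < e"
        using b'(2) [of "(circ r t, w)" "(circ r t, w')"] wr r by (simp add: dist_real_def)
      then show "norm (odd_ext u (circ r t) * half_kernel (circ r t) w - odd_ext u (circ r t) * half_kernel (circ r t) w') \<le> e * M"
        using half_harmonic_odd_ext_bound [OF u r, of t] e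
        by (simp add: abs_mult mult.commute [of e] right_diff_distrib [symmetric]) (intro mult_mono; auto intro: order_trans [OF abs_ge_zero])
    qed (use half_harmonic_representation(2) [OF u r] wr in \<open>auto intro!: integrable_diff\<close>)
    then show "\<bar>u w / Im w - u w' / Im w'\<bar> \<le> e * M"
      using half_harmonic_representation(2) [OF u r] wr I by (simp add: integral_diff)
  qed
qed

section \<open>The difference of two Green functions near the arc\<close>

text \<open>Which part of the lower half disc is mapped into the domains is left open, since a
  domain may lie on both sides of its boundary arc.\<close>

locale nested_domains =
  large: bounded_open \<Omega> d + small: bounded_open G d for \<Omega> G d +
  fixes f :: "complex \<Rightarrow> complex" and R :: real
  assumes sub: "G \<subseteq> \<Omega>" and R: "R > 0"
    and f: "f holomorphic_on ball 0 R" "inj_on f (ball 0 R)" "f ` half_disc R \<subseteq> G"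
    and real: "\<And>\<zeta>. \<zeta> \<in> ball 0 R \<Longrightarrow> Im \<zeta> = 0 \<Longrightarrow> f \<zeta> \<notin> \<Omega>"
begin

text \<open>The logarithmic poles cancel, so this is the difference of the Green functions of \<open>\<Omega>\<close> and \<open>G\<close>.\<close>

definition gap :: "complex \<Rightarrow> complex \<Rightarrow> real" where
  "gap \<zeta> \<xi> = (if Im \<zeta> > 0 \<and> Im \<xi> > 0
     then log_majorant \<Omega> (f \<xi>) (f \<zeta>) - log_majorant G (f \<xi>) (f \<zeta>) else 0)"

lemma f_mem: "\<zeta> \<in> half_disc R \<Longrightarrow> f \<zeta> \<in> G" "\<zeta> \<in> half_disc R \<Longrightarrow> f \<zeta> \<in> \<Omega>"
  using f sub by auto

lemma gap_symmetric:
  assumes "\<zeta> \<in> half_disc R" "\<xi> \<in> half_disc R" shows "gap \<zeta> \<xi> = gap \<xi> \<zeta>"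
  using f_mem [OF assms(1)] f_mem [OF assms(2)]
  by (simp add: gap_def large.log_majorant_symmetric [of "f \<zeta>"] small.log_majorant_symmetric [of "f \<zeta>"])

lemma gap_nonneg:
  assumes "\<zeta> \<in> half_disc R" "\<xi> \<in> half_disc R" shows "gap \<zeta> \<xi> \<ge> 0"
  using large.log_majorant_mono [OF small.bounded_open_axioms sub f_mem(1) f_mem(1), OF assms(2,1)]
  by (simp add: gap_def)

text \<open>The Green function of \<open>G\<close> is nonnegative, so the gap lies below that of
  \<open>\<Omega>\<close>.\<close>

lemma gap_le:
  assumes "\<zeta> \<in> half_disc R" "\<xi> \<in> half_disc R" "\<zeta> \<noteq> \<xi>"
  shows "gap \<zeta> \<xi> \<le> log_majorant \<Omega> (f \<xi>) (f \<zeta>) - ln (cmod (f \<zeta> - f \<xi>))"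
proof -
  have "f \<zeta> \<noteq> f \<xi>"
    using assms f(2) by (auto simp: half_disc_def inj_on_def)
  then show ?thesis
    using small.ln_le_log_majorant [OF f_mem(1) f_mem(1), OF assms(1,2)] assms by (simp add: gap_def half_disc_def)
qed

lemma gap_harmonic:
  assumes "\<xi> \<in> half_disc R"
  shows "gradient_harmonic (\<lambda>\<zeta>. gap \<zeta> \<xi>) (half_disc R)"
proof (rule gradient_harmonic_cong)
  have "f holomorphic_on half_disc R"
    using f(1) by (rule holomorphic_on_subset) (auto simp: half_disc_def)
  then show "gradient_harmonic (\<lambda>\<zeta>. log_majorant \<Omega> (f \<xi>) (f \<zeta>) - log_majorant G (f \<xi>) (f \<zeta>)) (half_disc R)"
    using f_mem assms
    by (intro gradient_harmonic_diff gradient_harmonic_compose [OF large.log_majorant_harmonic]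
        gradient_harmonic_compose [OF small.log_majorant_harmonic] open_half_disc) auto
qed (use assms in \<open>auto simp: gap_def half_disc_def\<close>)

text \<open>Continuity up to the axis rests on \<open>\<Omega>\<close> alone: the gap is squeezed
  between 0 and the Green function of \<open>\<Omega>\<close>, which tends to 0 there by the
  barrier.\<close>

lemma gap_half_harmonic:
  assumes r: "0 < r" "r < R" and \<xi>: "\<xi> \<in> half_disc R"
    and bd: "\<And>\<zeta>. \<zeta> \<in> sphere 0 r \<Longrightarrow> Im \<zeta> > 0 \<Longrightarrow> gap \<zeta> \<xi> \<le> M" and M: "M \<ge> 0"
  shows "half_harmonic (\<lambda>\<zeta>. gap \<zeta> \<xi>) r M"
  unfolding half_harmonic_def
proof (intro conjI ballI impI)
  show "gradient_harmonic (\<lambda>\<zeta>. gap \<zeta> \<xi>) (half_disc r)"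
    using gradient_harmonic_subset [OF gap_harmonic [OF \<xi>] open_half_disc half_disc_mono] r by simp
  show "gap z \<xi> = 0" if "Im z = 0" for z using that by (simp add: gap_def)
  show "\<bar>gap z \<xi>\<bar> \<le> M" if z: "z \<in> sphere 0 r" "0 \<le> Im z" for z
  proof (cases "Im z = 0")
    case False
    then have "z \<in> half_disc R" using z r by (auto simp: half_disc_def)
    then show ?thesis using bd [of z] z False gap_nonneg \<xi> by auto
  qed (use M in \<open>simp add: gap_def\<close>)
  have lim: "((\<lambda>\<zeta>. gap \<zeta> \<xi>) \<longlongrightarrow> gap x \<xi>) (at x within {z \<in> cball 0 r. 0 \<le> Im z})"
    if x: "x \<in> cball 0 r" "0 \<le> Im x" for x
  proof (cases "Im x = 0")
    case False
    then have xh: "x \<in> half_disc R" using x r by (auto simp: half_disc_def)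
    have "isCont (\<lambda>\<zeta>. gap \<zeta> \<xi>) x"
      using gradient_harmonic_continuous [OF gap_harmonic [OF \<xi>]] xh open_half_disc continuous_on_eq_continuous_at by blast
    then show ?thesis
      unfolding isCont_def by (rule tendsto_within_subset) auto
  next
    case True
    let ?S = "{z \<in> cball 0 r. 0 \<le> Im z}"
    have xR: "x \<in> ball 0 R" using x r by auto
    let ?g = "\<lambda>\<zeta>. log_majorant \<Omega> (f \<xi>) (f \<zeta>) - ln (cmod (f \<zeta> - f \<xi>))"
    have g: "(?g \<longlongrightarrow> 0) (at x within half_disc R)"
      by (rule large.green_tendsto_boundary [OF f(1,2) _ real _ xR True]) (use f sub f_mem \<xi> in auto)
    have ne: "\<forall>\<^sub>F \<zeta> in at x within half_disc R. \<zeta> \<noteq> \<xi>"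
      by (rule eventually_neq_at_within)
    have inh: "\<forall>\<^sub>F \<zeta> in at x within half_disc R. \<zeta> \<in> half_disc R"
      by (simp add: eventually_at_filter)
    have 1: "((\<lambda>\<zeta>. gap \<zeta> \<xi>) \<longlongrightarrow> 0) (at x within half_disc R)"
    proof (rule tendsto_sandwich [OF _ _ tendsto_const g])
      show "\<forall>\<^sub>F \<zeta> in at x within half_disc R. 0 \<le> gap \<zeta> \<xi>"
        using inh by eventually_elim (rule gap_nonneg [OF _ \<xi>])
      show "\<forall>\<^sub>F \<zeta> in at x within half_disc R. gap \<zeta> \<xi> \<le> ?g \<zeta>"
        using inh ne by eventually_elim (rule gap_le [OF _ \<xi>])
    qed
    have 2: "((\<lambda>\<zeta>. gap \<zeta> \<xi>) \<longlongrightarrow> 0) (at x within {z. Im z = 0})"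
      by (rule tendsto_eventually) (auto simp: eventually_at_filter gap_def)
    have "((\<lambda>\<zeta>. gap \<zeta> \<xi>) \<longlongrightarrow> 0) (at x within half_disc R \<union> {z. Im z = 0})"
      using 1 2 Lim_within_Un by blast
    then have "((\<lambda>\<zeta>. gap \<zeta> \<xi>) \<longlongrightarrow> 0) (at x within ?S)"
      by (rule tendsto_within_subset) (use r in \<open>auto simp: half_disc_def\<close>)
    then show ?thesis using True by (simp add: gap_def)
  qed
  then show "continuous_on {z \<in> cball 0 r. 0 \<le> Im z} (\<lambda>\<zeta>. gap \<zeta> \<xi>)"
    by (simp add: continuous_on_def)
qed

text \<open>By compactness and injectivity \<open>f \<zeta>\<close> and \<open>f \<xi>\<close> keep
  a positive distance for \<open>norm \<zeta> = r\<close> and \<open>norm \<xi> \<le> r/2\<close>,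
  so the Green function of \<open>\<Omega>\<close> is bounded for such pairs.\<close>

lemma gap_bounded_on_circle:
  assumes r: "0 < r" "r < R"
  obtains M where "M \<ge> 0"
    "\<And>\<zeta> \<xi>. \<zeta> \<in> sphere 0 r \<Longrightarrow> Im \<zeta> > 0 \<Longrightarrow> \<xi> \<in> half_disc R \<Longrightarrow> norm \<xi> \<le> r/2 \<Longrightarrow> gap \<zeta> \<xi> \<le> M"
proof -
  have cf: "continuous_on (ball 0 R) f" using f holomorphic_on_imp_continuous_on by blast
  let ?K = "sphere (0::complex) r \<times> cball (0::complex) (r/2)"
  have "compact ?K" by (intro compact_Times) auto
  moreover have "continuous_on ?K (\<lambda>p. norm (f (fst p) - f (snd p)))"
    using r by (intro continuous_intros continuous_on_compose2 [OF cf]) auto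
  moreover have "(of_real r, 0) \<in> ?K" using r by simp
  ultimately obtain p where p: "p \<in> ?K" "\<And>q. q \<in> ?K \<Longrightarrow> norm (f (fst p) - f (snd p)) \<le> norm (f (fst q) - f (snd q))"
    using continuous_attains_inf [of ?K "\<lambda>p. norm (f (fst p) - f (snd p))"] by blast
  define \<delta> where "\<delta> = norm (f (fst p) - f (snd p))"
  have "fst p \<in> ball 0 R" "snd p \<in> ball 0 R" "fst p \<noteq> snd p"
    using p(1) r by (auto simp: mem_Times_iff)
  then have \<delta>: "\<delta> > 0" using f(2) by (auto simp: \<delta>_def inj_on_def)
  show thesis
  proof
    show "max 0 (ln d - ln \<delta>) \<ge> 0" by simp
    fix \<zeta> \<xi> assume h: "\<zeta> \<in> sphere 0 r" "Im \<zeta> > 0" "\<xi> \<in> half_disc R" "norm \<xi> \<le> r/2"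
    then have \<zeta>: "\<zeta> \<in> half_disc R" and ne: "\<zeta> \<noteq> \<xi>" using r by (auto simp: half_disc_def)
    have "\<delta> \<le> norm (f \<zeta> - f \<xi>)" using p(2) [of "(\<zeta>, \<xi>)"] h by (simp add: \<delta>_def)
    then have "ln \<delta> \<le> ln (norm (f \<zeta> - f \<xi>))" using \<delta> by (intro ln_mono) auto
    moreover have "log_majorant \<Omega> (f \<xi>) (f \<zeta>) \<le> ln d"
      using large.log_majorant_le_ln_diam f_mem \<zeta> h by blast
    ultimately show "gap \<zeta> \<xi> \<le> max 0 (ln d - ln \<delta>)"
      using gap_le [OF \<zeta> h(3) ne] by linarith
  qed
qed

text \<open>By symmetry the quotient \<open>gap \<zeta> \<xi> / (Im \<zeta> Im \<xi>)\<close> satisfies a Cauchy condition in each variable,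
  uniformly in the other one.\<close>

theorem gap_quadratic:
  obtains k where "k \<ge> 0" "((\<lambda>\<zeta>. gap \<zeta> \<zeta> / (Im \<zeta>)\<^sup>2) \<longlongrightarrow> k) (at 0 within half_disc R)"
proof -
  define r where "r = R / 2"
  have r: "0 < r" "r < R" "r/2 > 0" "r/2 < R" using R by (auto simp: r_def)
  obtain M where M: "M \<ge> 0"
    "\<And>\<zeta> \<xi>. \<zeta> \<in> sphere 0 r \<Longrightarrow> Im \<zeta> > 0 \<Longrightarrow> \<xi> \<in> half_disc R \<Longrightarrow> norm \<xi> \<le> r/2 \<Longrightarrow> gap \<zeta> \<xi> \<le> M"
    using gap_bounded_on_circle [OF r(1,2)] by blast
  obtain C where C: "C \<ge> 0"
    "\<And>u M w. half_harmonic u r M \<Longrightarrow> w \<in> half_disc r \<Longrightarrow> norm w \<le> r/2 \<Longrightarrow> \<bar>u w\<bar> \<le> C * M * Im w"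
    using half_harmonic_linear_bound [OF r(1)] by blast
  have lin: "gap \<zeta> \<xi> \<le> C * M * Im \<zeta>"
    if "\<zeta> \<in> half_disc R" "norm \<zeta> \<le> r/2" "\<xi> \<in> half_disc R" "norm \<xi> \<le> r/2" for \<zeta> \<xi>
  proof -
    have "half_harmonic (\<lambda>\<zeta>. gap \<zeta> \<xi>) r M"
      using gap_half_harmonic [OF r(1,2) that(3) _ M(1)] M(2) that by blast
    then have "\<bar>gap \<zeta> \<xi>\<bar> \<le> C * M * Im \<zeta>"
      by (rule C(2)) (use that r in \<open>auto simp: half_disc_def\<close>)
    then show ?thesis by simp
  qed
  \<comment> \<open>The linear bound, moved to the other variable by symmetry, serves as the bound
    on the half circle of radius \<open>r/2\<close>: this is how the second factor
    \<open>Im \<zeta>\<close> arises.\<close>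
  have hh: "half_harmonic (\<lambda>\<xi>. gap \<xi> \<zeta>) (r/2) (C * M * Im \<zeta>)" if \<zeta>: "\<zeta> \<in> half_disc R" "norm \<zeta> \<le> r/2" for \<zeta>
  proof (rule gap_half_harmonic [OF r(3,4) \<zeta>(1)])
    show "C * M * Im \<zeta> \<ge> 0" using C M \<zeta> by (simp add: half_disc_def)
    fix \<xi> assume "\<xi> \<in> sphere 0 (r/2)" "Im \<xi> > 0"
    then have "\<xi> \<in> half_disc R" "norm \<xi> \<le> r/2" using r by (auto simp: half_disc_def)
    then show "gap \<xi> \<zeta> \<le> C * M * Im \<zeta>"
      using lin \<zeta> gap_symmetric by metis
  qed
  define K where "K \<zeta> = gap \<zeta> \<zeta> / (Im \<zeta>)\<^sup>2" for \<zeta>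
  have cauchy: "\<exists>b>0. b \<le> R \<and> (\<forall>\<zeta>\<in>half_disc b. \<forall>\<xi>\<in>half_disc b. \<bar>K \<zeta> - K \<xi>\<bar> \<le> e)" if e: "e > 0" for e
  proof -
    \<comment> \<open>The 2 leaves \<open>e/2\<close> for each of two steps; adding 1 to
      \<open>C * M\<close> avoids a division by zero.\<close>
    define e' where "e' = e / (2 * (C * M + 1))"
    have CM: "C * M \<ge> 0" using C M by simp
    then have e': "e' > 0" using e by (simp add: e'_def add_nonneg_pos)
    have "e' * (C * M) \<le> e' * (C * M + 1)" using e' by simp
    also have "\<dots> = e/2"
    proof -
      have "C * M + 1 \<noteq> 0" using CM by linarith
      then show ?thesis unfolding e'_def by (metis nonzero_mult_divide_mult_cancel_right times_divide_eq_left)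
    qed
    finally have e'2: "e' * (C * M) \<le> e/2" .
    obtain b where b: "b > 0" "b \<le> r/2/2"
      "\<And>u M w w'. half_harmonic u (r/2) M \<Longrightarrow> w \<in> half_disc b \<Longrightarrow> w' \<in> half_disc b \<Longrightarrow> \<bar>u w / Im w - u w' / Im w'\<bar> \<le> e' * M"
      using half_harmonic_quotient_cauchy [OF r(3) e'] by metis
    have close: "\<bar>gap w \<zeta> / (Im w * Im \<zeta>) - gap w' \<zeta> / (Im w' * Im \<zeta>)\<bar> \<le> e/2"
      if "w \<in> half_disc b" "w' \<in> half_disc b" "\<zeta> \<in> half_disc b" for w w' \<zeta>
    proof -
      have i: "Im \<zeta> > 0" using that by (simp add: half_disc_def)
      have "\<zeta> \<in> half_disc R" "norm \<zeta> \<le> r/2" using that b r by (auto simp: half_disc_def)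
      then have "\<bar>gap w \<zeta> / Im w - gap w' \<zeta> / Im w'\<bar> \<le> e' * (C * M * Im \<zeta>)"
        using b(3) [OF hh] that by blast
      then have "\<bar>gap w \<zeta> / Im w - gap w' \<zeta> / Im w'\<bar> / Im \<zeta> \<le> e' * (C * M)"
        using i by (simp add: divide_le_eq mult_ac)
      also have "\<bar>gap w \<zeta> / Im w - gap w' \<zeta> / Im w'\<bar> / Im \<zeta> = \<bar>(gap w \<zeta> / Im w - gap w' \<zeta> / Im w') / Im \<zeta>\<bar>"
        using i by (simp add: abs_divide)
      also have "\<dots> = \<bar>gap w \<zeta> / (Im w * Im \<zeta>) - gap w' \<zeta> / (Im w' * Im \<zeta>)\<bar>"
        by (simp add: diff_divide_distrib)
      finally show ?thesis using e'2 by linarith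
    qed
    have "\<bar>K \<zeta> - K \<xi>\<bar> \<le> e" if \<zeta>: "\<zeta> \<in> half_disc b" and \<xi>: "\<xi> \<in> half_disc b" for \<zeta> \<xi>
    proof -
      have "\<zeta> \<in> half_disc R" "\<xi> \<in> half_disc R" using that b r by (auto simp: half_disc_def)
      then have sym: "gap \<zeta> \<xi> = gap \<xi> \<zeta>" by (rule gap_symmetric)
      \<comment> \<open>The passage from \<open>(\<zeta>, \<zeta>)\<close> to
        \<open>(\<xi>, \<xi>)\<close> changes one variable at a time; the intermediate value is read
        in both orders by symmetry.\<close>
      have tri: "\<bar>x - z\<bar> \<le> e" if "\<bar>x - y\<bar> \<le> e/2" "\<bar>y - z\<bar> \<le> e/2" for x y z :: real
        using that by linarith
      show ?thesis
        unfolding K_def power2_eq_square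
        by (rule tri [OF close [OF \<zeta> \<xi> \<zeta>] close [OF \<zeta> \<xi> \<xi>, unfolded sym mult.commute [of "Im \<zeta>"]]])
    qed
    then show ?thesis using b r by (intro exI [of _ b]) auto
  qed
  \<comment> \<open>Any sequence in the half disc tending to 0 would do; the summand 2 keeps every
    term inside radius \<open>R\<close>.\<close>
  define s where "s n = \<i> * of_real (R / (real n + 2))" for n
  have s_mem: "\<forall>\<^sub>F n in sequentially. s n \<in> half_disc b" if "b > 0" for b
  proof -
    have "(\<lambda>n. R / (real n + 2)) \<longlonglongrightarrow> 0" by real_asymp
    then have "\<forall>\<^sub>F n in sequentially. R / (real n + 2) < b"
      using that by (rule order_tendstoD)
    then show ?thesis
      by eventually_elim (use R in \<open>simp add: s_def half_disc_def norm_mult del: of_real_divide\<close>)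
  qed
  have "Cauchy (\<lambda>n. K (s n))"
    unfolding Cauchy_def
  proof (intro allI impI)
    fix e :: real assume "e > 0"
    then obtain b where b: "b > 0" "\<forall>\<zeta>\<in>half_disc b. \<forall>\<xi>\<in>half_disc b. \<bar>K \<zeta> - K \<xi>\<bar> \<le> e/2"
      using cauchy [of "e/2"] by auto
    then obtain N where "\<forall>n\<ge>N. s n \<in> half_disc b"
      using s_mem [OF b(1)] unfolding eventually_sequentially by blast
    then show "\<exists>N. \<forall>m\<ge>N. \<forall>n\<ge>N. dist (K (s m)) (K (s n)) < e"
    proof (intro exI [of _ N] allI impI)
      fix m n assume "N \<le> m" "N \<le> n"
      then have "\<bar>K (s m) - K (s n)\<bar> \<le> e/2"
        using b \<open>\<forall>n\<ge>N. s n \<in> half_disc b\<close> by blast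
      then show "dist (K (s m)) (K (s n)) < e"
        using \<open>e > 0\<close> by (simp add: dist_real_def)
    qed
  qed
  then obtain k where k: "(\<lambda>n. K (s n)) \<longlonglongrightarrow> k"
    using convergent_eq_Cauchy by blast
  have near: "\<exists>b>0. \<forall>\<zeta>\<in>half_disc b. \<bar>K \<zeta> - k\<bar> \<le> e" if e: "e > 0" for e
  proof -
    obtain b where b: "b > 0" "\<forall>\<zeta>\<in>half_disc b. \<forall>\<xi>\<in>half_disc b. \<bar>K \<zeta> - K \<xi>\<bar> \<le> e"
      using cauchy [OF e] by auto
    have "\<bar>K \<zeta> - k\<bar> \<le> e" if \<zeta>: "\<zeta> \<in> half_disc b" for \<zeta>
    proof (rule tendsto_upperbound)
      show "(\<lambda>n. \<bar>K \<zeta> - K (s n)\<bar>) \<longlonglongrightarrow> \<bar>K \<zeta> - k\<bar>"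
        by (intro tendsto_intros k)
      show "\<forall>\<^sub>F n in sequentially. \<bar>K \<zeta> - K (s n)\<bar> \<le> e"
        using s_mem [OF b(1)] by eventually_elim (use b \<zeta> in blast)
    qed auto
    then show ?thesis using b by blast
  qed
  show thesis
  proof
    have "\<forall>\<^sub>F n in sequentially. 0 \<le> K (s n)"
      using s_mem [OF R] by eventually_elim (use gap_nonneg in \<open>auto simp: K_def\<close>)
    then show "k \<ge> 0"
      using tendsto_lowerbound [OF k] by simp
    show "((\<lambda>\<zeta>. gap \<zeta> \<zeta> / (Im \<zeta>)\<^sup>2) \<longlongrightarrow> k) (at 0 within half_disc R)"
      unfolding Lim_within
    proof (intro allI impI)
      fix e :: real assume "e > 0"
      then obtain b where b: "b > 0" "\<forall>\<zeta>\<in>half_disc b. \<bar>K \<zeta> - k\<bar> \<le> e/2"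
        using near [of "e/2"] by auto
      then show "\<exists>b>0. \<forall>\<zeta>\<in>half_disc R. 0 < dist \<zeta> 0 \<and> dist \<zeta> 0 < b \<longrightarrow> dist (gap \<zeta> \<zeta> / (Im \<zeta>)\<^sup>2) k < e"
      proof (intro exI [of _ b] conjI ballI impI)
        fix \<zeta> assume "\<zeta> \<in> half_disc R" "0 < dist \<zeta> 0 \<and> dist \<zeta> 0 < b"
        then have "\<zeta> \<in> half_disc b" by (simp add: half_disc_def)
        then have "\<bar>K \<zeta> - k\<bar> \<le> e/2" using b by blast
        then show "dist (gap \<zeta> \<zeta> / (Im \<zeta>)\<^sup>2) k < e"
          using \<open>e > 0\<close> by (simp add: K_def dist_real_def)
      qed (rule b)
    qed
  qed
qed

end

section \<open>Charts of the extended plane\<close>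

text \<open>The inverse of the coordinate \<open>x \<mapsto> 1/(x - b)\<close> on the extended plane minus \<open>b\<close>.\<close>

definition point_chart :: "complex \<Rightarrow> complex \<Rightarrow> complex option" where
  "point_chart b w = (if w = 0 then None else Some (b + inverse w))"

definition point_coord :: "complex \<Rightarrow> complex option \<Rightarrow> complex" where
  "point_coord b x = (case x of None \<Rightarrow> 0 | Some w \<Rightarrow> inverse (w - b))"

lemma point_coord_Some [simp]: "point_coord b (Some w) = inverse (w - b)"
  by (simp add: point_coord_def)

lemma point_coord_chart [simp]: "point_coord b (point_chart b w) = w"
  by (simp add: point_chart_def point_coord_def)

lemma point_chart_coord: "x \<noteq> Some b \<Longrightarrow> point_chart b (point_coord b x) = x"
  by (auto simp: point_chart_def point_coord_def split: option.splits)

lemma point_chart_neq [simp]: "point_chart b w \<noteq> Some b"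
  by (simp add: point_chart_def)

lemma open_vimage_Some: "openin extended_plane V \<Longrightarrow> open (Some -` V)"
  using openin_continuous_map_preimage [OF continuous_map_Some [of euclidean], of V] by (simp add: vimage_def)

lemma open_vimage_point_chart:
  assumes V: "openin extended_plane V"
  shows "open (point_chart b -` V)"
proof (rule openI)
  fix w assume w: "w \<in> point_chart b -` V"
  show "\<exists>e>0. ball w e \<subseteq> point_chart b -` V"
  proof (cases "w = 0")
    case False
    have "continuous_on (- {0}) (\<lambda>w. b + inverse w)" by (intro continuous_intros) auto
    then have "open (- {0} \<inter> (\<lambda>w. b + inverse w) -` (Some -` V))"
      using open_vimage_Some [OF V] by (intro continuous_open_preimage) auto
    moreover have "w \<in> - {0} \<inter> (\<lambda>w. b + inverse w) -` (Some -` V)"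
      using w False by (auto simp: point_chart_def)
    moreover have "- {0} \<inter> (\<lambda>w. b + inverse w) -` (Some -` V) \<subseteq> point_chart b -` V"
      by (auto simp: point_chart_def)
    ultimately show ?thesis
      by (meson open_contains_ball subset_trans)
  next
    case True
    then have "None \<in> V" using w by (simp add: point_chart_def)
    then obtain C where C: "compact C" "V = insert None (Some ` (- C))"
      using V by (auto simp: openin_Alexandroff_compactification Compl_eq_Diff_UNIV)
    then obtain B where B: "B > 0" "\<And>x. x \<in> C \<Longrightarrow> norm x \<le> B"
      using compact_imp_bounded bounded_pos by metis
    \<comment> \<open>For such nonzero \<open>v\<close> the point \<open>b + inverse v\<close> has
      modulus greater than \<open>B\<close>, hence lies outside the compact set
      \<open>C\<close>.\<close>
    have "point_chart b v \<in> V" if v: "norm v < inverse (B + norm b)" for v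
    proof (cases "v = 0")
      case False
      have p: "B + norm b > 0" using B by (simp add: add_pos_nonneg)
      have "inverse (norm v) > B + norm b"
        using v False p by (metis inverse_inverse_eq inverse_less_iff_less inverse_positive_iff_positive zero_less_norm_iff)
      then have "norm (b + inverse v) > B"
        using norm_diff_ineq [of "inverse v" b] by (simp add: norm_inverse add.commute)
      then have "b + inverse v \<notin> C" using B(2) by force
      then show ?thesis using C(2) False by (auto simp: point_chart_def)
    qed (use C in \<open>simp add: point_chart_def\<close>)
    moreover have "inverse (B + norm b) > 0" using B by (simp add: add_pos_nonneg)
    ultimately show ?thesis
      using True by (intro exI [of _ "inverse (B + norm b)"]) auto
  qed
qed

lemma continuous_map_point_chart: "continuous_map euclidean extended_plane (point_chart b)"
  unfolding continuous_map_def using open_vimage_point_chart [of _ b]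
  by (auto simp: vimage_def point_chart_def)

lemma open_vimage_Some_of_chart:
  assumes "Some b \<notin> G" "open (point_chart b -` G)"
  shows "open (Some -` G)"
proof -
  have "Some -` G = - {b} \<inter> (\<lambda>w. inverse (w - b)) -` (point_chart b -` G)"
    using assms(1) by (auto simp: point_chart_def)
  moreover have "open \<dots>"
    by (rule continuous_open_preimage) (use assms in \<open>auto intro!: continuous_intros\<close>)
  ultimately show ?thesis by simp
qed

text \<open>The transition between the two coordinates at infinity is a Moebius map; the zero of
  \<open>1 - b * w\<close>, if any, corresponds to the omitted point \<open>b\<close>.\<close>

lemma inv_chart_point_chart:
  assumes "b * w \<noteq> 1" shows "point_chart b (w / (1 - b * w)) = inv_chart w"
  using assms by (auto simp: inv_chart_def point_chart_def field_simps)

lemma inv_chart_avoids: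
  assumes "Some b \<notin> G" "inv_chart w \<in> G"
  shows "b * w \<noteq> 1" "point_chart b (w / (1 - b * w)) \<in> G"
proof -
  show "b * w \<noteq> 1"
  proof
    assume *: "b * w = 1"
    then have "w \<noteq> 0" by auto
    then have "inverse w = b" using * by (metis inverse_unique mult.commute)
    then show False using assms \<open>w \<noteq> 0\<close> by (auto simp: inv_chart_def)
  qed
  then show "point_chart b (w / (1 - b * w)) \<in> G"
    using assms inv_chart_point_chart by simp
qed

lemma open_vimage_inv_chart_of_chart:
  assumes "Some b \<notin> G" "open (point_chart b -` G)"
  shows "open (inv_chart -` G)"
proof -
  let ?A = "{w. 1 - b * w \<noteq> 0}"
  have A: "open ?A" by (intro open_Collect_neq continuous_intros)
  have "inv_chart -` G = ?A \<inter> (\<lambda>w. w / (1 - b * w)) -` (point_chart b -` G)"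
    using inv_chart_avoids [OF assms(1)] inv_chart_point_chart [of b] by auto
  moreover have "open \<dots>"
    by (rule continuous_open_preimage) (use assms A in \<open>auto intro!: continuous_intros\<close>)
  ultimately show ?thesis by simp
qed

text \<open>When \<open>G\<close> omits \<open>b\<close>, the single coordinate
  \<open>point_chart b\<close> covers \<open>G\<close>, and conformal invariance lets it replace the
  two charts of the definition.\<close>

lemma harmonic_on_ext_iff:
  assumes b: "Some b \<notin> G" and op: "open (point_chart b -` G)"
  shows "harmonic_on_ext u G \<longleftrightarrow> gradient_harmonic (u \<circ> point_chart b) (point_chart b -` G)"
proof
  assume "harmonic_on_ext u G"
  then have h: "gradient_harmonic (u \<circ> Some) (Some -` G)" "gradient_harmonic (u \<circ> inv_chart) (inv_chart -` G)"
    by (auto simp: harmonic_on_ext_def harmonic_on_iff_gradient)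
  show "gradient_harmonic (u \<circ> point_chart b) (point_chart b -` G)"
  proof (rule gradient_harmonic_local [OF op])
    fix w assume w: "w \<in> point_chart b -` G"
    show "\<exists>N. w \<in> N \<and> gradient_harmonic (u \<circ> point_chart b) N"
    proof (cases "w = 0")
      case False
      let ?N = "- {0} \<inter> (\<lambda>w. b + inverse w) -` (Some -` G)"
      have o: "open ?N"
        by (rule continuous_open_preimage) (use gradient_harmonic_open [OF h(1)] in \<open>auto intro!: continuous_intros\<close>)
      have "gradient_harmonic (\<lambda>w. (u \<circ> Some) (b + inverse w)) ?N"
        by (rule gradient_harmonic_compose [OF h(1)]) (use o in \<open>auto intro!: holomorphic_intros\<close>)
      then have "gradient_harmonic (u \<circ> point_chart b) ?N"
        by (rule gradient_harmonic_cong) (auto simp: point_chart_def)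
      then show ?thesis
        using w False by (intro exI [of _ ?N]) (auto simp: point_chart_def)
    next
      case True
      let ?A = "{w. 1 + b * w \<noteq> 0}"
      let ?N = "?A \<inter> (\<lambda>w. w / (1 + b * w)) -` (inv_chart -` G)"
      have A: "open ?A" by (intro open_Collect_neq continuous_intros)
      have o: "open ?N"
        by (rule continuous_open_preimage) (use A gradient_harmonic_open [OF h(2)] in \<open>auto intro!: continuous_intros\<close>)
      have "gradient_harmonic (\<lambda>w. (u \<circ> inv_chart) (w / (1 + b * w))) ?N"
        by (rule gradient_harmonic_compose [OF h(2)]) (use o in \<open>auto intro!: holomorphic_intros\<close>)
      then have "gradient_harmonic (u \<circ> point_chart b) ?N"
      proof (rule gradient_harmonic_cong)
        fix w assume "w \<in> ?N"
        then have "inv_chart (w / (1 + b * w)) = point_chart b w"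
          by (auto simp: inv_chart_def point_chart_def field_simps)
        then show "(u \<circ> inv_chart) (w / (1 + b * w)) = (u \<circ> point_chart b) w" by simp
      qed
      then show ?thesis
        using w True by (intro exI [of _ ?N]) (auto simp: point_chart_def inv_chart_def)
    qed
  qed
next
  assume h: "gradient_harmonic (u \<circ> point_chart b) (point_chart b -` G)"
  have "gradient_harmonic (\<lambda>w. (u \<circ> point_chart b) (inverse (w - b))) (Some -` G)"
    by (rule gradient_harmonic_compose [OF h])
      (use b open_vimage_Some_of_chart [OF b op] in \<open>auto intro!: holomorphic_intros simp: point_chart_def\<close>)
  then have "gradient_harmonic (u \<circ> Some) (Some -` G)"
    by (rule gradient_harmonic_cong) (use b in \<open>auto simp: point_chart_def\<close>)
  moreover have "gradient_harmonic (\<lambda>w. (u \<circ> point_chart b) (w / (1 - b * w))) (inv_chart -` G)"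
    by (rule gradient_harmonic_compose [OF h])
      (use inv_chart_avoids [OF b] open_vimage_inv_chart_of_chart [OF b op]
        in \<open>auto intro!: holomorphic_intros simp: eq_commute [of 1]\<close>)
  then have "gradient_harmonic (u \<circ> inv_chart) (inv_chart -` G)"
    by (rule gradient_harmonic_cong) (use inv_chart_avoids [OF b] inv_chart_point_chart [of b] in auto)
  ultimately show "harmonic_on_ext u G"
    by (simp add: harmonic_on_ext_def harmonic_on_iff_gradient)
qed

text \<open>Coordinate balls are connected, so a component contains one about each of its
  points.\<close>

lemma open_vimage_component:
  assumes X: "openin extended_plane X"
  shows "open (point_chart b -` component_at X z)"
proof (rule openI)
  let ?S = "subtopology extended_plane X"
  fix w assume w: "w \<in> point_chart b -` component_at X z"
  then have c: "connected_component_of ?S (Some z) (point_chart b w)"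
    by (simp add: component_at_def)
  then have "point_chart b w \<in> X"
    using connected_component_in_topspace by fastforce
  then obtain e where e: "e > 0" "ball w e \<subseteq> point_chart b -` X"
    using open_vimage_point_chart [OF X] open_contains_ball by blast
  have "connectedin extended_plane (point_chart b ` ball w e)"
    by (rule connectedin_continuous_map_image [OF continuous_map_point_chart]) simp
  then have con: "connectedin ?S (point_chart b ` ball w e)"
    using e by (auto simp: connectedin_subtopology)
  have "point_chart b v \<in> component_at X z" if "v \<in> ball w e" for v
  proof -
    have "connected_component_of ?S (point_chart b w) (point_chart b v)"
      using con that e by (auto simp: connected_component_of_def intro!: exI [of _ "point_chart b ` ball w e"])
    then show ?thesis
      using c connected_component_of_trans by (fastforce simp: component_at_def)
  qed
  then show "\<exists>e>0. ball w e \<subseteq> point_chart b -` component_at X z"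
    using e by blast
qed

lemma component_at_subset: "component_at X z \<subseteq> X"
  unfolding component_at_def using connected_component_in_topspace by fastforce

section \<open>Green functions in a bounded chart\<close>

text \<open>Two coordinates in succession: inversion about a point \<open>b\<close> outside the
  domain moves it into the plane, and then \<open>q\<close> makes it bounded.\<close>

locale bounded_chart =
  fixes b :: complex and W :: "complex set" and q :: "complex \<Rightarrow> complex" and d :: real
  assumes open_W: "open W" and holo_q: "q holomorphic_on W" and inj_q: "inj_on q W"
    and diam_q: "\<And>x y. x \<in> W \<Longrightarrow> y \<in> W \<Longrightarrow> cmod (q x - q y) \<le> d"
begin

definition coord :: "complex \<Rightarrow> complex" where
  "coord w = q (inverse (w - b))"

definition image_of :: "complex option set \<Rightarrow> complex set" where
  "image_of G = q ` (point_chart b -` G)"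

definition admissible :: "complex option set \<Rightarrow> bool" where
  "admissible G \<longleftrightarrow> Some b \<notin> G \<and> open (point_chart b -` G) \<and> point_chart b -` G \<subseteq> W"

lemma bounded_open_image:
  assumes "admissible G" shows "bounded_open (image_of G) d"
proof
  have "q holomorphic_on point_chart b -` G" "inj_on q (point_chart b -` G)"
    using assms holo_q inj_q holomorphic_on_subset inj_on_subset unfolding admissible_def by blast+
  then show "open (image_of G)"
    using assms open_mapping_thm3 unfolding admissible_def image_of_def by blast
  show "cmod (x - y) \<le> d" if "x \<in> image_of G" "y \<in> image_of G" for x y
    using that diam_q assms by (auto simp: admissible_def image_of_def)
qed

lemma coord_mem:
  assumes "admissible G" "Some z \<in> G"
  shows "inverse (z - b) \<in> point_chart b -` G" "inverse (z - b) \<in> W" "coord z \<in> image_of G" "z \<noteq> b"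
proof -
  show "z \<noteq> b" using assms by (auto simp: admissible_def)
  then show *: "inverse (z - b) \<in> point_chart b -` G"
    using assms point_chart_coord [of "Some z" b] by simp
  then show "inverse (z - b) \<in> W" "coord z \<in> image_of G"
    using assms by (auto simp: admissible_def image_of_def coord_def)
qed

lemma coord_inject:
  assumes "admissible G" "Some x \<in> G" "Some y \<in> G" "coord x = coord y"
  shows "x = y"
proof -
  have "q (inverse (x - b)) = q (inverse (y - b))"
    using assms(4) by (simp only: coord_def)
  then have "inverse (x - b) = inverse (y - b)"
    using inj_q coord_mem(2) [OF assms(1,2)] coord_mem(2) [OF assms(1,3)] by (simp only: inj_onD)
  then show ?thesis by simp
qed

lemma coord_conformal:
  assumes "admissible G"
  shows "coord holomorphic_on Some -` G" "inj_on coord (Some -` G)" "open (Some -` G)"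
proof -
  show "open (Some -` G)"
    using assms open_vimage_Some_of_chart by (auto simp: admissible_def)
  have inv: "(\<lambda>w. inverse (w - b)) holomorphic_on Some -` G"
    using coord_mem(4) [OF assms] by (intro holomorphic_intros) auto
  have "q \<circ> (\<lambda>w. inverse (w - b)) holomorphic_on Some -` G"
    by (rule holomorphic_on_compose_gen [OF inv holo_q]) (use coord_mem(2) [OF assms] in auto)
  then show "coord holomorphic_on Some -` G"
    by (simp add: coord_def [abs_def] o_def)
  show "inj_on coord (Some -` G)"
  proof (rule inj_onI)
    fix x y assume "x \<in> Some -` G" "y \<in> Some -` G" "coord x = coord y"
    then show "x = y" using coord_inject [OF assms, of x y] by simp
  qed
qed

lemma coord_deriv:
  assumes "admissible G" "Some z \<in> G"
  shows "(coord has_field_derivative deriv coord z) (at z)" "deriv coord z \<noteq> 0"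
  using holomorphic_derivI [OF coord_conformal(1,3) [OF assms(1)]]
    holomorphic_injective_imp_regular [OF coord_conformal(1,3,2) [OF assms(1)]] assms(2) by auto

text \<open>Limits as \<open>w\<close> tends to \<open>z\<close> must be turned into limits at
  \<open>coord z\<close> in the image; \<open>\<rho>\<close> is the local inverse for that
  substitution.\<close>

lemma coord_local_inverse:
  assumes "admissible G" "Some z \<in> G"
  obtains \<rho> where "filterlim \<rho> (at z) (at (coord z))" "\<forall>\<^sub>F y in at (coord z). coord (\<rho> y) = y"
proof -
  note h = coord_conformal [OF assms(1)]
  let ?I = "coord ` (Some -` G)"
  obtain g where g: "g holomorphic_on ?I" "\<And>w. w \<in> Some -` G \<Longrightarrow> g (coord w) = w"
    using holomorphic_has_inverse [OF h(1,3,2)] by metis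
  have o: "open ?I" using open_mapping_thm3 [OF h(1,3,2)] .
  have zI: "coord z \<in> ?I" using assms by blast
  have "isCont g (coord z)"
    using holomorphic_on_imp_continuous_on [OF g(1)] o zI continuous_on_eq_continuous_at by blast
  then have lim: "(g \<longlongrightarrow> z) (at (coord z))"
    using g(2) [of z] assms by (simp add: isCont_def)
  have ev: "\<forall>\<^sub>F y in at (coord z). y \<in> ?I"
    using o zI eventually_at_topological by blast
  have inv: "\<forall>\<^sub>F y in at (coord z). coord (g y) = y"
    using ev by eventually_elim (use g(2) in auto)
  moreover have "\<forall>\<^sub>F y in at (coord z). y \<noteq> coord z"
    by (rule eventually_neq_at_within)
  ultimately have "\<forall>\<^sub>F y in at (coord z). g y \<noteq> z"
    by eventually_elim auto
  then have "filterlim g (at z) (at (coord z))"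
    using lim by (auto simp: filterlim_at)
  then show thesis using that inv by blast
qed

text \<open>The difference quotient of \<open>coord\<close> tends to its derivative; the logarithm
  of the latter is the correction between the singularities in the two coordinates.\<close>

lemma coord_log_quotient:
  assumes "admissible G" "Some z \<in> G"
  shows "((\<lambda>w. ln (cmod (coord w - coord z)) - ln (cmod (w - z))) \<longlongrightarrow> ln (cmod (deriv coord z))) (at z)"
    and "\<forall>\<^sub>F w in at z. Some w \<in> G \<and> coord w \<noteq> coord z"
    and "filterlim coord (at (coord z)) (at z)"
proof -
  note D = coord_deriv [OF assms]
  have q: "((\<lambda>w. (coord w - coord z) / (w - z)) \<longlongrightarrow> deriv coord z) (at z)"
    using D(1) by (simp add: has_field_derivative_iff)
  then have "((\<lambda>w. ln (cmod ((coord w - coord z) / (w - z)))) \<longlongrightarrow> ln (cmod (deriv coord z))) (at z)"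
    by (intro tendsto_intros) (use D in auto)
  moreover have o: "open (Some -` G)"
    using assms open_vimage_Some_of_chart by (auto simp: admissible_def)
  have evG: "\<forall>\<^sub>F w in at z. Some w \<in> G"
    using assms o eventually_at_topological [of "\<lambda>w. Some w \<in> G" z UNIV] by (auto simp: vimage_def)
  have evz: "\<forall>\<^sub>F w in at z. w \<noteq> z" by (simp add: eventually_at_filter)
  show ev: "\<forall>\<^sub>F w in at z. Some w \<in> G \<and> coord w \<noteq> coord z"
    using evG evz
  proof eventually_elim
    case (elim w)
    then have "coord w \<noteq> coord z" using coord_inject [OF assms(1) _ assms(2)] by blast
    then show ?case using elim by simp
  qed
  have "\<forall>\<^sub>F w in at z. ln (cmod ((coord w - coord z) / (w - z))) = ln (cmod (coord w - coord z)) - ln (cmod (w - z))"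
    using ev evz by eventually_elim (auto simp: norm_divide ln_div)
  then show "((\<lambda>w. ln (cmod (coord w - coord z)) - ln (cmod (w - z))) \<longlongrightarrow> ln (cmod (deriv coord z))) (at z)"
    using calculation by (rule Lim_transform_eventually [rotated])
  have "(coord \<longlongrightarrow> coord z) (at z)"
    using DERIV_isCont [OF D(1)] by (simp add: isCont_def)
  then show "filterlim coord (at (coord z)) (at z)"
    unfolding filterlim_at using ev by (auto elim: eventually_mono)
qed

end

text \<open>Removable singularities by comparison with the Poisson integral: the term
  \<open>- e * ln (|x - z| / r)\<close> is nonnegative on the disc and infinite at \<open>z\<close>,
  so it controls the puncture, and then \<open>e\<close> tends to 0.\<close>

lemma superharmonic_removable:
  assumes G: "open G" and z: "z \<in> G" and h: "gradient_harmonic u (G - {z})"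
    and lim: "(u \<longlongrightarrow> u z) (at z)"
  shows "superharmonic u G"
proof -
  have cont: "continuous_on G u"
  proof (rule continuous_at_imp_continuous_on, rule ballI)
    fix x assume "x \<in> G"
    show "isCont u x"
    proof (cases "x = z")
      case False
      then show ?thesis
        using gradient_harmonic_continuous [OF h] gradient_harmonic_open [OF h] \<open>x \<in> G\<close>
          continuous_on_eq_continuous_at by blast
    qed (use lim in \<open>simp add: isCont_def\<close>)
  qed
  obtain r where r: "r > 0" "cball z r \<subseteq> G" using G z open_contains_cball by blast
  have c: "continuous_on (cball z r) u" using cont r continuous_on_subset by blast
  then have cs: "continuous_on (sphere z r) u" using continuous_on_subset sphere_cball by blast
  let ?d = "dirichlet u z r" and ?B = "ball z r - {z}"
  have cd: "continuous_on (cball z r) ?d" using dirichlet_continuous_cball c r by blast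
  have oB: "open ?B" by (simp add: open_Diff)
  have hB: "gradient_harmonic (\<lambda>x. s * (u x - ?d x) - e * ln (cmod (x - z) / r)) ?B" for s e :: real
  proof -
    have "gradient_harmonic (\<lambda>x. ln (cmod (x - z)) + - ln r) ?B"
      by (intro gradient_harmonic_add gradient_harmonic_const oB gradient_harmonic_subset [OF ln_norm_harmonic]) auto
    then have "gradient_harmonic (\<lambda>x. ln (cmod (x - z) / r)) ?B"
      by (rule gradient_harmonic_cong) (use r in \<open>auto simp: ln_div\<close>)
    moreover have "gradient_harmonic u ?B"
      by (rule gradient_harmonic_subset [OF h oB]) (use r in auto)
    moreover have "gradient_harmonic ?d ?B"
      by (rule gradient_harmonic_subset [OF dirichlet_harmonic [OF cs] oB]) auto
    ultimately show ?thesis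
      by (intro gradient_harmonic_diff gradient_harmonic_cmult)
  qed
  \<comment> \<open>The factor \<open>s\<close> treats both signs of the difference at once; it is
    set to 1 and to -1 below.\<close>
  have key: "s * (u x - ?d x) - e * ln (cmod (x - z) / r) \<ge> 0" if x: "x \<in> ?B" and e: "e > 0" for s e x
  proof (rule minimum_principle [where S = "\<lambda>x. s * (u x - ?d x) - e * ln (cmod (x - z) / r)", OF gradient_harmonic_superharmonic [OF hB] _ _ x])
    show "bounded ?B" using bounded_ball bounded_subset by (metis Diff_subset)
    fix y e' :: _ assume y: "y \<in> frontier ?B" and e': "(e'::real) > 0"
    have "y \<in> closure ?B" "y \<notin> ?B" using y oB by (auto simp: frontier_def interior_open)
    then have yc: "y \<in> cball z r"
      using closure_minimal [OF _ closed_cball, of ?B z r] by (meson Diff_subset ball_subset_cball subset_iff)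
    have lim1: "((\<lambda>x. s * (u x - ?d x)) \<longlongrightarrow> s * (u y - ?d y)) (at y within ?B)"
    proof -
      have "((\<lambda>x. s * (u x - ?d x)) \<longlongrightarrow> s * (u y - ?d y)) (at y within cball z r)"
        using c cd yc by (intro tendsto_intros) (auto simp: continuous_on_def)
      then show ?thesis by (rule tendsto_within_subset) auto
    qed
    show "\<forall>\<^sub>F x in at y within ?B. - e' < s * (u x - ?d x) - e * ln (cmod (x - z) / r)"
    proof (cases "y = z")
      case False
      then have ys: "y \<in> sphere z r" using yc \<open>y \<notin> ?B\<close> by auto
      have "((\<lambda>x. s * (u x - ?d x) - e * ln (cmod (x - z) / r)) \<longlongrightarrow> s * (u y - ?d y) - e * ln (cmod (y - z) / r)) (at y within ?B)"
        using False r by (intro tendsto_intros lim1) auto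
      moreover have "s * (u y - ?d y) - e * ln (cmod (y - z) / r) = 0"
        using ys r by (simp add: dirichlet_def dist_norm norm_minus_commute)
      ultimately show ?thesis using e' by (intro order_tendstoD) auto
    next
      case True
      have "\<forall>\<^sub>F x in at y within ?B. s * (u x - ?d x) > s * (u y - ?d y) - 1"
        using lim1 by (intro order_tendstoD) auto
      moreover have "\<forall>\<^sub>F x in at z. ln (cmod (x - z)) \<le> (s * (u y - ?d y) - 1) / e + ln r"
        using ln_norm_at_bot [of z] by (auto simp: filterlim_at_bot)
      then have "\<forall>\<^sub>F x in at y within ?B. ln (cmod (x - z)) \<le> (s * (u y - ?d y) - 1) / e + ln r"
        unfolding True using at_le filter_leD subset_UNIV by metis
      moreover have "\<forall>\<^sub>F x in at y within ?B. x \<noteq> z" by (rule eventually_neq_at_within)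
      ultimately show ?thesis
      proof eventually_elim
        case (elim x)
        then have "ln (cmod (x - z) / r) \<le> (s * (u y - ?d y) - 1) / e"
          using r by (simp add: ln_div)
        then have "e * ln (cmod (x - z) / r) \<le> s * (u y - ?d y) - 1"
          using e by (simp add: field_simps)
        then show ?case using elim(1) e' by linarith
      qed
    qed
  qed
  have eq0: "u x = ?d x" if x: "x \<in> ?B" for x
  proof -
    have "0 \<le> s * (u x - ?d x)" if "s = 1 \<or> s = -1" for s
    proof (rule tendsto_lowerbound)
      show "((\<lambda>e. s * (u x - ?d x) - e * ln (cmod (x - z) / r)) \<longlongrightarrow> s * (u x - ?d x)) (at_right 0)"
        by (rule tendsto_eq_intros | simp)+
      show "\<forall>\<^sub>F e in at_right 0. 0 \<le> s * (u x - ?d x) - e * ln (cmod (x - z) / r)"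
        using key [OF x] by (auto simp: eventually_at_filter)
    qed auto
    from this [of 1] this [of "-1"] show ?thesis by simp
  qed
  have "u z = ?d z"
  proof (rule tendsto_unique [of "at z"])
    show "(u \<longlongrightarrow> u z) (at z)" by (rule lim)
    have "isCont ?d z"
      using gradient_harmonic_continuous [OF dirichlet_harmonic [OF cs]] r
      by (simp add: continuous_on_eq_continuous_at)
    then have "(?d \<longlongrightarrow> ?d z) (at z)" by (simp add: isCont_def)
    moreover have "\<forall>\<^sub>F x in at z. ?d x = u x"
      unfolding eventually_at using r eq0 by (intro exI [of _ r]) (auto simp: dist_commute)
    ultimately show "(u \<longlongrightarrow> ?d z) (at z)"
      by (rule Lim_transform_eventually)
  qed auto
  then have eq: "?d x = u x" if "x \<in> ball z r" for x
    using eq0 that by (cases "x = z") auto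
  have "gradient_harmonic u G"
  proof (rule gradient_harmonic_local [OF G])
    fix x assume x: "x \<in> G"
    show "\<exists>N. x \<in> N \<and> gradient_harmonic u N"
    proof (cases "x = z")
      case True
      then show ?thesis
        using gradient_harmonic_cong [OF dirichlet_harmonic [OF cs] eq] r by (intro exI [of _ "ball z r"]) auto
    qed (use h x in \<open>auto intro!: exI [of _ "G - {z}"]\<close>)
  qed
  then show ?thesis by (rule gradient_harmonic_superharmonic)
qed

context bounded_chart
begin

definition chart_green :: "complex option set \<Rightarrow> complex \<Rightarrow> complex option \<Rightarrow> real" where
  "chart_green G z x = log_majorant (image_of G) (coord z) (q (point_coord b x))
     - ln (cmod (q (point_coord b x) - coord z))"

lemma admissible_Diff:
  assumes "admissible G" "Some z \<in> G" shows "admissible (G - {Some z})"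
proof -
  have "point_chart b -` (G - {Some z}) = point_chart b -` G - {inverse (z - b)}"
  proof -
    have "point_chart b w = Some z \<longleftrightarrow> w = inverse (z - b)" for w
      using coord_mem(4) [OF assms] by (auto simp: point_chart_def)
    then show ?thesis by auto
  qed
  then show ?thesis using assms by (auto simp: admissible_def open_Diff)
qed

lemma image_of_Diff:
  assumes "admissible G" "Some z \<in> G" shows "image_of (G - {Some z}) = image_of G - {coord z}"
proof -
  have eq: "point_chart b w = Some z \<longleftrightarrow> w = inverse (z - b)" for w
    using coord_mem(4) [OF assms] by (auto simp: point_chart_def)
  have "q w = coord z \<longleftrightarrow> w = inverse (z - b)" if "point_chart b w \<in> G" for w
    using that assms coord_mem(2) [OF assms] inj_q unfolding coord_def admissible_def
    by (metis inj_on_def subsetD vimageI)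
  then show ?thesis
    unfolding image_of_def using eq by auto
qed

lemma harmonic_on_ext_image:
  assumes G: "admissible G"
  shows "gradient_harmonic v (image_of G) \<Longrightarrow> harmonic_on_ext (\<lambda>x. v (q (point_coord b x))) G"
    and "harmonic_on_ext u G \<Longrightarrow>
      gradient_harmonic (\<lambda>y. u (point_chart b (inv_into W q y))) (image_of G)"
proof -
  have b: "Some b \<notin> G" and op: "open (point_chart b -` G)" and sub: "point_chart b -` G \<subseteq> W"
    using G by (auto simp: admissible_def)
  have hq: "q holomorphic_on point_chart b -` G" using holo_q sub holomorphic_on_subset by blast
  {
    assume "gradient_harmonic v (image_of G)"
    then have "gradient_harmonic (\<lambda>w. v (q w)) (point_chart b -` G)"
      by (rule gradient_harmonic_compose [OF _ hq op]) (simp add: image_of_def)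
    then show "harmonic_on_ext (\<lambda>x. v (q (point_coord b x))) G"
      unfolding harmonic_on_ext_iff [OF b op] by (simp add: o_def)
  next
    assume "harmonic_on_ext u G"
    then have h: "gradient_harmonic (u \<circ> point_chart b) (point_chart b -` G)"
      using harmonic_on_ext_iff [OF b op] by blast
    obtain g where g: "g holomorphic_on q ` W" "\<And>w. w \<in> W \<Longrightarrow> g (q w) = w"
      using holomorphic_has_inverse [OF holo_q open_W inj_q] by metis
    have "g holomorphic_on image_of G"
      using g(1) holomorphic_on_subset sub unfolding image_of_def by (metis image_mono)
    then have "gradient_harmonic (\<lambda>y. (u \<circ> point_chart b) (g y)) (image_of G)"
      by (rule gradient_harmonic_compose [OF h])
        (use bounded_open.open_G [OF bounded_open_image [OF G]] g(2) sub in \<open>auto simp: image_of_def\<close>)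
    then show "gradient_harmonic (\<lambda>y. u (point_chart b (inv_into W q y))) (image_of G)"
    proof (rule gradient_harmonic_cong)
      fix y assume "y \<in> image_of G"
      then obtain w where "w \<in> W" "y = q w" using sub by (auto simp: image_of_def)
      then show "(u \<circ> point_chart b) (g y) = u (point_chart b (inv_into W q y))"
        using g(2) inj_q by simp
    qed
  }
qed

lemma point_coord_mem:
  assumes "admissible G" "x \<in> G"
  shows "point_coord b x \<in> point_chart b -` G" "point_coord b x \<in> W" "q (point_coord b x) \<in> image_of G"
proof -
  have "x \<noteq> Some b" using assms by (auto simp: admissible_def)
  then show "point_coord b x \<in> point_chart b -` G" using assms point_chart_coord by simp
  then show "point_coord b x \<in> W" "q (point_coord b x) \<in> image_of G"
    using assms by (auto simp: admissible_def image_of_def)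
qed

lemma chart_green_regular_part:
  assumes G: "admissible G" and z: "Some z \<in> G"
  shows "((\<lambda>w. chart_green G z (Some w) + ln (cmod (w - z))) \<longlongrightarrow>
      log_majorant (image_of G) (coord z) (coord z) - ln (cmod (deriv coord z))) (at z)"
proof -
  interpret bounded_open "image_of G" d by (rule bounded_open_image [OF G])
  note L = coord_log_quotient [OF G z]
  have zi: "coord z \<in> image_of G" using coord_mem [OF G z] by blast
  have "isCont (log_majorant (image_of G) (coord z)) (coord z)"
    using gradient_harmonic_continuous [OF log_majorant_harmonic [OF zi]] zi open_G continuous_on_eq_continuous_at by blast
  then have "(log_majorant (image_of G) (coord z) \<longlongrightarrow> log_majorant (image_of G) (coord z) (coord z)) (at (coord z))"
    by (simp add: isCont_def)
  then have "((\<lambda>w. log_majorant (image_of G) (coord z) (coord w)) \<longlongrightarrow> log_majorant (image_of G) (coord z) (coord z)) (at z)"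
    using L(3) by (rule filterlim_compose)
  from tendsto_diff [OF this L(1)] show ?thesis
    by (simp add: chart_green_def coord_def algebra_simps)
qed

text \<open>Minimality is transported: a member \<open>u\<close> of the pole family plus the
  logarithm in the image has a removable singularity, so it is superharmonic and competes in
  \<open>pole_majorants\<close>.\<close>

lemma is_green_function_chart:
  assumes G: "admissible G" and z: "Some z \<in> G"
  shows "is_green_function G z (chart_green G z)"
  unfolding is_green_function_def
proof (intro conjI ballI)
  interpret bounded_open "image_of G" d by (rule bounded_open_image [OF G])
  have zi: "coord z \<in> image_of G" using coord_mem [OF G z] by blast
  note G' = admissible_Diff [OF G z] and im = image_of_Diff [OF G z]
  have mem: "q (point_coord b x) \<in> image_of G - {coord z}" if "x \<in> G - {Some z}" for x
    using point_coord_mem(3) [OF G' that] im by simp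
  show "chart_green G z \<in> log_pole_family G z"
    unfolding log_pole_family_def
  proof (intro CollectI conjI ballI)
    have "gradient_harmonic (\<lambda>y. log_majorant (image_of G) (coord z) y - ln (cmod (y - coord z))) (image_of G - {coord z})"
      using open_G
      by (intro gradient_harmonic_diff gradient_harmonic_subset [OF log_majorant_harmonic [OF zi]]
          gradient_harmonic_subset [OF ln_norm_harmonic]) (auto simp: open_Diff)
    then show "harmonic_on_ext (chart_green G z) (G - {Some z})"
      using harmonic_on_ext_image(1) [OF G'] unfolding im chart_green_def [abs_def] by blast
    show "0 \<le> chart_green G z x" if "x \<in> G - {Some z}" for x
      using mem [OF that] ln_le_log_majorant zi by (auto simp: chart_green_def)
    show "\<exists>l. ((\<lambda>w. chart_green G z (Some w) + ln (cmod (w - z))) \<longlongrightarrow> l) (at z)"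
      using chart_green_regular_part [OF G z] by blast
  qed
  fix u x assume u: "u \<in> log_pole_family G z" and x: "x \<in> G - {Some z}"
  obtain l where l: "((\<lambda>w. u (Some w) + ln (cmod (w - z))) \<longlongrightarrow> l) (at z)"
    and hu: "harmonic_on_ext u (G - {Some z})" and nn: "\<And>x. x \<in> G - {Some z} \<Longrightarrow> 0 \<le> u x"
    using u by (auto simp: log_pole_family_def)
  define U where "U y = u (point_chart b (inv_into W q y))" for y
  have Uq: "U (q (point_coord b x)) = u x" if "x \<in> G" for x
  proof -
    have "x \<noteq> Some b" using that G by (auto simp: admissible_def)
    then show ?thesis
      using point_coord_mem(2) [OF G that] inj_q point_chart_coord [of x b] by (simp add: U_def)
  qed
  have hU: "gradient_harmonic U (image_of G - {coord z})"
    using harmonic_on_ext_image(2) [OF G' hu] unfolding im U_def [abs_def] .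
  \<comment> \<open>\<open>l\<close> is the limit in terms of \<open>w - z\<close>; passing to
    \<open>coord w - coord z\<close> adds the logarithm of the derivative.\<close>
  define l' where "l' = l + ln (cmod (deriv coord z))"
  define S where "S y = (if y = coord z then l' else U y + ln (cmod (y - coord z)))" for y
  have U_nn: "0 \<le> U y" if y: "y \<in> image_of G - {coord z}" for y
  proof -
    have "y \<in> image_of (G - {Some z})" using y im by simp
    then obtain w where w: "point_chart b w \<in> G - {Some z}" "y = q w" by (auto simp: image_of_def)
    then have "U y = u (point_chart b w)" using Uq [of "point_chart b w"] by simp
    then show ?thesis using nn w by simp
  qed
  have "superharmonic S (image_of G)"
  proof (rule superharmonic_removable [OF open_G zi])
    have "gradient_harmonic (\<lambda>y. U y + ln (cmod (y - coord z))) (image_of G - {coord z})"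
      using open_G by (intro gradient_harmonic_add hU gradient_harmonic_subset [OF ln_norm_harmonic]) (auto simp: open_Diff)
    then show "gradient_harmonic S (image_of G - {coord z})"
      by (rule gradient_harmonic_cong) (simp add: S_def)
    have lim: "((\<lambda>w. S (coord w)) \<longlongrightarrow> l') (at z)"
    proof (rule Lim_transform_eventually)
      show "((\<lambda>w. (u (Some w) + ln (cmod (w - z))) + (ln (cmod (coord w - coord z)) - ln (cmod (w - z)))) \<longlongrightarrow> l') (at z)"
        unfolding l'_def by (intro tendsto_add l coord_log_quotient(1) [OF G z])
      show "\<forall>\<^sub>F w in at z. (u (Some w) + ln (cmod (w - z))) + (ln (cmod (coord w - coord z)) - ln (cmod (w - z))) = S (coord w)"
        using coord_log_quotient(2) [OF G z]
      proof eventually_elim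
        case (elim w)
        then show ?case using Uq [of "Some w"] by (simp add: S_def coord_def)
      qed
    qed
    obtain \<rho> where \<rho>: "filterlim \<rho> (at z) (at (coord z))" "\<forall>\<^sub>F y in at (coord z). coord (\<rho> y) = y"
      using coord_local_inverse [OF G z] by blast
    have "((\<lambda>y. S (coord (\<rho> y))) \<longlongrightarrow> l') (at (coord z))"
      by (rule filterlim_compose [OF lim \<rho>(1)])
    then have "(S \<longlongrightarrow> l') (at (coord z))"
      by (rule Lim_transform_eventually) (use \<rho>(2) in \<open>auto elim: eventually_mono\<close>)
    then show "(S \<longlongrightarrow> S (coord z)) (at (coord z))"
      by (simp add: S_def)
  qed
  moreover have "ln (cmod (y - coord z)) \<le> S y" if "y \<in> image_of G - {coord z}" for y
    using U_nn [OF that] that by (simp add: S_def)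
  ultimately have "S \<in> pole_majorants (image_of G) (coord z)"
    by (simp add: pole_majorants_def)
  then have "log_majorant (image_of G) (coord z) (q (point_coord b x)) \<le> S (q (point_coord b x))"
    using mem [OF x] by (intro log_majorant_le) auto
  then show "chart_green G z x \<le> u x"
    using mem [OF x] Uq [of x] x by (simp add: S_def chart_green_def)
qed

text \<open>The definition picks some Green function, but minimality makes any two agree off the
  pole, and the limit at \<open>z\<close> ignores the value at the pole.\<close>

theorem inner_radius_chart:
  assumes X: "openin extended_plane X" "Some b \<notin> X" "point_chart b -` X \<subseteq> W" and z: "Some z \<in> X"
  shows "inner_radius X z = exp (log_majorant (image_of (component_at X z)) (coord z) (coord z) - ln (cmod (deriv coord z)))"
proof -
  let ?C = "component_at X z"
  have sub: "?C \<subseteq> X" by (rule component_at_subset)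
  then have C: "admissible ?C"
    using X open_vimage_component [OF X(1)] by (auto simp: admissible_def)
  have zC: "Some z \<in> ?C"
    using z openin_subset [OF X(1)] by (simp add: component_at_def connected_component_of_refl)
  note ig = is_green_function_chart [OF C zC]
  have ig': "is_green_function ?C z (green_function ?C z)"
    unfolding green_function_def by (rule someI [where P = "is_green_function ?C z", OF ig])
  have eq: "green_function ?C z x = chart_green ?C z x" if "x \<in> ?C - {Some z}" for x
    using ig ig' that unfolding is_green_function_def by (meson antisym)
  have "((\<lambda>w. green_function ?C z (Some w) + ln (cmod (w - z))) \<longlongrightarrow>
      log_majorant (image_of ?C) (coord z) (coord z) - ln (cmod (deriv coord z))) (at z)"
  proof (rule Lim_transform_eventually [OF chart_green_regular_part [OF C zC]])
    show "\<forall>\<^sub>F w in at z. chart_green ?C z (Some w) + ln (cmod (w - z)) = green_function ?C z (Some w) + ln (cmod (w - z))"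
      using coord_log_quotient(2) [OF C zC]
    proof eventually_elim
      case (elim w)
      then have "Some w \<in> ?C - {Some z}" by auto
      then show ?case using eq by simp
    qed
  qed
  then show ?thesis
    unfolding inner_radius_def by (simp add: tendsto_Lim)
qed

end

section \<open>A bounded chart of the complement of an arc\<close>

lemma arc_coordinate_image:
  assumes "arc \<beta>"
  shows "- (point_chart (\<beta> 0) -` (- Some ` path_image \<beta>)) = (\<lambda>t. inverse (\<beta> t - \<beta> 0)) ` {0<..1}"
proof -
  have inj: "\<beta> t = \<beta> 0 \<longleftrightarrow> t = 0" if "t \<in> {0..1}" for t
    using assms that by (auto simp: arc_def inj_on_def)
  have "w \<in> - (point_chart (\<beta> 0) -` (- Some ` path_image \<beta>)) \<longleftrightarrow> w \<noteq> 0 \<and> \<beta> 0 + inverse w \<in> path_image \<beta>" for w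
    by (auto simp: point_chart_def)
  moreover have "w \<noteq> 0 \<and> \<beta> 0 + inverse w \<in> path_image \<beta> \<longleftrightarrow> w \<in> (\<lambda>t. inverse (\<beta> t - \<beta> 0)) ` {0<..1}" for w
  proof
    assume "w \<noteq> 0 \<and> \<beta> 0 + inverse w \<in> path_image \<beta>"
    then obtain t where t: "t \<in> {0..1}" "\<beta> 0 + inverse w = \<beta> t" and w: "w \<noteq> 0"
      by (auto simp: path_image_def)
    then have e: "inverse w = \<beta> t - \<beta> 0" by (simp add: algebra_simps)
    then have "t \<noteq> 0" "w = inverse (\<beta> t - \<beta> 0)" using w by auto (metis inverse_inverse_eq)
    then show "w \<in> (\<lambda>t. inverse (\<beta> t - \<beta> 0)) ` {0<..1}" using t by auto
  next
    assume "w \<in> (\<lambda>t. inverse (\<beta> t - \<beta> 0)) ` {0<..1}"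
    then obtain t where "t \<in> {0<..1}" "w = inverse (\<beta> t - \<beta> 0)" by blast
    then show "w \<noteq> 0 \<and> \<beta> 0 + inverse w \<in> path_image \<beta>"
      using inj [of t] by (auto simp: path_image_def)
  qed
  ultimately show ?thesis by blast
qed

text \<open>Sending the end point \<open>\<beta> 0\<close> to infinity turns the rest of the arc
  into a connected unbounded set, and an open connected plane set whose complement has only
  unbounded components is simply connected.\<close>

lemma simply_connected_arc_complement_chart:
  assumes arc: "arc \<beta>"
  shows "open (point_chart (\<beta> 0) -` (- Some ` path_image \<beta>))"
    and "simply_connected (point_chart (\<beta> 0) -` (- Some ` path_image \<beta>))"
proof -
  let ?W = "point_chart (\<beta> 0) -` (- Some ` path_image \<beta>)"
  let ?f = "\<lambda>t. inverse (\<beta> t - \<beta> 0)"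
  have path: "path \<beta>" and inj: "inj_on \<beta> {0..1}" using arc by (auto simp: arc_def)
  have cb: "continuous_on {0..1} \<beta>" using path by (simp add: path_def)
  have inj0: "\<beta> t \<noteq> \<beta> 0" if "t \<in> {0<..1}" for t
    using inj_onD [OF inj, of t 0] that by auto
  have comp: "- ?W = ?f ` {0<..1}" by (rule arc_coordinate_image [OF arc])
  have "closedin extended_plane (Some ` path_image \<beta>)"
    using compact_path_image [OF path] by (simp add: compact_imp_closed)
  then have "openin extended_plane (topspace extended_plane - Some ` path_image \<beta>)"
    by blast
  moreover have "topspace extended_plane = UNIV"
    by (simp add: UNIV_option_conv)
  ultimately have "openin extended_plane (- Some ` path_image \<beta>)"
    by (simp add: Compl_eq_Diff_UNIV)
  then show oW: "open ?W" by (rule open_vimage_point_chart)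
  have "continuous_on {0<..1} ?f"
    using inj0 by (intro continuous_intros continuous_on_subset [OF cb]) auto
  then have con: "connected (- ?W)"
    unfolding comp by (rule connected_continuous_image) (simp add: is_interval_connected)
  have unb: "\<not> bounded (- ?W)"
  proof
    assume "bounded (- ?W)"
    then obtain B where B: "B > 0" "\<And>t. t \<in> {0<..1} \<Longrightarrow> norm (?f t) \<le> B"
      unfolding comp bounded_pos by auto
    obtain e where e: "e > 0" "\<And>t. t \<in> {0..1} \<Longrightarrow> dist t 0 < e \<Longrightarrow> dist (\<beta> t) (\<beta> 0) < inverse B"
      using cb B(1) unfolding continuous_on_iff by (metis atLeastAtMost_iff inverse_positive_iff_positive order_refl zero_le_one)
    define t where "t = min 1 (e/2)"
    have t: "t \<in> {0<..1}" "dist t 0 < e" using e by (auto simp: t_def)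
    then have "norm (\<beta> t - \<beta> 0) < inverse B" using e(2) [of t] by (auto simp: dist_norm)
    moreover have "norm (\<beta> t - \<beta> 0) > 0" using inj0 t by simp
    ultimately have "B < norm (?f t)"
      by (metis inverse_inverse_eq inverse_less_iff_less inverse_positive_iff_positive norm_inverse less_trans B(1))
    then show False using B(2) t by fastforce
  qed
  have conW: "connected ?W"
  proof -
    have "connected (- path_image \<beta>)"
      using connected_arc_complement [OF arc] by simp
    moreover have "continuous_on (- path_image \<beta>) (\<lambda>w. inverse (w - \<beta> 0))"
      by (intro continuous_intros) (auto simp: path_image_def)
    ultimately have c: "connected ((\<lambda>w. inverse (w - \<beta> 0)) ` (- path_image \<beta>))"
      by (rule connected_continuous_image [rotated])
    have eq: "(\<lambda>w. inverse (w - \<beta> 0)) ` (- path_image \<beta>) = ?W - {0}"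
    proof (intro equalityI subsetI)
      fix v assume "v \<in> (\<lambda>w. inverse (w - \<beta> 0)) ` (- path_image \<beta>)"
      then obtain w where w: "w \<notin> path_image \<beta>" "v = inverse (w - \<beta> 0)" by auto
      moreover have "\<beta> 0 \<in> path_image \<beta>" by (auto simp: path_image_def)
      ultimately show "v \<in> ?W - {0}" by (auto simp: point_chart_def)
    next
      fix v assume "v \<in> ?W - {0}"
      then have "v = inverse (\<beta> 0 + inverse v - \<beta> 0)" "\<beta> 0 + inverse v \<in> - path_image \<beta>"
        by (auto simp: point_chart_def)
      then show "v \<in> (\<lambda>w. inverse (w - \<beta> 0)) ` (- path_image \<beta>)" by blast
    qed
    \<comment> \<open>Only 0, the coordinate of the point at infinity, is missing from the image of
      the plane; it is a limit point, so adding it preserves connectedness.\<close>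
    have "?W \<subseteq> closure (?W - {0})"
    proof
      fix x assume x: "x \<in> ?W"
      then have "x islimpt ?W" using oW by (simp add: interior_limit_point interior_open)
      then have "x islimpt ?W - {0}" by (metis islimpt_insert insert_Diff_single)
      then show "x \<in> closure (?W - {0})" by (simp add: closure_def)
    qed
    then show ?thesis
      using connected_intermediate_closure [of "?W - {0}" ?W] c eq by auto
  qed
  have "- ?W \<noteq> {}" unfolding comp by auto
  then have "components (- ?W) = {- ?W}"
    using con connected_eq_components_subset_sing_exists by (metis components_eq_sing_iff)
  then show "simply_connected ?W"
    using simply_connected_eq_unbounded_complement_components [OF oW] conW unb by auto
qed

text \<open>The Koebe trick: a branch of a square root omits an open set, so its inversion is bounded.\<close>

lemma bounded_conformal_map_exists:
  assumes W: "open W" "simply_connected W" "W \<noteq> {}" and p: "p \<notin> W"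
  obtains q d where "q holomorphic_on W" "inj_on q W" "\<And>x y. x \<in> W \<Longrightarrow> y \<in> W \<Longrightarrow> cmod (q x - q y) \<le> d"
proof -
  have "(\<lambda>w. w - p) holomorphic_on W" "\<forall>w\<in>W. w - p \<noteq> 0"
    using p by (auto intro!: holomorphic_intros)
  then obtain s where s: "s holomorphic_on W" "\<And>w. w \<in> W \<Longrightarrow> w - p = (s w)\<^sup>2"
    using W(1,2) simply_connected_eq_holomorphic_sqrt [OF W(1)] by blast
  have inj: "x = y" if "x \<in> W" "y \<in> W" "s x = s y \<or> s x = - s y" for x y
  proof -
    have "(s x)\<^sup>2 = (s y)\<^sup>2" using that(3) by auto
    then have "x - p = y - p" using s(2) that by metis
    then show ?thesis by simp
  qed
  have nz: "s w \<noteq> 0" if "w \<in> W" for w using s(2) [OF that] that p by auto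
  have "inj_on s W" using inj by (auto simp: inj_on_def)
  then have "open (s ` W)" using open_mapping_thm3 s(1) W(1) by blast
  moreover obtain w0 where w0: "w0 \<in> W" using W by blast
  ultimately obtain e where e: "e > 0" "ball (s w0) e \<subseteq> s ` W"
    using open_contains_ball by blast
  \<comment> \<open>A value \<open>s w\<close> within \<open>e\<close> of \<open>- s w0\<close>
    would have its negative among the values of \<open>s\<close> too, but \<open>s\<close> never
    takes both a value and its negative.\<close>
  have far: "e \<le> norm (s w + s w0)" if w: "w \<in> W" for w
  proof (rule ccontr)
    assume "\<not> e \<le> norm (s w + s w0)"
    moreover have "norm (s w + s w0) = dist (s w0) (- s w)" by (simp add: dist_norm add.commute)
    ultimately have "- s w \<in> s ` W" using e(2) by auto
    then obtain y where y: "y \<in> W" "s y = - s w" by auto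
    then have "y = w" using inj w by blast
    then have "s w + s w = 0" using y by (simp add: eq_neg_iff_add_eq_0)
    then have "2 * s w = 0" by (simp only: mult_2)
    then show False using nz [OF w] by simp
  qed
  let ?q = "\<lambda>w. inverse (s w + s w0)"
  have nz': "s w + s w0 \<noteq> 0" if "w \<in> W" for w using far [OF that] e(1) by auto
  have bnd: "norm (?q w) \<le> inverse e" if "w \<in> W" for w
    using far [OF that] e(1) by (simp add: norm_inverse le_imp_inverse_le)
  show thesis
  proof
    show "?q holomorphic_on W" by (intro holomorphic_intros s(1)) (use nz' in auto)
    show "inj_on ?q W"
    proof (rule inj_onI)
      fix x y assume a: "x \<in> W" "y \<in> W" "?q x = ?q y"
      then have "s x = s y" by simp
      then show "x = y" using inj a by blast
    qed
    show "cmod (?q x - ?q y) \<le> inverse e + inverse e" if "x \<in> W" "y \<in> W" for x y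
      using norm_triangle_ineq4 [of "?q x" "?q y"] bnd that by (smt (verit))
  qed
qed

lemma bounded_chart_exists:
  assumes arc: "arc \<beta>"
  obtains q d where "bounded_chart (point_chart (\<beta> 0) -` (- Some ` path_image \<beta>)) q d"
proof -
  let ?W = "point_chart (\<beta> 0) -` (- Some ` path_image \<beta>)"
  note W = simply_connected_arc_complement_chart [OF arc]
  have "0 \<in> ?W" by (auto simp: point_chart_def)
  then have ne: "?W \<noteq> {}" by blast
  \<comment> \<open>The other end point of the arc supplies the omitted value for the square
    root.\<close>
  have "inverse (\<beta> 1 - \<beta> 0) \<in> - ?W" unfolding arc_coordinate_image [OF arc] by auto
  then have "inverse (\<beta> 1 - \<beta> 0) \<notin> ?W" by simp
  from bounded_conformal_map_exists [OF W ne this]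
  obtain q d where "q holomorphic_on ?W" "inj_on q ?W" "\<And>x y. x \<in> ?W \<Longrightarrow> y \<in> ?W \<Longrightarrow> cmod (q x - q y) \<le> d"
    by blast
  then have "bounded_chart ?W q d"
    using W(1) by unfold_locales
  then show thesis by (rule that)
qed

section \<open>Coordinates at the boundary arc\<close>

text \<open>The side of the real axis on which \<open>D\<close> lies, or whether it lies on both, is
  left open; the accessible point decides it later, with \<open>f (- \<zeta>)\<close> exchanging the
  sides.\<close>

definition boundary_coordinate :: "complex option set \<Rightarrow> complex \<Rightarrow> (complex \<Rightarrow> complex) \<Rightarrow> real \<Rightarrow> bool" where
  "boundary_coordinate D z0 f R \<longleftrightarrow> R > 0 \<and> f holomorphic_on ball 0 R \<and> inj_on f (ball 0 R) \<and> f 0 = z0 \<and>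
     (\<forall>\<zeta>\<in>ball 0 R. Some (f \<zeta>) \<in> extended_plane frontier_of D \<longleftrightarrow> Im \<zeta> = 0)"

lemma boundary_coordinate_flip:
  assumes "boundary_coordinate D z0 f R" shows "boundary_coordinate D z0 (\<lambda>\<zeta>. f (- \<zeta>)) R"
proof -
  have "f holomorphic_on ball 0 R" "inj_on f (ball 0 R)"
    using assms by (auto simp: boundary_coordinate_def)
  then have "f \<circ> uminus holomorphic_on ball 0 R" "inj_on (f \<circ> uminus) (ball 0 R)"
    by (auto intro!: holomorphic_on_compose_gen holomorphic_intros comp_inj_on elim: inj_on_subset)
  then show ?thesis using assms by (auto simp: boundary_coordinate_def o_def)
qed

text \<open>The analytic function that parametrises the arc, shifted to \<open>t0\<close>, is the
  coordinate. The disc must be shrunk until no other piece of the arc enters its image.\<close>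

lemma boundary_coordinate_exists:
  assumes "boundary_arc_near D z0 \<gamma>"
  obtains f R where "boundary_coordinate D z0 f R"
proof -
  obtain U where U: "open U" "z0 \<in> U" "Some -` (extended_plane frontier_of D) \<inter> U = path_image \<gamma> \<inter> U"
    and an: "analytic_arc \<gamma>" and z0: "z0 \<in> \<gamma> ` {0<..<1}"
    using assms unfolding boundary_arc_near_def by blast
  obtain F where arc: "arc \<gamma>" and F: "F analytic_on of_real ` {0..1}"
    "\<And>t. t \<in> {0..1} \<Longrightarrow> \<gamma> t = F (of_real t)" "\<And>t. t \<in> {0..1} \<Longrightarrow> deriv F (of_real t) \<noteq> 0"
    using an unfolding analytic_arc_def by blast
  obtain t0 where t0: "t0 \<in> {0<..<1}" "z0 = \<gamma> t0" using z0 by blast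
  have inj: "inj_on \<gamma> {0..1}" and cg: "continuous_on {0..1} \<gamma>"
    using arc by (auto simp: arc_def path_def)
  have "(of_real t0 :: complex) \<in> of_real ` {0..1}"
    using t0 by (intro imageI) auto
  then obtain r1 where r1: "r1 > 0" "F holomorphic_on ball (of_real t0) r1"
    using F(1) unfolding analytic_on_def by blast
  obtain r2 where r2: "r2 > 0" "ball (of_real t0) r2 \<subseteq> ball (of_real t0 :: complex) r1" "inj_on F (ball (of_real t0) r2)"
  proof -
    have "of_real t0 \<in> ball (of_real t0 :: complex) r1" "deriv F (of_real t0) \<noteq> 0"
      using r1 F(3) [of t0] t0 by auto
    from has_complex_derivative_locally_injective [OF r1(2) this(1) open_ball this(2)] show thesis
      using that by metis
  qed
  define r3 where "r3 = min r2 (min t0 (1 - t0))"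
  have r3: "r3 > 0" "r3 \<le> r2" "r3 \<le> t0" "r3 \<le> 1 - t0" using r2 t0 by (auto simp: r3_def)
  have holo: "F holomorphic_on ball (of_real t0) r3"
    using r1(2) by (rule holomorphic_on_subset) (use r2 r3 in auto)
  have injF: "inj_on F (ball (of_real t0) r3)"
    using r2(3) by (rule inj_on_subset) (use r3 in auto)
  \<comment> \<open>The part of the arc with parameters away from \<open>t0\<close>: a compact set
    missing \<open>z0\<close>, to be kept out of the image.\<close>
  define K where "K = \<gamma> ` ({0..1} - {t0 - r3<..<t0 + r3})"
  have "compact K"
    unfolding K_def by (intro compact_continuous_image continuous_on_subset [OF cg] compact_diff) auto
  then have "open (U \<inter> - K)" using U by (auto intro: open_Int simp: compact_imp_closed open_Compl)
  moreover have "z0 \<notin> K"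
  proof
    assume "z0 \<in> K"
    then obtain t where "t \<in> {0..1} - {t0 - r3<..<t0 + r3}" "z0 = \<gamma> t" unfolding K_def by blast
    then show False using inj_onD [OF inj, of t0 t] t0 r3 by auto
  qed
  moreover have "isCont F (of_real t0)"
    using holomorphic_on_imp_continuous_on [OF holo] r3 by (simp add: continuous_on_eq_continuous_at)
  moreover have "F (of_real t0) = z0" using F(2) [of t0] t0 by auto
  ultimately have "\<forall>\<^sub>F w in nhds (of_real t0). F w \<in> U \<inter> - K"
    using U by (intro topological_tendstoD) (auto simp: isCont_def tendsto_at_iff_tendsto_nhds)
  then obtain r4 where r4: "r4 > 0" "\<And>w. dist w (of_real t0) < r4 \<Longrightarrow> F w \<in> U \<inter> - K"
    unfolding eventually_nhds_metric by blast
  define R where "R = min r3 r4"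
  define f where "f \<zeta> = F (of_real t0 + \<zeta>)" for \<zeta>
  have R: "R > 0" "R \<le> r3" "R \<le> r4" using r3 r4 by (auto simp: R_def)
  have mem: "of_real t0 + \<zeta> \<in> ball (of_real t0) r3" "f \<zeta> \<in> U" "f \<zeta> \<notin> K" if "\<zeta> \<in> ball 0 R" for \<zeta>
    using that R r4(2) [of "of_real t0 + \<zeta>"] by (auto simp: f_def dist_norm)
  have "F \<circ> (\<lambda>\<zeta>. of_real t0 + \<zeta>) holomorphic_on ball 0 R"
  proof (rule holomorphic_on_compose_gen [OF _ holo])
    show "(\<lambda>\<zeta>. complex_of_real t0 + \<zeta>) ` ball 0 R \<subseteq> ball (complex_of_real t0) r3" using mem(1) by blast
  qed (intro holomorphic_intros)
  then have "f holomorphic_on ball 0 R" by (simp add: f_def [abs_def] o_def)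
  moreover have "inj_on f (ball 0 R)"
  proof (rule inj_onI)
    fix x y assume a: "x \<in> ball 0 R" "y \<in> ball 0 R" "f x = f y"
    have "of_real t0 + x = of_real t0 + y"
      by (rule inj_onD [OF injF _ mem(1) [OF a(1)] mem(1) [OF a(2)]]) (use a(3) in \<open>simp add: f_def\<close>)
    then show "x = y" by simp
  qed
  moreover have "f 0 = z0" using \<open>F (of_real t0) = z0\<close> by (simp add: f_def)
  moreover have "Some (f \<zeta>) \<in> extended_plane frontier_of D \<longleftrightarrow> Im \<zeta> = 0" if \<zeta>: "\<zeta> \<in> ball 0 R" for \<zeta>
  proof -
    have "Some (f \<zeta>) \<in> extended_plane frontier_of D \<longleftrightarrow> f \<zeta> \<in> path_image \<gamma>"
      using U(3) mem(2) [OF \<zeta>] by blast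
    also have "\<dots> \<longleftrightarrow> Im \<zeta> = 0"
    proof
      assume "f \<zeta> \<in> path_image \<gamma>"
      then obtain t where t: "t \<in> {0..1}" "f \<zeta> = \<gamma> t" by (auto simp: path_image_def)
      then have "t \<in> {t0 - r3<..<t0 + r3}" using mem(3) [OF \<zeta>] by (auto simp: K_def)
      then have "of_real t \<in> ball (of_real t0 :: complex) r3"
        by (auto simp: dist_norm norm_of_real simp flip: of_real_diff)
      moreover have "F (of_real t0 + \<zeta>) = F (of_real t)" using t F(2) by (simp add: f_def)
      ultimately have "of_real t0 + \<zeta> = of_real t"
        using mem(1) [OF \<zeta>] inj_onD [OF injF] by blast
      then have "\<zeta> = of_real (t - t0)" by (simp add: algebra_simps)
      then show "Im \<zeta> = 0" by simp
    next
      assume "Im \<zeta> = 0"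
      then have z: "\<zeta> = of_real (Re \<zeta>)" by (simp add: complex_eq_iff)
      have "\<bar>Re \<zeta>\<bar> < R" using \<zeta> abs_Re_le_cmod [of \<zeta>] by auto
      then have t: "t0 + Re \<zeta> \<in> {0..1}" using R r3 by auto
      have "f \<zeta> = F (of_real (t0 + Re \<zeta>))" using z by (simp add: f_def)
      then have "f \<zeta> = \<gamma> (t0 + Re \<zeta>)" using F(2) [OF t] by simp
      then show "f \<zeta> \<in> path_image \<gamma>" using t by (auto simp: path_image_def)
    qed
    finally show ?thesis .
  qed
  ultimately have "boundary_coordinate D z0 f R" using R by (simp add: boundary_coordinate_def)
  then show thesis by (rule that)
qed

text \<open>The theorem allows any arc \<open>\<gamma>\<close>, while \<open>f\<close> may come from
  another one. Both describe the frontier near \<open>z0\<close>, so the inverse of \<open>f\<close>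
  is real along \<open>\<gamma>\<close>, and so is its derivative \<open>c\<close>.\<close>

lemma boundary_coordinate_tangent:
  assumes f: "boundary_coordinate D z0 f R" and \<gamma>: "boundary_arc_near D z0 \<gamma>"
    and t: "t \<in> {0<..<1}" "\<gamma> t = z0"
  obtains k :: real where "k \<noteq> 0" "vector_derivative \<gamma> (at t) = of_real k * deriv f 0"
proof -
  have R: "R > 0" and hf: "f holomorphic_on ball 0 R" and inj: "inj_on f (ball 0 R)" and f0: "f 0 = z0"
    and fr: "\<And>\<zeta>. \<zeta> \<in> ball 0 R \<Longrightarrow> Some (f \<zeta>) \<in> extended_plane frontier_of D \<longleftrightarrow> Im \<zeta> = 0"
    using f by (auto simp: boundary_coordinate_def)
  obtain U where U: "open U" "z0 \<in> U" "Some -` (extended_plane frontier_of D) \<inter> U = path_image \<gamma> \<inter> U"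
    and an: "analytic_arc \<gamma>"
    using \<gamma> unfolding boundary_arc_near_def by blast
  obtain F where F: "F analytic_on of_real ` {0..1}"
    "\<And>t. t \<in> {0..1} \<Longrightarrow> \<gamma> t = F (of_real t)" "\<And>t. t \<in> {0..1} \<Longrightarrow> deriv F (of_real t) \<noteq> 0"
    using an unfolding analytic_arc_def by blast
  have tm: "(of_real t :: complex) \<in> of_real ` {0..1}" using t by (intro imageI) auto
  obtain r where r: "r > 0" "F holomorphic_on ball (of_real t) r"
    using F(1) tm unfolding analytic_on_def by blast
  have dF: "(F has_field_derivative deriv F (of_real t)) (at (of_real t))"
    using holomorphic_derivI [OF r(2) open_ball] r by simp
  have Ft: "F (of_real t) = z0" using F(2) [of t] t by simp
  obtain g where g: "g holomorphic_on f ` ball 0 R" "\<And>w. w \<in> ball 0 R \<Longrightarrow> deriv f w * deriv g (f w) = 1"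
    "\<And>w. w \<in> ball 0 R \<Longrightarrow> g (f w) = w"
    using holomorphic_has_inverse [OF hf open_ball inj] by metis
  have o: "open (f ` ball 0 R)" using open_mapping_thm3 [OF hf open_ball inj] .
  have zI: "z0 \<in> f ` ball 0 R" using f0 R by force
  have dg: "(g has_field_derivative deriv g z0) (at z0)"
    using holomorphic_derivI [OF g(1) o zI] .
  have dF': "((\<lambda>s. F (of_real s)) has_vector_derivative deriv F (of_real t)) (at t)"
    using has_vector_derivative_real_field [OF dF] .
  have evt: "\<forall>\<^sub>F s in nhds t. s \<in> {0<..<1}"
    using t by (intro eventually_nhds_in_open) auto
  have "(\<gamma> has_vector_derivative deriv F (of_real t)) (at t)"
  proof (rule has_vector_derivative_transform_within_open [OF dF' open_greaterThanLessThan t(1)])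
    show "F (of_real s) = \<gamma> s" if "s \<in> {0<..<1}" for s using F(2) [of s] that by simp
  qed
  then have vd: "vector_derivative \<gamma> (at t) = deriv F (of_real t)"
    by (rule vector_derivative_at)
  define c where "c = deriv g z0 * deriv F (of_real t)"
  have "((\<lambda>w. g (F w)) has_field_derivative c) (at (of_real t))"
    unfolding c_def by (rule DERIV_chain2) (use dg dF Ft in auto)
  then have "((\<lambda>s. g (F (of_real s))) has_vector_derivative c) (at t)"
    by (rule has_vector_derivative_real_field)
  then have "((\<lambda>s. Im (g (F (of_real s)))) has_vector_derivative Im c) (at t)"
    using bounded_linear.has_vector_derivative [OF bounded_linear_Im] by blast
  then have d1: "((\<lambda>s. Im (g (F (of_real s)))) has_real_derivative Im c) (at t)"
    by (simp add: has_real_derivative_iff_has_vector_derivative)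
  have "\<forall>\<^sub>F s in nhds t. F (of_real s) \<in> f ` ball 0 R \<inter> U"
  proof -
    have "isCont (\<lambda>s. F (of_real s)) t"
      using has_vector_derivative_continuous [OF dF'] by simp
    then have "((\<lambda>s. F (of_real s)) \<longlongrightarrow> F (of_real t)) (nhds t)"
      unfolding isCont_def by (rule tendsto_at_iff_tendsto_nhds [THEN iffD1])
    then show ?thesis
      by (rule topological_tendstoD) (use o U zI Ft in auto)
  qed
  then have "\<forall>\<^sub>F s in nhds t. Im (g (F (of_real s))) = 0"
    using evt
  proof eventually_elim
    case (elim s)
    then obtain \<zeta> where \<zeta>: "\<zeta> \<in> ball 0 R" "F (of_real s) = f \<zeta>" by auto
    have "F (of_real s) = \<gamma> s" "s \<in> {0..1}" using F(2) [of s] elim by auto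
    then have "F (of_real s) \<in> path_image \<gamma>" unfolding path_image_def by blast
    then have "Some (f \<zeta>) \<in> extended_plane frontier_of D" using U(3) elim \<zeta> by auto
    then show ?case using fr \<zeta> g(3) by simp
  qed
  then have "Im c = 0"
    using DERIV_unique [OF d1, of 0] DERIV_cong_ev [OF refl, of "\<lambda>s. Im (g (F (of_real s)))" "\<lambda>_. 0" t 0 0] by simp
  then have c: "c = of_real (Re c)" by (simp add: complex_eq_iff)
  have fg: "deriv f 0 * deriv g z0 = 1" using g(2) [of 0] R f0 by simp
  then have "deriv F (of_real t) = c * deriv f 0"
    by (simp add: c_def mult_ac)
  moreover have "deriv F (of_real t) \<noteq> 0" using F(3) [of t] t by simp
  ultimately show thesis
    using that [of "Re c"] c vd by (metis mult_zero_left of_real_0)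
qed

text \<open>The factor \<open>u\<close> tends to \<open>A\<close>, so the direction of
  \<open>\<zeta>\<close> tends to \<open>v / sgn A\<close>. This limit has modulus 1, is purely
  imaginary by perpendicularity and lies in the closed upper half plane, so it is
  \<open>\<i>\<close>; hence \<open>Im \<zeta>\<close> is asymptotic to
  \<open>|\<zeta>|\<close>.\<close>

lemma perpendicular_approach:
  fixes \<zeta> :: "real \<Rightarrow> complex"
  assumes D: "(f has_field_derivative A) (at 0)" "A \<noteq> 0"
    and \<zeta>: "filterlim \<zeta> (at 0) L" "\<forall>\<^sub>F t in L. Im (\<zeta> t) > 0" and L: "L \<noteq> bot"
    and v: "((\<lambda>t. sgn (f (\<zeta> t) - f 0)) \<longlongrightarrow> v) L" "v \<bullet> A = 0"
  shows "((\<lambda>t. Im (\<zeta> t) / cmod (f (\<zeta> t) - f 0)) \<longlongrightarrow> 1 / cmod A) L"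
proof -
  define u where "u t = (f (\<zeta> t) - f 0) / \<zeta> t" for t
  have "((\<lambda>w. (f w - f 0) / w) \<longlongrightarrow> A) (at 0)"
    using D(1) by (simp add: has_field_derivative_iff)
  then have u: "(u \<longlongrightarrow> A) L"
    unfolding u_def using \<zeta>(1) by (rule filterlim_compose)
  then have su: "((\<lambda>t. sgn (u t)) \<longlongrightarrow> sgn A) L" using D by (intro tendsto_sgn)
  have nz: "\<forall>\<^sub>F t in L. u t \<noteq> 0"
    using tendsto_imp_eventually_ne [OF u D(2)] .
  have eq: "\<forall>\<^sub>F t in L. sgn (f (\<zeta> t) - f 0) / sgn (u t) = sgn (\<zeta> t)"
    using nz \<zeta>(2)
  proof eventually_elim
    case (elim t)
    then have z: "\<zeta> t \<noteq> 0" by auto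
    then have "f (\<zeta> t) - f 0 = u t * \<zeta> t" by (simp add: u_def)
    then show ?case using elim by (simp add: sgn_mult sgn_eq_0_iff)
  qed
  have "((\<lambda>t. sgn (f (\<zeta> t) - f 0) / sgn (u t)) \<longlongrightarrow> v / sgn A) L"
    using D by (intro tendsto_divide v su) (simp add: sgn_eq_0_iff)
  then have s: "((\<lambda>t. sgn (\<zeta> t)) \<longlongrightarrow> v / sgn A) L"
    using eq by (rule Lim_transform_eventually)
  define \<omega> where "\<omega> = v / sgn A"
  have "((\<lambda>t. norm (sgn (\<zeta> t))) \<longlongrightarrow> norm \<omega>) L"
    unfolding \<omega>_def by (intro tendsto_norm s)
  moreover have "\<forall>\<^sub>F t in L. norm (sgn (\<zeta> t)) = 1"
    using \<zeta>(2) by eventually_elim (auto simp: norm_sgn)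
  then have "((\<lambda>t. norm (sgn (\<zeta> t))) \<longlongrightarrow> 1) L"
    by (rule tendsto_eventually)
  ultimately have n1: "norm \<omega> = 1"
    by (rule tendsto_unique [OF L])
  have re: "Re \<omega> = 0"
  proof -
    have "\<omega> = v * of_real (norm A) / A" using D by (simp add: \<omega>_def sgn_div_norm scaleR_conv_of_real field_simps)
    then have "\<omega> = of_real (norm A) * (v / A)" by simp
    then have "Re \<omega> = norm A * Re (v / A)"
      by (simp only: times_complex.sel Re_complex_of_real Im_complex_of_real mult_zero_left diff_zero)
    moreover have "Re (v / A) = 0" using v(2) by (simp add: Re_divide inner_complex_def)
    ultimately show ?thesis by simp
  qed
  have im: "((\<lambda>t. Im (sgn (\<zeta> t))) \<longlongrightarrow> Im \<omega>) L"
    unfolding \<omega>_def by (intro tendsto_Im s)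
  have "Im \<omega> \<ge> 0"
  proof (rule tendsto_lowerbound [OF im _ L])
    show "\<forall>\<^sub>F t in L. 0 \<le> Im (sgn (\<zeta> t))"
      using \<zeta>(2) by eventually_elim (simp add: sgn_div_norm)
  qed
  moreover have "\<bar>Im \<omega>\<bar> = 1" using n1 re by (simp add: cmod_def)
  ultimately have "Im \<omega> = 1" by simp
  then have "((\<lambda>t. Im (sgn (\<zeta> t)) / norm (u t)) \<longlongrightarrow> 1 / norm A) L"
    using im D by (intro tendsto_divide tendsto_norm u) auto
  then show ?thesis
  proof (rule Lim_transform_eventually)
    show "\<forall>\<^sub>F t in L. Im (sgn (\<zeta> t)) / norm (u t) = Im (\<zeta> t) / cmod (f (\<zeta> t) - f 0)"
      using \<zeta>(2)
    proof eventually_elim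
      case (elim t)
      then have "\<zeta> t \<noteq> 0" by auto
      then show ?case by (simp add: u_def sgn_div_norm norm_divide)
    qed
  qed
qed

text \<open>Rests on \<open>- x \<le> exp (- x) - 1 \<le> - x + x^2\<close> for
  \<open>x \<ge> 0\<close>; the quadratic term is of fourth order in \<open>n\<close>.\<close>

lemma exp_expansion:
  assumes h: "((\<lambda>t. h t / (n t)\<^sup>2) \<longlongrightarrow> c) L" and n: "(n \<longlongrightarrow> 0) L"
    and nn: "\<forall>\<^sub>F t in L. h t \<ge> 0 \<and> n t > 0"
  shows "(\<lambda>t. exp (- h t) - (1 - c * (n t)\<^sup>2)) \<in> o[L](\<lambda>t. (n t)\<^sup>2 :: real)"
proof (rule smalloI_tendsto)
  show "\<forall>\<^sub>F t in L. (n t)\<^sup>2 \<noteq> 0" using nn by eventually_elim auto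
  have e: "- x \<le> exp (- x) - 1 \<and> exp (- x) - 1 \<le> - x + x\<^sup>2" if "x \<ge> 0" for x :: real
  proof -
    have "exp (- x) \<ge> 1 + - x" by (rule exp_ge_add_one_self)
    moreover have "exp (- x) \<le> 1 - x + x\<^sup>2"
    proof -
      have "exp (- x) * (1 + x) \<le> exp (- x) * exp x"
        by (intro mult_left_mono exp_ge_add_one_self) auto
      also have "\<dots> = 1" by (simp add: exp_minus)
      \<comment> \<open>The right side equals \<open>1 + x^3\<close>.\<close>
      also have "1 \<le> (1 - x + x\<^sup>2) * (1 + x)" using that by (simp add: algebra_simps power2_eq_square)
      finally show ?thesis using that by (simp add: mult_le_cancel_right)
    qed
    ultimately show ?thesis by linarith
  qed
  show "((\<lambda>t. (exp (- h t) - (1 - c * (n t)\<^sup>2)) / (n t)\<^sup>2) \<longlongrightarrow> 0) L"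
  proof (rule tendsto_sandwich)
    show "((\<lambda>t. c - h t / (n t)\<^sup>2) \<longlongrightarrow> 0) L"
      using tendsto_diff [OF tendsto_const [of c] h] by simp
    show "((\<lambda>t. c - h t / (n t)\<^sup>2 + (h t / (n t)\<^sup>2) * (h t / (n t)\<^sup>2) * (n t)\<^sup>2) \<longlongrightarrow> 0) L"
    proof -
      have "((\<lambda>t. c - h t / (n t)\<^sup>2 + (h t / (n t)\<^sup>2) * (h t / (n t)\<^sup>2) * (n t)\<^sup>2) \<longlongrightarrow> c - c + c * c * 0\<^sup>2) L"
        by (intro tendsto_intros h n)
      then show ?thesis by simp
    qed
    show "\<forall>\<^sub>F t in L. c - h t / (n t)\<^sup>2 \<le> (exp (- h t) - (1 - c * (n t)\<^sup>2)) / (n t)\<^sup>2"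
      using nn
    proof eventually_elim
      case (elim t)
      then have "(- h t + c * (n t)\<^sup>2) / (n t)\<^sup>2 \<le> (exp (- h t) - (1 - c * (n t)\<^sup>2)) / (n t)\<^sup>2"
        using e [of "h t"] by (intro divide_right_mono) auto
      then show ?case using elim by (simp add: add_divide_distrib diff_divide_distrib)
    qed
    show "\<forall>\<^sub>F t in L. (exp (- h t) - (1 - c * (n t)\<^sup>2)) / (n t)\<^sup>2 \<le> c - h t / (n t)\<^sup>2 + (h t / (n t)\<^sup>2) * (h t / (n t)\<^sup>2) * (n t)\<^sup>2"
      using nn
    proof eventually_elim
      case (elim t)
      then have "(exp (- h t) - (1 - c * (n t)\<^sup>2)) / (n t)\<^sup>2 \<le> (- h t + (h t)\<^sup>2 + c * (n t)\<^sup>2) / (n t)\<^sup>2"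
        using e [of "h t"] by (intro divide_right_mono) auto
      also have "\<dots> = c - h t / (n t)\<^sup>2 + (h t / (n t)\<^sup>2) * (h t / (n t)\<^sup>2) * (n t)\<^sup>2"
        using elim by (simp add: field_simps power2_eq_square)
      finally show ?case .
    qed
  qed
qed

section \<open>The side of the arc determined by an accessible point\<close>

lemma openin_Int_frontier: "openin X D \<Longrightarrow> D \<inter> X frontier_of D = {}"
  by (auto simp: frontier_of_def interior_of_openin)

lemma eventually_at_left_1_ge:
  assumes "s < 1" shows "\<forall>\<^sub>F t in at_left 1. t \<in> {s..<1::real}"
  using assms by (auto simp: eventually_at_left_field intro: exI [of _ s])

lemma eventually_at_left_1_obtain:
  assumes "\<forall>\<^sub>F t in at_left (1::real). P t"
  obtains s where "s \<in> {0..<1}" "\<And>t. t \<in> {s..<1} \<Longrightarrow> P t"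
proof -
  obtain b where b: "b < 1" "\<And>t. b < t \<Longrightarrow> t < 1 \<Longrightarrow> P t"
    using assms by (auto simp: eventually_at_left_field)
  define s where "s = max 0 ((b + 1) / 2)"
  have "s \<in> {0..<1}" "b < s" using b by (auto simp: s_def max_def)
  then show thesis using b(2) by (intro that [of s]) auto
qed

lemma end_path_tendsto:
  assumes "p \<in> end_paths D z0" shows "(p \<longlongrightarrow> z0) (at_left 1)"
proof -
  have "continuous_on {0..1} p" "p 1 = z0"
    using assms by (auto simp: end_paths_def path_def pathfinish_def)
  then have "(p \<longlongrightarrow> z0) (at 1 within {0..1})"
    by (auto simp: continuous_on_def)
  moreover have "at 1 within {0..1} = at_left (1::real)"
    by (rule at_within_Icc_at_left) simp
  ultimately show ?thesis by simp
qed

lemma end_path_mem: "p \<in> end_paths D z0 \<Longrightarrow> t \<in> {0..<1} \<Longrightarrow> Some (p t) \<in> D"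
  by (auto simp: end_paths_def)

lemma convex_half_disc: "convex (half_disc R)"
proof -
  have "half_disc R = ball 0 R \<inter> {z. Im z > 0}" by (auto simp: half_disc_def)
  then show ?thesis by (simp add: convex_Int convex_halfspace_Im_gt)
qed

context
  fixes D z0 f R
  assumes D: "openin extended_plane D" and bc: "boundary_coordinate D z0 f R"
begin

lemma bc_facts:
  shows "R > 0" "f holomorphic_on ball 0 R" "inj_on f (ball 0 R)" "f 0 = z0"
    "\<And>\<zeta>. \<zeta> \<in> ball 0 R \<Longrightarrow> Some (f \<zeta>) \<in> extended_plane frontier_of D \<longleftrightarrow> Im \<zeta> = 0"
    "continuous_on (ball 0 R) f"
  using bc holomorphic_on_imp_continuous_on by (auto simp: boundary_coordinate_def)

lemma bc_inject: "f x = f y \<Longrightarrow> x \<in> ball 0 R \<Longrightarrow> y \<in> ball 0 R \<Longrightarrow> x = y"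
  using bc_facts(3) by (rule inj_onD)

lemma bc_open_image:
  assumes "0 < r" "r \<le> R" shows "open (f ` ball 0 r)" "z0 \<in> f ` ball 0 r"
proof -
  have sub: "ball 0 r \<subseteq> ball (0::complex) R" using assms by auto
  show "open (f ` ball 0 r)"
    by (rule open_mapping_thm3 [OF holomorphic_on_subset [OF bc_facts(2) sub] open_ball inj_on_subset [OF bc_facts(3) sub]])
  have "f 0 \<in> f ` ball 0 r" using assms by (intro imageI) auto
  then show "z0 \<in> f ` ball 0 r" using bc_facts(4) by simp
qed

text \<open>The real axis of the coordinate is frontier and so misses the open set \<open>D\<close>;
  a connected part of \<open>D\<close> in the coordinate patch cannot pass from one half disc to the
  other.\<close>

lemma bc_same_side:
  assumes C: "connected C" "C \<subseteq> f ` ball 0 R" "C \<subseteq> Some -` D" and x: "x \<in> C" "x \<in> f ` half_disc R"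
  shows "C \<subseteq> f ` half_disc R"
proof
  fix y assume y: "y \<in> C"
  obtain g where g: "g holomorphic_on f ` ball 0 R" "\<And>w. w \<in> ball 0 R \<Longrightarrow> g (f w) = w"
    using holomorphic_has_inverse [OF bc_facts(2) open_ball bc_facts(3)] by metis
  have nz: "Im (g v) \<noteq> 0" if v: "v \<in> C" for v
  proof -
    obtain \<zeta> where \<zeta>: "\<zeta> \<in> ball 0 R" "v = f \<zeta>" using v C by blast
    have "Some v \<notin> extended_plane frontier_of D"
      using openin_Int_frontier [OF D] C(3) v by blast
    then show ?thesis using bc_facts(5) [OF \<zeta>(1)] \<zeta> g(2) by auto
  qed
  have "continuous_on C (\<lambda>v. Im (g v))"
    using holomorphic_on_imp_continuous_on [OF g(1)] C(2) by (intro continuous_intros) (auto intro: continuous_on_subset)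
  then have con: "connected ((\<lambda>v. Im (g v)) ` C)" using C(1) connected_continuous_image by blast
  have gx: "Im (g x) > 0"
  proof -
    obtain \<xi> where "\<xi> \<in> half_disc R" "x = f \<xi>" using x by blast
    then show ?thesis using g(2) [of \<xi>] by (auto simp: half_disc_def)
  qed
  have "Im (g y) > 0"
  proof (rule ccontr)
    assume "\<not> Im (g y) > 0"
    then have "0 \<in> (\<lambda>v. Im (g v)) ` C"
      using connectedD_interval [OF con, of "Im (g y)" "Im (g x)" 0] x y gx by auto
    then show False using nz by auto
  qed
  moreover obtain \<zeta> where "\<zeta> \<in> ball 0 R" "y = f \<zeta>" using y C by blast
  ultimately show "y \<in> f ` half_disc R" using g(2) [of \<zeta>] by (auto simp: half_disc_def)
qed

text \<open>The open half disc is connected and its image misses the frontier, so the image lies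
  entirely inside or entirely outside \<open>D\<close>.\<close>

lemma bc_half_disc_subset:
  assumes "\<zeta> \<in> half_disc R" "Some (f \<zeta>) \<in> D" and \<xi>: "\<xi> \<in> half_disc R"
  shows "Some (f \<xi>) \<in> D"
proof (rule ccontr)
  assume n: "Some (f \<xi>) \<notin> D"
  have "continuous_on (half_disc R) f"
    using bc_facts(6) by (rule continuous_on_subset) (auto simp: half_disc_def)
  then have "connected (f ` half_disc R)"
    using connected_continuous_image convex_connected convex_half_disc by blast
  then have "connectedin extended_plane (Some ` f ` half_disc R)"
    by (intro connectedin_continuous_map_image [OF continuous_map_Some]) simp
  then have "Some ` f ` half_disc R \<inter> extended_plane frontier_of D \<noteq> {}"
    by (rule connectedin_Int_frontier_of) (use assms n in auto)
  then show False using bc_facts(5) by (auto simp: half_disc_def)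
qed

lemma bc_path_near:
  assumes p: "(p \<longlongrightarrow> z0) (at_left 1)" and ev: "\<forall>\<^sub>F t in at_left 1. p t \<in> f ` half_disc R" and r: "0 < r" "r \<le> R"
  shows "\<forall>\<^sub>F t in at_left 1. p t \<in> f ` half_disc r"
proof -
  have "\<forall>\<^sub>F t in at_left 1. p t \<in> f ` ball 0 r"
    using p bc_open_image [OF r] by (intro topological_tendstoD) auto
  then show ?thesis
    using ev
  proof eventually_elim
    case (elim t)
    then obtain \<zeta> \<xi> where *: "\<zeta> \<in> ball 0 r" "\<xi> \<in> half_disc R" "p t = f \<zeta>" "p t = f \<xi>" by blast
    then have "\<zeta> = \<xi>" using r bc_inject [of \<zeta> \<xi>] by (auto simp: half_disc_def)
    then show ?case using * by (auto simp: half_disc_def)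
  qed
qed

text \<open>A tail of the path is a connected part of \<open>D\<close> in the coordinate patch, so
  the side of its first point decides.\<close>

lemma bc_path_side:
  assumes p: "p \<in> end_paths D z0"
  shows "(\<forall>\<^sub>F t in at_left 1. p t \<in> f ` half_disc R) \<or> (\<forall>\<^sub>F t in at_left 1. p t \<in> (\<lambda>\<zeta>. f (- \<zeta>)) ` half_disc R)"
proof -
  have "\<forall>\<^sub>F t in at_left 1. p t \<in> f ` ball 0 R"
    using end_path_tendsto [OF p] bc_open_image [of R] bc_facts(1) by (intro topological_tendstoD) auto
  then obtain s where s: "s \<in> {0..<1}" "\<And>t. t \<in> {s..<1} \<Longrightarrow> p t \<in> f ` ball 0 R"
    using eventually_at_left_1_obtain by blast
  have sm: "s \<in> {s..<1}" using s by auto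
  have "continuous_on {s..<1} p"
    by (rule continuous_on_subset [of "{0..1}"]) (use p s in \<open>auto simp: end_paths_def path_def\<close>)
  then have "connected (p ` {s..<1})"
    by (rule connected_continuous_image) (simp add: is_interval_connected)
  moreover have "p ` {s..<1} \<subseteq> Some -` D" using end_path_mem [OF p] s by auto
  moreover have "p ` {s..<1} \<subseteq> f ` ball 0 R" using s by auto
  ultimately have side: "p ` {s..<1} \<subseteq> f ` half_disc R" if "p s \<in> f ` half_disc R"
    using bc_same_side [of "p ` {s..<1}" "p s"] that sm by blast
  obtain \<zeta> where \<zeta>: "\<zeta> \<in> ball 0 R" "p s = f \<zeta>" using s(2) [OF sm] by blast
  have "Some (p s) \<notin> extended_plane frontier_of D"
    using openin_Int_frontier [OF D] end_path_mem [OF p s(1)] by blast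
  then have "Im \<zeta> \<noteq> 0" using bc_facts(5) [OF \<zeta>(1)] \<zeta>(2) by simp
  then consider "Im \<zeta> > 0" | "Im \<zeta> < 0" by linarith
  then show ?thesis
  proof cases
    case 1
    then have "p ` {s..<1} \<subseteq> f ` half_disc R" using side \<zeta> by (auto simp: half_disc_def)
    then show ?thesis using eventually_at_left_1_ge [of s] s by (auto elim!: eventually_mono)
  next
    case 2
    have mem: "t \<in> (\<lambda>\<zeta>. f (- \<zeta>)) ` half_disc R \<longleftrightarrow> (\<exists>\<xi>\<in>ball 0 R. Im \<xi> < 0 \<and> t = f \<xi>)" for t
    proof
      assume "\<exists>\<xi>\<in>ball 0 R. Im \<xi> < 0 \<and> t = f \<xi>"
      then obtain \<xi> where "\<xi> \<in> ball 0 R" "Im \<xi> < 0" "t = f \<xi>" by blast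
      then show "t \<in> (\<lambda>\<zeta>. f (- \<zeta>)) ` half_disc R"
        by (intro image_eqI [of _ _ "- \<xi>"]) (auto simp: half_disc_def)
    next
      assume "t \<in> (\<lambda>\<zeta>. f (- \<zeta>)) ` half_disc R"
      then obtain \<eta> where "\<eta> \<in> half_disc R" "t = f (- \<eta>)" by blast
      then show "\<exists>\<xi>\<in>ball 0 R. Im \<xi> < 0 \<and> t = f \<xi>"
        by (intro bexI [of _ "- \<eta>"]) (auto simp: half_disc_def)
    qed
    have "p t \<in> (\<lambda>\<zeta>. f (- \<zeta>)) ` half_disc R" if t: "t \<in> {s..<1}" for t
    proof -
      obtain \<xi> where \<xi>: "\<xi> \<in> ball 0 R" "p t = f \<xi>" using s(2) [OF t] by blast
      have "t \<in> {0..<1}" using t s by auto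
      then have "Some (p t) \<notin> extended_plane frontier_of D"
        using openin_Int_frontier [OF D] end_path_mem [OF p] by blast
      then have nz: "Im \<xi> \<noteq> 0" using bc_facts(5) [OF \<xi>(1)] \<xi>(2) by simp
      have "\<not> Im \<xi> > 0"
      proof
        assume "Im \<xi> > 0"
        then have "p t \<in> f ` half_disc R" using \<xi> by (auto simp: half_disc_def)
        then have "p ` {s..<1} \<subseteq> f ` half_disc R"
          using bc_same_side [of "p ` {s..<1}" "p t"] t \<open>connected (p ` {s..<1})\<close> \<open>p ` {s..<1} \<subseteq> Some -` D\<close>
            \<open>p ` {s..<1} \<subseteq> f ` ball 0 R\<close> by blast
        then have "f \<zeta> \<in> f ` half_disc R" using sm \<zeta>(2) by (metis image_subset_iff)
        then obtain \<eta> where \<eta>: "\<eta> \<in> half_disc R" "f \<zeta> = f \<eta>" by blast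
        then have "\<zeta> = \<eta>" using \<zeta>(1) bc_inject [of \<zeta> \<eta>] by (auto simp: half_disc_def)
        then show False using \<eta> 2 by (simp add: half_disc_def)
      qed
      then show ?thesis using nz \<xi> mem by force
    qed
    then have "\<forall>\<^sub>F t in at_left 1. p t \<in> (\<lambda>\<zeta>. f (- \<zeta>)) ` half_disc R"
      using s by (intro eventually_mono [OF eventually_at_left_1_ge [of s]]) auto
    then show ?thesis ..
  qed
qed

text \<open>Tails of equivalent paths are joined by connected parts of \<open>D\<close> inside a
  disc small enough to lie in the coordinate patch, so they run on the same side.\<close>

lemma bc_equivalent_path_side:
  assumes pq: "(p0, p) \<in> end_equiv D z0" and p0: "\<forall>\<^sub>F t in at_left 1. p0 t \<in> f ` half_disc R"
  shows "\<forall>\<^sub>F t in at_left 1. p t \<in> f ` half_disc R"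
proof -
  obtain e where e: "e > 0" "ball z0 e \<subseteq> f ` ball 0 R"
    using bc_open_image [of R] bc_facts(1) open_contains_ball by (metis order_refl)
  then obtain s where s: "s \<in> {0..<1}"
    "\<And>t t'. t \<in> {s..<1} \<Longrightarrow> t' \<in> {s..<1} \<Longrightarrow> connected_component (Some -` D \<inter> ball z0 e) (p0 t) (p t')"
    using pq unfolding end_equiv_def by blast
  have "\<forall>\<^sub>F t in at_left 1. p0 t \<in> f ` half_disc R \<and> t \<in> {s..<1}"
    using p0 eventually_at_left_1_ge [of s] s by (auto intro: eventually_conj)
  then obtain t where t: "t \<in> {s..<1}" "p0 t \<in> f ` half_disc R"
    using eventually_happens' [OF trivial_limit_at_left_real] by blast
  have "p t' \<in> f ` half_disc R" if t': "t' \<in> {s..<1}" for t'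
  proof -
    obtain C where C: "connected C" "C \<subseteq> Some -` D \<inter> ball z0 e" "p0 t \<in> C" "p t' \<in> C"
      using s(2) [OF t(1) t'] unfolding connected_component_def by blast
    then show ?thesis using bc_same_side [OF C(1) _ _ C(3) t(2)] e by blast
  qed
  then show ?thesis using eventually_at_left_1_ge [of s] s by (auto elim!: eventually_mono)
qed

context
  fixes p0
  assumes p0: "p0 \<in> end_paths D z0" and side: "\<forall>\<^sub>F t in at_left 1. p0 t \<in> f ` half_disc R"
begin

lemma half_disc_in_domain:
  assumes "\<zeta> \<in> half_disc R" shows "Some (f \<zeta>) \<in> D"
proof -
  have "\<forall>\<^sub>F t in at_left 1. p0 t \<in> f ` half_disc R \<and> t \<in> {0..<1}"
    using side eventually_at_left_1_ge [of 0] by (auto intro: eventually_conj)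
  then obtain t where t: "p0 t \<in> f ` half_disc R" "t \<in> {0..<1}"
    using eventually_happens' [OF trivial_limit_at_left_real] by blast
  then obtain \<xi> where "\<xi> \<in> half_disc R" "Some (f \<xi>) \<in> D"
    using end_path_mem [OF p0 t(2)] by auto
  then show ?thesis using bc_half_disc_subset assms by blast
qed

text \<open>Images of radial segments will be compared with the inner distance, so they must
  represent the given accessible point. Images of small half discs are connected subsets of
  \<open>D\<close> that contain the tails of both paths.\<close>

lemma segment_end_equiv:
  assumes \<zeta>: "\<zeta> \<in> half_disc R"
  shows "(p0, \<lambda>t. f (of_real (1 - t) * \<zeta>)) \<in> end_equiv D z0"
proof -
  let ?q = "\<lambda>t. f (of_real (1 - t) * \<zeta>)"
  have nz: "norm (of_real (1 - t) * \<zeta>) \<le> norm \<zeta>" if "t \<in> {0..1}" for t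
    using that by (simp add: norm_mult mult_left_le_one_le del: of_real_diff)
  have hd: "of_real (1 - t) * \<zeta> \<in> half_disc R" if "t \<in> {0..<1}" for t
    using nz [of t] that \<zeta> by (auto simp: half_disc_def simp del: of_real_diff)
  have "continuous_on {0..1} ?q"
  proof (rule continuous_on_compose2 [OF bc_facts(6)])
    show "(\<lambda>t. of_real (1 - t) * \<zeta>) ` {0..1} \<subseteq> ball 0 R"
      using nz \<zeta> by (force simp: half_disc_def)
  qed (intro continuous_intros)
  then have q: "?q \<in> end_paths D z0"
    using p0 bc_facts(4) half_disc_in_domain hd by (auto simp: end_paths_def path_def pathfinish_def simp del: of_real_diff)
  have "\<exists>s\<in>{0..<1}. \<forall>t\<in>{s..<1}. \<forall>t'\<in>{s..<1}. connected_component (Some -` D \<inter> ball z0 e) (p0 t) (?q t')" if e: "e > 0" for e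
  proof -
    have "isCont f 0" using bc_facts(1,6) by (simp add: continuous_on_eq_continuous_at)
    then obtain r0 where r0: "r0 > 0" "\<And>w. dist w 0 < r0 \<Longrightarrow> dist (f w) z0 < e"
      using e bc_facts(4) unfolding continuous_at_eps_delta by blast
    define r where "r = min r0 R"
    have r: "0 < r" "r \<le> R" "r \<le> r0" using r0 bc_facts(1) by (auto simp: r_def)
    have sub: "f ` half_disc r \<subseteq> Some -` D \<inter> ball z0 e"
    proof -
      have "Some (f w) \<in> D \<and> f w \<in> ball z0 e" if w: "w \<in> half_disc r" for w
        using half_disc_in_domain [of w] half_disc_mono [OF r(2)] r0(2) [of w] w r
        by (auto simp: half_disc_def dist_commute)
      then show ?thesis by auto
    qed
    have "continuous_on (half_disc r) f"
      using bc_facts(6) by (rule continuous_on_subset) (use r in \<open>auto simp: half_disc_def\<close>)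
    then have con: "connected (f ` half_disc r)"
      using connected_continuous_image convex_connected convex_half_disc by blast
    have "\<forall>\<^sub>F t in at_left 1. p0 t \<in> f ` half_disc r"
      using bc_path_near [OF end_path_tendsto [OF p0] side] r by blast
    moreover have "\<forall>\<^sub>F t in at_left 1. ?q t \<in> f ` half_disc R"
      by (rule eventually_mono [OF eventually_at_left_1_ge [OF zero_less_one]]) (use hd in blast)
    then have "\<forall>\<^sub>F t in at_left 1. ?q t \<in> f ` half_disc r"
      using bc_path_near [OF end_path_tendsto [OF q]] r by blast
    ultimately have "\<forall>\<^sub>F t in at_left 1. p0 t \<in> f ` half_disc r \<and> ?q t \<in> f ` half_disc r"
      by (rule eventually_conj)
    then obtain s where s: "s \<in> {0..<1}" "\<And>t. t \<in> {s..<1} \<Longrightarrow> p0 t \<in> f ` half_disc r \<and> ?q t \<in> f ` half_disc r"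
      using eventually_at_left_1_obtain by blast
    show ?thesis
    proof (intro bexI [of _ s] ballI s(1))
      fix t t' assume "t \<in> {s..<1}" "t' \<in> {s..<1}"
      then have "p0 t \<in> f ` half_disc r" "?q t' \<in> f ` half_disc r" using s(2) by blast+
      then show "connected_component (Some -` D \<inter> ball z0 e) (p0 t) (?q t')"
        unfolding connected_component_def using con sub by blast
    qed
  qed
  then show ?thesis using p0 q by (simp add: end_equiv_def)
qed

text \<open>A point of \<open>E\<close> in a small half disc would be joined to the accessible point
  by the image of a segment, and such a curve is short because \<open>f\<close> is Lipschitz near
  0.\<close>

lemma half_disc_avoids:
  assumes E: "inner_distance E (end_equiv D z0 `` {p0}) > 0"
  obtains r where "0 < r" "r \<le> R" "\<And>\<zeta>. \<zeta> \<in> half_disc r \<Longrightarrow> Some (f \<zeta>) \<notin> E"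
proof -
  have "deriv f holomorphic_on ball 0 R" using bc_facts(2) holomorphic_deriv by blast
  then have "continuous_on (cball 0 (R/2)) (deriv f)"
    using bc_facts(1) by (intro holomorphic_on_imp_continuous_on) (auto elim!: holomorphic_on_subset)
  then have "bounded (deriv f ` cball 0 (R/2))"
    using compact_continuous_image compact_imp_bounded compact_cball by blast
  then obtain B where B: "B > 0" "\<And>w. w \<in> cball 0 (R/2) \<Longrightarrow> norm (deriv f w) \<le> B"
    unfolding bounded_pos by auto
  have lip: "norm (f x - f y) \<le> B * norm (x - y)" if "x \<in> cball 0 (R/2)" "y \<in> cball 0 (R/2)" for x y
  proof (rule field_differentiable_bound [OF convex_cball])
    fix w assume w: "w \<in> cball (0::complex) (R/2)"
    then have "w \<in> ball 0 R" using bc_facts(1) by auto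
    then show "(f has_field_derivative deriv f w) (at w within cball 0 (R/2))"
      using holomorphic_derivI [OF bc_facts(2) open_ball] has_field_derivative_at_within by blast
  qed (use that B in auto)
  \<comment> \<open>A finite number below the distance; when the distance is infinite, as for empty
    \<open>E\<close>, any positive value serves.\<close>
  obtain m where m: "m > 0" "ennreal m < inner_distance E (end_equiv D z0 `` {p0})"
  proof (cases "inner_distance E (end_equiv D z0 `` {p0})")
    case (real x)
    then have "x > 0" using E by simp
    then show thesis using that [of "x/2"] real by (simp add: ennreal_less_iff)
  next
    case top
    then show thesis using that [of 1] by simp
  qed
  \<comment> \<open>The image of the segment from \<open>\<zeta>\<close> to 0 has length at most
    \<open>B * norm \<zeta>\<close>, which is at most \<open>m\<close> for this \<open>r\<close>;
    \<open>R/2\<close> is the radius of the Lipschitz bound.\<close>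
  define r where "r = min (R/2) (m / B)"
  have r: "0 < r" "r \<le> R/2" "r * B \<le> m" using bc_facts(1) m B by (auto simp: r_def min_def field_simps)
  have "Some (f \<zeta>) \<notin> E" if \<zeta>: "\<zeta> \<in> half_disc r" for \<zeta>
  proof
    assume fE: "Some (f \<zeta>) \<in> E"
    let ?q = "\<lambda>t. f (of_real (1 - t) * \<zeta>)"
    have n: "norm \<zeta> < r" using \<zeta> by (simp add: half_disc_def)
    have "\<zeta> \<in> half_disc R" using \<zeta> r half_disc_mono [of r R] bc_facts(1) by auto
    then have "(p0, ?q) \<in> end_equiv D z0" by (rule segment_end_equiv)
    then have "inner_distance E (end_equiv D z0 `` {p0}) \<le> curve_length ?q"
      unfolding inner_distance_def using fE by (intro INF_lower) (auto simp: pathstart_def)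
    also have "curve_length ?q \<le> ennreal m"
      unfolding curve_length_def
    proof (rule SUP_least)
      fix ns :: "nat \<times> (nat \<Rightarrow> real)" assume a: "ns \<in> {(n, s). mono s \<and> range s \<subseteq> {0..1}}"
      obtain k s where ns: "ns = (k, s)" by force
      then have s: "mono s" "range s \<subseteq> {0..1}" using a by auto
      then have s: "mono s" "\<And>i. s i \<in> {0..1}" by blast+
      have c: "of_real (1 - s i) * \<zeta> \<in> cball 0 (R/2)" for i
      proof -
        have "\<bar>1 - s i\<bar> * norm \<zeta> \<le> 1 * norm \<zeta>" using s(2) [of i] by (intro mult_right_mono) auto
        then show ?thesis using n r by (simp add: norm_mult del: of_real_diff)
      qed
      have "dist (?q (s i)) (?q (s (Suc i))) \<le> B * norm \<zeta> * (s (Suc i) - s i)" for i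
      proof -
        have "dist (?q (s i)) (?q (s (Suc i))) \<le> B * norm (of_real (1 - s i) * \<zeta> - of_real (1 - s (Suc i)) * \<zeta>)"
          unfolding dist_norm by (rule lip [OF c c])
        also have "of_real (1 - s i) * \<zeta> - of_real (1 - s (Suc i)) * \<zeta> = of_real (s (Suc i) - s i) * \<zeta>"
          by (simp add: algebra_simps)
        also have "norm \<dots> = (s (Suc i) - s i) * norm \<zeta>"
          using monoD [OF s(1), of i "Suc i"] by (simp add: norm_mult del: of_real_diff)
        finally show ?thesis by (simp add: mult_ac)
      qed
      then have "(\<Sum>i<k. dist (?q (s i)) (?q (s (Suc i)))) \<le> (\<Sum>i<k. B * norm \<zeta> * (s (Suc i) - s i))"
        by (rule sum_mono)
      also have "\<dots> = B * norm \<zeta> * (s k - s 0)"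
        by (simp add: sum_distrib_left [symmetric] sum_lessThan_telescope)
      also have "\<dots> \<le> B * norm \<zeta> * 1"
        using s(2) [of k] s(2) [of 0] B by (intro mult_left_mono) auto
      also have "B * norm \<zeta> * 1 \<le> B * r"
        using mult_left_mono [of "norm \<zeta>" r B] n B(1) by simp
      also have "\<dots> \<le> m" using r(3) by (simp add: mult.commute)
      finally show "(case ns of (n, s) \<Rightarrow> ennreal (\<Sum>i<n. dist (?q (s i)) (?q (s (Suc i))))) \<le> ennreal m"
        by (simp add: ns ennreal_leI del: of_real_diff)
    qed
    finally show False using m by simp
  qed
  then show thesis using that [of r] r bc_facts(1) by auto
qed

end

end

lemma component_at_connected:
  assumes "connectedin extended_plane D" "Some z \<in> D"
  shows "component_at D z = D"
proof -
  have "connected_component_of (subtopology extended_plane D) (Some z) x" if "x \<in> D" for x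
    unfolding connected_component_of_def using assms that by (auto simp: connectedin_subtopology)
  then show ?thesis
    using component_at_subset [of D z] by (auto simp: component_at_def)
qed

lemma component_at_eq:
  assumes "connectedin extended_plane (Some ` C)" "Some ` C \<subseteq> X" "z \<in> C" "w \<in> C"
  shows "component_at X z = component_at X w"
proof -
  have "connected_component_of (subtopology extended_plane X) (Some z) (Some w)"
    unfolding connected_component_of_def using assms by (intro exI [of _ "Some ` C"]) (auto simp: connectedin_subtopology)
  then show ?thesis
    unfolding component_at_def by (metis connected_component_of_equiv)
qed

lemma mem_component_at:
  assumes "Some z \<in> X" shows "Some z \<in> component_at X z"
proof -
  have "Some z \<in> topspace (subtopology extended_plane X)" using assms by simp
  then show ?thesis by (simp add: component_at_def connected_component_of_refl)
qed

section \<open>The quotient of the inner radii in a half disc\<close>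

theorem inner_radius_quotient:
  assumes D: "plane_domain D" and bc: "boundary_coordinate D z0 f R"
    and p0: "p0 \<in> end_paths D z0" "\<forall>\<^sub>F t in at_left 1. p0 t \<in> f ` half_disc R"
    and E: "closedin (subtopology extended_plane D) E" "inner_distance E (end_equiv D z0 `` {p0}) > 0"
  obtains h r k where "0 < r" "r \<le> R" "k \<ge> 0"
    "\<And>\<zeta>. \<zeta> \<in> half_disc r \<Longrightarrow> 0 \<le> h \<zeta> \<and> inner_radius (D - E) (f \<zeta>) / inner_radius D (f \<zeta>) = exp (- h \<zeta>)"
    "((\<lambda>\<zeta>. h \<zeta> / (Im \<zeta>)\<^sup>2) \<longlongrightarrow> k) (at 0 within half_disc r)"
proof -
  have oD: "openin extended_plane D" and cD: "connectedin extended_plane D"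
    using D by (auto simp: plane_domain_def)
  note F = bc_facts [OF oD bc]
  have fr: "D \<inter> extended_plane frontier_of D = {}" using openin_Int_frontier [OF oD] .
  \<comment> \<open>A boundary subarc, the image of the segment from \<open>R/4\<close> to
    \<open>R/2\<close>, away from \<open>z0\<close>; the bounded chart lives on its complement,
    which contains \<open>D\<close>.\<close>
  define \<beta> where "\<beta> t = f (of_real (R/4 + t * (R/4)))" for t
  have line: "of_real (R/4 + t * (R/4)) \<in> ball (0::complex) R" "norm (of_real (R/4 + t * (R/4)) :: complex) \<ge> R/4"
    if t: "t \<in> {0..1}" for t
  proof -
    have "0 \<le> t * (R/4)" "t * (R/4) \<le> 1 * (R/4)"
      using t F(1) by (auto intro!: mult_right_mono)
    then have "norm (of_real (R/4 + t * (R/4)) :: complex) = R/4 + t * (R/4)" "R/4 + t * (R/4) < R"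
      using F(1) unfolding norm_of_real by linarith+
    then show "of_real (R/4 + t * (R/4)) \<in> ball (0::complex) R" "norm (of_real (R/4 + t * (R/4)) :: complex) \<ge> R/4"
      using \<open>0 \<le> t * (R/4)\<close> by (simp_all del: of_real_add of_real_mult of_real_divide)
  qed
  have arc: "arc \<beta>"
    unfolding arc_def path_def
  proof
    show "continuous_on {0..1} \<beta>"
      unfolding \<beta>_def by (rule continuous_on_compose2 [OF F(6)]) (use line in \<open>auto intro!: continuous_intros simp del: of_real_add of_real_mult of_real_divide\<close>)
    show "inj_on \<beta> {0..1}"
    proof (rule inj_onI)
      fix x y assume a: "x \<in> {0..1}" "y \<in> {0..1}" "\<beta> x = \<beta> y"
      have "of_real (R/4 + x * (R/4)) = (of_real (R/4 + y * (R/4)) :: complex)"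
        by (rule bc_inject [OF oD bc _ line(1) [OF a(1)] line(1) [OF a(2)]]) (use a(3) in \<open>simp only: \<beta>_def\<close>)
      then have "R/4 + x * (R/4) = R/4 + y * (R/4)" by (simp only: of_real_eq_iff)
      then show "x = y" using F(1) by simp
    qed
  qed
  have \<beta>_frontier: "Some x \<in> extended_plane frontier_of D" if x: "x \<in> path_image \<beta>" for x
  proof -
    obtain t where t: "t \<in> {0..1}" "x = \<beta> t" using x by (auto simp: path_image_def)
    have "Im (of_real (R/4 + t * (R/4))) = 0" by (rule Im_complex_of_real)
    then show ?thesis using F(5) [OF line(1) [OF t(1)]] t(2) by (simp only: \<beta>_def)
  qed
  have \<beta>D: "D \<subseteq> - Some ` path_image \<beta>" using \<beta>_frontier fr by blast
  define b where "b = \<beta> 0"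
  have b\<beta>: "b \<in> path_image \<beta>" by (auto simp: b_def path_image_def)
  define W where "W = point_chart b -` (- Some ` path_image \<beta>)"
  obtain q d where chart: "bounded_chart W q d"
    using bounded_chart_exists [OF arc] unfolding W_def b_def by blast
  interpret bounded_chart b W q d by (rule chart)
  have sub_ok: "Some b \<notin> X" "point_chart b -` X \<subseteq> W" if "X \<subseteq> D" for X
    using that \<beta>D b\<beta> by (auto simp: W_def)
  have oX: "openin extended_plane (D - E)"
  proof -
    obtain T where "closedin extended_plane T" "E = T \<inter> D"
      using E(1) unfolding closedin_subtopology by blast
    then have "D - E = D - T" by blast
    then show ?thesis using oD \<open>closedin extended_plane T\<close> by (simp add: openin_diff)
  qed
  obtain r1 where r1: "0 < r1" "r1 \<le> R" "\<And>\<zeta>. \<zeta> \<in> half_disc r1 \<Longrightarrow> Some (f \<zeta>) \<notin> E"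
    using half_disc_avoids [OF oD bc p0 E(2)] by blast
  \<comment> \<open>The bound \<open>R/4\<close> keeps the small disc off the subarc, and
    \<open>r1\<close> keeps the half disc off \<open>E\<close>.\<close>
  define r where "r = min r1 (R/4)"
  have r: "0 < r" "r \<le> R" "r \<le> r1" "r \<le> R/4" using r1 F(1) by (auto simp: r_def)
  have ballR: "\<zeta> \<in> ball 0 R" if "\<zeta> \<in> ball 0 r" for \<zeta> :: complex using that r by auto
  have off: "f \<zeta> \<notin> path_image \<beta>" if \<zeta>: "\<zeta> \<in> ball 0 r" for \<zeta>
  proof
    assume "f \<zeta> \<in> path_image \<beta>"
    then obtain t where t: "t \<in> {0..1}" "f \<zeta> = f (of_real (R/4 + t * (R/4)))" by (auto simp: path_image_def \<beta>_def)
    have "\<zeta> = of_real (R/4 + t * (R/4))"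
      by (rule bc_inject [OF oD bc t(2) ballR [OF \<zeta>] line(1) [OF t(1)]])
    then show False using line(2) [OF t(1)] \<zeta> r(4) by simp
  qed
  have neb: "f \<zeta> \<noteq> b" if "\<zeta> \<in> ball 0 r" for \<zeta> using off [OF that] b\<beta> by auto
  have pc: "point_chart b (inverse (f \<zeta> - b)) = Some (f \<zeta>)" if "\<zeta> \<in> ball 0 r" for \<zeta>
    using neb [OF that] by (simp add: point_chart_def)
  have inW: "inverse (f \<zeta> - b) \<in> W" if "\<zeta> \<in> ball 0 r" for \<zeta>
    using pc [OF that] off [OF that] by (auto simp: W_def)
  define f' where "f' \<zeta> = coord (f \<zeta>)" for \<zeta>
  have hf': "f' holomorphic_on ball 0 r"
  proof -
    have "f holomorphic_on ball 0 r"
      using F(2) by (rule holomorphic_on_subset) (use ballR in auto)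
    then have "(\<lambda>\<zeta>. inverse (f \<zeta> - b)) holomorphic_on ball 0 r"
      by (intro holomorphic_intros) (use neb in auto)
    then have "q \<circ> (\<lambda>\<zeta>. inverse (f \<zeta> - b)) holomorphic_on ball 0 r"
      by (rule holomorphic_on_compose_gen [OF _ holo_q]) (use inW in blast)
    then show ?thesis by (simp add: f'_def [abs_def] coord_def o_def)
  qed
  have inj_f': "inj_on f' (ball 0 r)"
  proof (rule inj_onI)
    fix x y assume a: "x \<in> ball 0 r" "y \<in> ball 0 r" "f' x = f' y"
    then have "q (inverse (f x - b)) = q (inverse (f y - b))" by (simp only: f'_def coord_def)
    then have "inverse (f x - b) = inverse (f y - b)"
      using inj_onD [OF inj_q _ inW [OF a(1)] inW [OF a(2)]] by blast
    then have "f x = f y" by simp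
    then show "x = y" using bc_inject [OF oD bc] ballR a by blast
  qed
  have halfR: "\<zeta> \<in> half_disc R" "\<zeta> \<in> half_disc r1" "\<zeta> \<in> ball 0 r" if "\<zeta> \<in> half_disc r" for \<zeta>
    using that r by (auto simp: half_disc_def)
  have inD: "Some (f \<zeta>) \<in> D" and inX: "Some (f \<zeta>) \<in> D - E" if "\<zeta> \<in> half_disc r" for \<zeta>
    using half_disc_in_domain [OF oD bc p0] r1(3) halfR [OF that] by auto
  define \<zeta>0 where "\<zeta>0 = \<i> * of_real (r / 2)"
  have \<zeta>0: "\<zeta>0 \<in> half_disc r" using r by (simp add: \<zeta>0_def half_disc_def norm_mult)
  \<comment> \<open>The image of the half disc is connected and avoids \<open>E\<close>, so one
    component of \<open>D - E\<close> serves for every pole in it.\<close>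
  define C where "C = component_at (D - E) (f \<zeta>0)"
  have C_eq: "component_at (D - E) (f \<zeta>) = C" if "\<zeta> \<in> half_disc r" for \<zeta>
  proof -
    have "continuous_on (half_disc r) f"
      using F(6) by (rule continuous_on_subset) (use halfR ballR in blast)
    then have "connected (f ` half_disc r)"
      using connected_continuous_image convex_connected convex_half_disc by blast
    then have "connectedin extended_plane (Some ` f ` half_disc r)"
      by (intro connectedin_continuous_map_image [OF continuous_map_Some]) simp
    then show ?thesis
      unfolding C_def by (rule component_at_eq) (use inX that \<zeta>0 in auto)
  qed
  have CX: "C \<subseteq> D - E" by (simp add: C_def component_at_subset)
  have admD: "admissible D"
    using sub_ok [of D] open_vimage_point_chart [OF oD] by (simp add: admissible_def)
  have admC: "admissible C"
    using sub_ok [of C] CX open_vimage_component [OF oX] by (auto simp: admissible_def C_def)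
  have memC: "Some (f \<zeta>) \<in> C" if "\<zeta> \<in> half_disc r" for \<zeta>
    using mem_component_at [OF inX [OF that]] C_eq [OF that] by simp
  interpret large: bounded_open "image_of D" d by (rule bounded_open_image [OF admD])
  interpret small: bounded_open "image_of C" d by (rule bounded_open_image [OF admC])
  interpret nested_domains "image_of D" "image_of C" d f' r
  proof unfold_locales
    show "image_of C \<subseteq> image_of D" using CX by (auto simp: image_of_def)
    show "f' ` half_disc r \<subseteq> image_of C"
      using coord_mem(3) [OF admC memC] by (auto simp: f'_def)
    fix \<zeta> :: complex assume \<zeta>: "\<zeta> \<in> ball 0 r" "Im \<zeta> = 0"
    show "f' \<zeta> \<notin> image_of D"
    proof
      assume "f' \<zeta> \<in> image_of D"
      then obtain w where w: "point_chart b w \<in> D" "q (inverse (f \<zeta> - b)) = q w"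
        by (auto simp: image_of_def f'_def coord_def)
      then have "w \<in> W" using sub_ok(2) [of D] by auto
      then have "inverse (f \<zeta> - b) = w" using inj_onD [OF inj_q w(2) inW [OF \<zeta>(1)]] by blast
      then have "Some (f \<zeta>) \<in> D" using w(1) pc [OF \<zeta>(1)] by simp
      then show False using F(5) [OF ballR [OF \<zeta>(1)]] \<zeta>(2) fr by blast
    qed
  qed (use r hf' inj_f' in auto)
  obtain k where k: "k \<ge> 0" "((\<lambda>\<zeta>. gap \<zeta> \<zeta> / (Im \<zeta>)\<^sup>2) \<longlongrightarrow> k) (at 0 within half_disc r)"
    using gap_quadratic by blast
  have "inner_radius (D - E) (f \<zeta>) / inner_radius D (f \<zeta>) = exp (- gap \<zeta> \<zeta>)" if \<zeta>: "\<zeta> \<in> half_disc r" for \<zeta>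
  proof -
    have "inner_radius (D - E) (f \<zeta>) = exp (log_majorant (image_of C) (f' \<zeta>) (f' \<zeta>) - ln (cmod (deriv coord (f \<zeta>))))"
      using inner_radius_chart [OF oX sub_ok inX [OF \<zeta>]] C_eq [OF \<zeta>] by (simp add: f'_def)
    moreover have "inner_radius D (f \<zeta>) = exp (log_majorant (image_of D) (f' \<zeta>) (f' \<zeta>) - ln (cmod (deriv coord (f \<zeta>))))"
      using inner_radius_chart [OF oD sub_ok inD [OF \<zeta>]] component_at_connected [OF cD inD [OF \<zeta>]] by (simp add: f'_def)
    ultimately show ?thesis
      using \<zeta> by (simp add: gap_def half_disc_def flip: exp_diff)
  qed
  then show thesis
    using that [of r k "\<lambda>\<zeta>. gap \<zeta> \<zeta>"] r k gap_nonneg by blast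
qed

section \<open>The expansion along a perpendicular path\<close>

theorem theorem2p1:
  fixes D E :: "complex option set" and z0 :: complex and a :: "(real \<Rightarrow> complex) set"
  assumes "plane_domain D"
    and "a \<in> accessible_points D z0"
    and "\<exists>\<gamma>. boundary_arc_near D z0 \<gamma>"
    and "E \<subseteq> D" and "closedin (subtopology extended_plane D) E"
    and "inner_distance E a > 0"
  shows "\<exists>c::real. c \<ge> 0 \<and>
    (\<forall>\<gamma> p. boundary_arc_near D z0 \<gamma> \<longrightarrow> p \<in> a \<longrightarrow> ends_perpendicular_to p \<gamma> z0 \<longrightarrow>
      (\<lambda>t. inner_radius (D - E) (p t) / inner_radius D (p t)
             - (1 - c * (cmod (p t - z0))\<^sup>2))
        \<in> o[at_left 1](\<lambda>t. (cmod (p t - z0))\<^sup>2))"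
proof -
  have oD: "openin extended_plane D" using assms(1) by (simp add: plane_domain_def)
  obtain p0 where p0: "p0 \<in> end_paths D z0" "a = end_equiv D z0 `` {p0}"
    using assms(2) unfolding accessible_points_def by (rule quotientE)
  \<comment> \<open>The representative \<open>p0\<close> eventually stays on one side of the axis;
    if this is the lower one, the coordinate is turned by
    \<open>\<zeta> \<mapsto> - \<zeta>\<close>.\<close>
  obtain f R where bc: "boundary_coordinate D z0 f R" and side: "\<forall>\<^sub>F t in at_left 1. p0 t \<in> f ` half_disc R"
  proof -
    obtain f R where f: "boundary_coordinate D z0 f R"
      using assms(3) boundary_coordinate_exists by blast
    from bc_path_side [OF oD f p0(1)] show thesis
      using that [OF f] that [OF boundary_coordinate_flip [OF f]] by blast
  qed
  note F = bc_facts [OF oD bc]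
  have "inner_distance E (end_equiv D z0 `` {p0}) > 0" using assms(6) p0(2) by simp
  then obtain h r k where r: "0 < r" "r \<le> R" and k: "k \<ge> 0"
    and h: "\<And>\<zeta>. \<zeta> \<in> half_disc r \<Longrightarrow> 0 \<le> h \<zeta> \<and> inner_radius (D - E) (f \<zeta>) / inner_radius D (f \<zeta>) = exp (- h \<zeta>)"
    and lim: "((\<lambda>\<zeta>. h \<zeta> / (Im \<zeta>)\<^sup>2) \<longlongrightarrow> k) (at 0 within half_disc r)"
    by (rule inner_radius_quotient [OF assms(1) bc p0(1) side assms(5)]) (rule that)
  have Rb: "(0::complex) \<in> ball 0 R" using F(1) by simp
  define A where "A = deriv f 0"
  have dA: "(f has_field_derivative A) (at 0)" "A \<noteq> 0"
    unfolding A_def using holomorphic_derivI [OF F(2) open_ball Rb] holomorphic_injective_imp_regular [OF F(2) open_ball F(3) Rb] by auto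
  show ?thesis
  \<comment> \<open>Both \<open>k\<close> and \<open>A\<close> were fixed before any arc or path was
    chosen, so one constant serves for all of them. The division by \<open>|A|^2\<close> converts
    \<open>Im \<zeta>\<close> into the distance to \<open>z0\<close>.\<close>
  proof (intro exI [of _ "k / (cmod A)\<^sup>2"] conjI allI impI)
    show "0 \<le> k / (cmod A)\<^sup>2" using k by simp
    fix \<gamma> p assume \<gamma>: "boundary_arc_near D z0 \<gamma>" and pa: "p \<in> a" and perp: "ends_perpendicular_to p \<gamma> z0"
    have eqv: "(p0, p) \<in> end_equiv D z0" using pa p0(2) by simp
    then have p: "p \<in> end_paths D z0" by (simp add: end_equiv_def)
    have near: "\<forall>\<^sub>F t in at_left 1. p t \<in> f ` half_disc s" if "0 < s" "s \<le> R" for s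
      using bc_path_near [OF oD bc end_path_tendsto [OF p] bc_equivalent_path_side [OF oD bc eqv side]] that by blast
    define \<zeta> where "\<zeta> t = inv_into (ball 0 R) f (p t)" for t
    have \<zeta>: "\<forall>\<^sub>F t in at_left 1. \<zeta> t \<in> half_disc s \<and> f (\<zeta> t) = p t" if s: "0 < s" "s \<le> R" for s
      using near [OF s]
    proof eventually_elim
      case (elim t)
      then obtain \<xi> where \<xi>: "\<xi> \<in> half_disc s" "p t = f \<xi>" by blast
      then have "\<xi> \<in> ball 0 R" using s by (auto simp: half_disc_def)
      then have "\<zeta> t = \<xi>" using \<xi>(2) F(3) by (simp add: \<zeta>_def)
      then show ?case using \<xi> by simp
    qed
    have \<zeta>r: "\<forall>\<^sub>F t in at_left 1. \<zeta> t \<in> half_disc r \<and> f (\<zeta> t) = p t" using \<zeta> r by blast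
    have \<zeta>lim: "(\<zeta> \<longlongrightarrow> 0) (at_left 1)"
    proof (rule tendstoI)
      fix e :: real assume e: "e > 0"
      have "\<forall>\<^sub>F t in at_left 1. \<zeta> t \<in> half_disc (min e R) \<and> f (\<zeta> t) = p t"
        using e F(1) by (intro \<zeta>) auto
      then show "\<forall>\<^sub>F t in at_left 1. dist (\<zeta> t) 0 < e"
        by eventually_elim (simp add: half_disc_def)
    qed
    have \<zeta>0: "filterlim \<zeta> (at 0) (at_left 1)" "filterlim \<zeta> (at 0 within half_disc r) (at_left 1)"
      unfolding filterlim_at using \<zeta>lim \<zeta>r by (auto elim!: eventually_mono simp: half_disc_def)
    obtain t0 v where t0: "t0 \<in> {0<..<1}" "\<gamma> t0 = z0"
      and v: "((\<lambda>t. sgn (p t - z0)) \<longlongrightarrow> v) (at_left 1)" "v \<bullet> vector_derivative \<gamma> (at t0) = 0"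
      using perp unfolding ends_perpendicular_to_def by blast
    obtain m :: real where m: "m \<noteq> 0" "vector_derivative \<gamma> (at t0) = of_real m * A"
      using boundary_coordinate_tangent [OF bc \<gamma> t0] unfolding A_def by blast
    have vA: "v \<bullet> A = 0"
      using v(2) m by (simp flip: scaleR_conv_of_real)
    have v': "((\<lambda>t. sgn (f (\<zeta> t) - f 0)) \<longlongrightarrow> v) (at_left 1)"
      by (rule Lim_transform_eventually [OF v(1)]) (use \<zeta>r F(4) in \<open>auto elim: eventually_mono\<close>)
    have "((\<lambda>t. Im (\<zeta> t) / cmod (f (\<zeta> t) - f 0)) \<longlongrightarrow> 1 / cmod A) (at_left 1)"
      by (rule perpendicular_approach [OF dA \<zeta>0(1) _ trivial_limit_at_left_real v' vA])
        (use \<zeta>r in \<open>auto elim: eventually_mono simp: half_disc_def\<close>)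
    then have y: "((\<lambda>t. Im (\<zeta> t) / cmod (p t - z0)) \<longlongrightarrow> 1 / cmod A) (at_left 1)"
      by (rule Lim_transform_eventually) (use \<zeta>r F(4) in \<open>auto elim: eventually_mono\<close>)
    have "((\<lambda>t. h (\<zeta> t) / (Im (\<zeta> t))\<^sup>2 * (Im (\<zeta> t) / cmod (p t - z0))\<^sup>2) \<longlongrightarrow> k * (1 / cmod A)\<^sup>2) (at_left 1)"
      by (intro tendsto_intros y filterlim_compose [OF lim \<zeta>0(2)])
    then have hn: "((\<lambda>t. h (\<zeta> t) / (cmod (p t - z0))\<^sup>2) \<longlongrightarrow> k / (cmod A)\<^sup>2) (at_left 1)"
    proof (rule Lim_transform_eventually [THEN tendsto_eq_rhs])
      show "\<forall>\<^sub>F t in at_left 1. h (\<zeta> t) / (Im (\<zeta> t))\<^sup>2 * (Im (\<zeta> t) / cmod (p t - z0))\<^sup>2 = h (\<zeta> t) / (cmod (p t - z0))\<^sup>2"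
        using \<zeta>r by eventually_elim (auto simp: half_disc_def power_divide)
    qed (simp add: power_divide)
    have n0: "((\<lambda>t. cmod (p t - z0)) \<longlongrightarrow> 0) (at_left 1)"
      using end_path_tendsto [OF p] by (simp add: tendsto_norm_zero_iff LIM_zero)
    have pos: "\<forall>\<^sub>F t in at_left 1. 0 \<le> h (\<zeta> t) \<and> 0 < cmod (p t - z0)"
      using \<zeta>r
    proof eventually_elim
      case (elim t)
      have "p t \<noteq> z0"
      proof
        assume "p t = z0"
        then have "\<zeta> t = 0" using bc_inject [OF oD bc, of "\<zeta> t" 0] elim F(1,4) r by (auto simp: half_disc_def)
        then show False using elim by (simp add: half_disc_def)
      qed
      then show ?case using h elim by simp
    qed
    have sm: "(\<lambda>t. exp (- h (\<zeta> t)) - (1 - k / (cmod A)\<^sup>2 * (cmod (p t - z0))\<^sup>2)) \<in> o[at_left 1](\<lambda>t. (cmod (p t - z0))\<^sup>2)"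
      by (rule exp_expansion [OF hn n0 pos])
    have ev: "\<forall>\<^sub>F t in at_left 1. exp (- h (\<zeta> t)) - (1 - k / (cmod A)\<^sup>2 * (cmod (p t - z0))\<^sup>2) =
        inner_radius (D - E) (p t) / inner_radius D (p t) - (1 - k / (cmod A)\<^sup>2 * (cmod (p t - z0))\<^sup>2)"
      using \<zeta>r
    proof eventually_elim
      case (elim t)
      then show ?case using h [of "\<zeta> t"] by simp
    qed
    show "(\<lambda>t. inner_radius (D - E) (p t) / inner_radius D (p t)
             - (1 - k / (cmod A)\<^sup>2 * (cmod (p t - z0))\<^sup>2)) \<in> o[at_left 1](\<lambda>t. (cmod (p t - z0))\<^sup>2)"
      by (rule landau_o.small.in_cong [OF ev, THEN iffD1, OF sm])
  qed
qed

end
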